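(* Let $e,\varepsilon\in\{\pm1\}$. Assume either that $e\varepsilon=-1$ and $i_+$ is an end vertex, or that $e\varepsilon=1$ and $i_-$ is an end vertex. Then for all $i\in\widehat I$ the operators $T'_{i,e}$ (respectively $T''_{i,e}$) on $\mathbf U_I$ and on $\mathbf U_{\widehat I}$ are compatible under $\Psi_\varepsilon$, that is, $$\Psi_\varepsilon(T'_{i,e}(u))=T'_{i,e}(\Psi_\varepsilon(u)),\qquad \Psi_\varepsilon(T''_{i,e}(u))=T''_{i,e}(\Psi_\varepsilon(u))\qquad(u\in\mathbf U_{\widehat I}),$$ where on the right-hand sides, for $i=i_0$, $T'_{i_0,e}=\chi_{i_0,e\varepsilon}\tilde T'_{i_0,e}$ and $T''_{i_0,e}=\chi_{i_0,-e\varepsilon}\tilde T''_{i_0,e}$.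
   Context: A Cartan datum $(I,\cdot)$ is a finite set $I$ with a $\mathbb Z$-valued symmetric bilinear form $\cdot$ on $\mathbb Z[I]$ such that $i\cdot i\in\{2,4,6,\dots\}$ and $2\frac{i\cdot j}{i\cdot i}\in\{0,-1,-2,\dots\}$ for $i\neq j$ in $I$. Fix $i_+,i_-\in I$ with $i_+\cdot i_+=i_-\cdot i_-=-2\,i_+\cdot i_-$. Put $i_0=i_++i_-$, $\widehat I=(I\setminus\{i_+,i_-\})\cup\{i_0\}$; with the restricted form $(\widehat I,\cdot)$ is a Cartan datum (the edge contraction). $i_+$ (resp. $i_-$) is an end vertex if $i_+\cdot j=0$ (resp. $i_-\cdot j=0$) for all $j\in I\setminus\{i_+,i_-\}$. A root datum of type $(I,\cdot)$: finitely generated free abelian groups $Y,X$, a perfect pairing $\langle\,,\rangle:Y\times X\to\mathbb Z$, embeddings $I\hookrightarrow Y$, $i\mapsto i$, $I\hookrightarrow X$, $i\mapsto i'$, with $\langle i,j'\rangle=2\frac{i\cdot j}{i\cdot i}$. Fix one; the same $Y,X$ with $i_0\mapsto i_++i_-\in Y$, $i_0'=i_+'+i_-'$ is a root datum of type $(\widehat I,\cdot)$. Let $v$ be an indeterminate, $v_i=v^{i\cdot i/2}$, $[n]_i=\frac{v_i^n-v_i^{-n}}{v_i-v_i^{-1}}$, $x_i^{(n)}=x_i^n/[n]_i^!$. $\mathbf U_I$ is the $\mathbb Q(v)$-algebra with generators $E_i,F_i$ ($i\in I$), $K_\mu$ ($\mu\in Y$) and relations $K_0=1$, $K_\mu K_{\mu'}=K_{\mu+\mu'}$,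 $K_\mu E_i=v^{\langle\mu,i'\rangle}E_iK_\mu$, $K_\mu F_i=v^{-\langle\mu,i'\rangle}F_iK_\mu$, $E_iF_j-F_jE_i=\delta_{ij}\frac{\tilde K_i-\tilde K_i^{-1}}{v_i-v_i^{-1}}$ with $\tilde K_i=K_{\frac{i\cdot i}{2}i}$ (so $\tilde K_{ei}=\tilde K_i^{e}$), and $\sum_{r+s=1-\langle i,j'\rangle}(-1)^rx_i^{(s)}x_jx_i^{(r)}=0$ for $x=E,F$, $i\neq j$. $\mathbf U_{\widehat I}$ is the analogue for $\widehat I$; generators $\widehat E_i,\widehat F_i,\widehat K_\mu$. $E_{i_0,\varepsilon}=E_{i_+}E_{i_-}-v_{i_0}^{-\varepsilon}E_{i_-}E_{i_+}$, $F_{i_0,\varepsilon}=F_{i_-}F_{i_+}-v_{i_0}^{\varepsilon}F_{i_+}F_{i_-}$; $\Psi_\varepsilon:\mathbf U_{\widehat I}\to\mathbf U_I$ is the algebra embedding $\widehat E_i\mapsto E_i$, $\widehat F_i\mapsto F_i$ ($i\ne i_0$), $\widehat K_\mu\mapsto K_\mu$, $\widehat E_{i_0}\mapsto E_{i_0,\varepsilon}$, $\widehat F_{i_0}\mapsto F_{i_0,\varepsilon}$, and $\mathbf V_{\widehat I,\varepsilon}=\Psi_\varepsilon(\mathbf U_{\widehat I})$. Lusztig's symmetries (for $\mathbf U_I$, $i\in I$; same formulas for $\mathbf U_{\widehat I}$, $i\in\widehat I$): with $s_i(\mu)=\mu-\langle\mu,i'\rangle i$, $T'_{i,e}(K_\mu)=T''_{i,e}(K_\mu)=K_{s_i(\mu)}$;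 $T'_{i,e}(E_i)=-\tilde K_{ei}F_i$, $T'_{i,e}(F_i)=-E_i\tilde K_{-ei}$, $T''_{i,e}(E_i)=-F_i\tilde K_{ei}$, $T''_{i,e}(F_i)=-\tilde K_{-ei}E_i$; and for $j\neq i$, with sums over $r+s=-\langle i,j'\rangle$, $T'_{i,e}(E_j)=\sum(-1)^rv_i^{er}E_i^{(r)}E_jE_i^{(s)}$, $T'_{i,e}(F_j)=\sum(-1)^rv_i^{-er}F_i^{(s)}F_jF_i^{(r)}$, $T''_{i,e}(E_j)=\sum(-1)^rv_i^{-er}E_i^{(s)}E_jE_i^{(r)}$, $T''_{i,e}(F_j)=\sum(-1)^rv_i^{er}F_i^{(r)}F_jF_i^{(s)}$. For $i\in\widehat I\setminus\{i_0\}$ the operators $T'_{i,e},T''_{i,e}$ on $\mathbf U_I$ are these. $\tilde T'_{i_0,e}=T'_{i_+,e}T'_{i_-,e}T'_{i_+,e}$ and $\tilde T''_{i_0,e}=T''_{i_+,e}T''_{i_-,e}T''_{i_+,e}$ on $\mathbf U_I$. The algebra isomorphisms $\chi_{i_0,\pm1}:\mathbf V_{\widehat I,-\varepsilon}\to\mathbf V_{\widehat I,\varepsilon}$ fix all $K_\mu$ and are given by: $\chi_{i_0,-1}$: $E_{i_0,-\varepsilon}\mapsto-v_{i_0}^{\varepsilon}E_{i_0,\varepsilon}$, $F_{i_0,-\varepsilon}\mapsto-v_{i_0}^{-\varepsilon}F_{i_0,\varepsilon}$, $E_j\mapsto E_j$, $F_j\mapsto F_j$; $\chi_{i_0,1}$: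 $E_{i_0,-\varepsilon}\mapsto-v_{i_0}^{-\varepsilon}E_{i_0,\varepsilon}$, $F_{i_0,-\varepsilon}\mapsto-v_{i_0}^{\varepsilon}F_{i_0,\varepsilon}$, $E_j\mapsto(-v_{i_0})^{-\varepsilon\langle i_0,j'\rangle}E_j$, $F_j\mapsto(-v_{i_0})^{\varepsilon\langle i_0,j'\rangle}F_j$ ($j\in\widehat I\setminus\{i_0\}$). Under the hypotheses of the claim, $\tilde T'_{i_0,e}$ and $\tilde T''_{i_0,e}$ map $\mathbf V_{\widehat I,\varepsilon}$ to $\mathbf V_{\widehat I,-\varepsilon}$, so that $T'_{i_0,e}$, $T''_{i_0,e}$ are defined on $\mathbf V_{\widehat I,\varepsilon}$. *)

theory Defs
  imports
    "HOL-Algebra.QuotRing"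
    "HOL-Algebra.Module"
    "HOL-Library.Poly_Mapping"
    "HOL-Computational_Algebra.Fraction_Field"
    "HOL-Computational_Algebra.Polynomial"
begin

definition zscale :: "int \<Rightarrow> 'a::ab_group_add \<Rightarrow> 'a" where
  "zscale n x = (if 0 \<le> n then ((+) x ^^ nat n) 0 else - (((+) x ^^ nat (- n)) 0))"

text \<open>
  The groups \<open>Y\<close> and \<open>X\<close> are the types \<open>'y\<close> and \<open>'x\<close>. The set \<open>I\<close> is \<open>idx D\<close>, and the
  symmetric bilinear form on \<open>\<int>[I]\<close> is recorded by its values \<open>form D i j\<close> on the basis \<open>I\<close>.
  The embeddings \<open>i \<mapsto> i\<close> into \<open>Y\<close> and \<open>i \<mapsto> i'\<close> into \<open>X\<close> are \<open>cor D\<close> and \<open>rt D\<close>.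
\<close>

record ('i, 'y, 'x) root_datum =
  idx :: "'i set"
  form :: "'i \<Rightarrow> 'i \<Rightarrow> int"
  cor :: "'i \<Rightarrow> 'y"
  rt :: "'i \<Rightarrow> 'x"
  pair :: "'y \<Rightarrow> 'x \<Rightarrow> int"

definition cartan_datum :: "'i set \<Rightarrow> ('i \<Rightarrow> 'i \<Rightarrow> int) \<Rightarrow> bool" where
  "cartan_datum I b \<longleftrightarrow> finite I
     \<and> (\<forall>i\<in>I. \<forall>j\<in>I. b i j = b j i)
     \<and> (\<forall>i\<in>I. b i i > 0 \<and> even (b i i))
     \<and> (\<forall>i\<in>I. \<forall>j\<in>I. i \<noteq> j \<longrightarrow> (\<exists>n::nat. 2 * b i j = - int n * b i i))"

definition fg_free :: "'a::ab_group_add itself \<Rightarrow> bool" where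
  "fg_free _ \<longleftrightarrow> (\<exists>n. \<exists>\<phi> :: 'a \<Rightarrow> nat \<Rightarrow> int.
     (\<forall>x y k. \<phi> (x + y) k = \<phi> x k + \<phi> y k) \<and> bij_betw \<phi> UNIV {f. \<forall>k\<ge>n. f k = 0})"

definition perfect_pairing :: "('y::ab_group_add \<Rightarrow> 'x::ab_group_add \<Rightarrow> int) \<Rightarrow> bool" where
  "perfect_pairing p \<longleftrightarrow> (\<forall>y. Modules.additive (p y)) \<and> (\<forall>x. Modules.additive (\<lambda>y. p y x))
     \<and> (\<forall>g. Modules.additive g \<longrightarrow> (\<exists>!y. p y = g))
     \<and> (\<forall>g. Modules.additive g \<longrightarrow> (\<exists>!x. (\<lambda>y. p y x) = g))"

definition is_root_datum :: "('i, 'y::ab_group_add, 'x::ab_group_add) root_datum \<Rightarrow> bool" where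
  "is_root_datum D \<longleftrightarrow> cartan_datum (idx D) (form D)
     \<and> fg_free TYPE('y) \<and> fg_free TYPE('x) \<and> perfect_pairing (pair D)
     \<and> inj_on (cor D) (idx D) \<and> inj_on (rt D) (idx D)
     \<and> (\<forall>i\<in>idx D. \<forall>j\<in>idx D. pair D (cor D i) (rt D j) * form D i i = 2 * form D i j)"

definition contractible :: "('i, 'y, 'x) root_datum \<Rightarrow> 'i \<Rightarrow> 'i \<Rightarrow> bool" where
  "contractible D ip im \<longleftrightarrow> ip \<in> idx D \<and> im \<in> idx D
     \<and> form D ip ip = - 2 * form D ip im \<and> form D im im = - 2 * form D ip im"

definition end_vertex :: "('i, 'y, 'x) root_datum \<Rightarrow> 'i \<Rightarrow> 'i \<Rightarrow> 'i \<Rightarrow> bool" where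
  "end_vertex D ip im i \<longleftrightarrow> (\<forall>j\<in>idx D - {ip, im}. form D i j = 0)"

text \<open>
  The contracted index set consists of \<open>None\<close>, standing for \<open>i\<^sub>0 = i\<^sub>+ + i\<^sub>-\<close>, and of \<open>Some i\<close>
  for \<open>i \<in> I \<setminus> {i\<^sub>+, i\<^sub>-}\<close>. An index \<open>a\<close> denotes the element \<open>\<Sum>p\<in>parts ip im a. p\<close> of \<open>\<int>[I]\<close>,
  and the form and both embeddings are extended additively (note that \<open>i\<^sub>+ \<noteq> i\<^sub>-\<close>, since
  \<open>i\<^sub>+ \<cdot> i\<^sub>- < 0\<close>).
\<close>

fun parts :: "'i \<Rightarrow> 'i \<Rightarrow> 'i option \<Rightarrow> 'i set" where
  "parts ip im None = {ip, im}"
| "parts ip im (Some i) = {i}"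

definition contract ::
    "('i, 'y::ab_group_add, 'x::ab_group_add) root_datum \<Rightarrow> 'i \<Rightarrow> 'i \<Rightarrow> ('i option, 'y, 'x) root_datum" where
  "contract D ip im =
     \<lparr>idx = insert None (Some ` (idx D - {ip, im})),
      form = (\<lambda>a b. \<Sum>p\<in>parts ip im a. \<Sum>q\<in>parts ip im b. form D p q),
      cor = (\<lambda>a. \<Sum>p\<in>parts ip im a. cor D p),
      rt = (\<lambda>a. \<Sum>p\<in>parts ip im a. rt D p),
      pair = pair D\<rparr>"

type_synonym qv = "rat poly fract"

definition vq :: qv where "vq = Fraction_Field.Fract [:0, 1:] 1"

definition vi :: "('i, 'y, 'x) root_datum \<Rightarrow> 'i \<Rightarrow> qv" where
  "vi D i = vq powi (form D i i div 2)"

definition qint :: "('i, 'y, 'x) root_datum \<Rightarrow> 'i \<Rightarrow> nat \<Rightarrow> qv" where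
  "qint D i n = (vi D i powi int n - vi D i powi (- int n)) / (vi D i - inverse (vi D i))"

definition qfact :: "('i, 'y, 'x) root_datum \<Rightarrow> 'i \<Rightarrow> nat \<Rightarrow> qv" where
  "qfact D i n = (\<Prod>k=1..n. qint D i k)"

datatype ('i, 'y) gen = E 'i | F 'i | K 'y

text \<open>Words form a monoid, written additively so that finitely supported functions on words
  with values in \<open>\<rat>(v)\<close> carry the convolution product, i.e. are the free algebra.\<close>

datatype 'g word = Word (letters: "'g list")

instantiation word :: (type) monoid_add
begin
definition zero_word :: "'a word" where "zero_word = Word []"
definition plus_word :: "'a word \<Rightarrow> 'a word \<Rightarrow> 'a word" where
  "plus_word u w = Word (letters u @ letters w)"
instance by standard (auto simp: zero_word_def plus_word_def)
end

type_synonym ('i, 'y) falg = "('i, 'y) gen word \<Rightarrow>\<^sub>0 qv"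

definition scal :: "qv \<Rightarrow> ('i, 'y) falg" where "scal c = Poly_Mapping.single 0 c"

definition gen :: "('i, 'y) gen \<Rightarrow> ('i, 'y) falg" where
  "gen g = Poly_Mapping.single (Word [g]) 1"

definition dpow :: "('i, 'y, 'x) root_datum \<Rightarrow> 'i \<Rightarrow> nat \<Rightarrow> ('i, 'y) falg \<Rightarrow> ('i, 'y) falg" where
  "dpow D i n x = scal (inverse (qfact D i n)) * x ^ n"

text \<open>\<open>Kt D e i\<close> is \<open>K\<close> at \<open>e (i \<cdot> i / 2) i\<close>, so \<open>Kt D (- 1) i\<close> is the inverse of \<open>Kt D 1 i\<close>.\<close>

definition Kt :: "('i, 'y::ab_group_add, 'x) root_datum \<Rightarrow> int \<Rightarrow> 'i \<Rightarrow> ('i, 'y) falg" where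
  "Kt D e i = gen (K (zscale (e * (form D i i div 2)) (cor D i)))"

definition gens :: "('i, 'y, 'x) root_datum \<Rightarrow> ('i, 'y) gen set" where
  "gens D = E ` idx D \<union> F ` idx D \<union> range K"

definition free_alg :: "('i, 'y, 'x) root_datum \<Rightarrow> ('i, 'y) falg ring" where
  "free_alg D = \<lparr>carrier = {p. \<forall>w\<in>Poly_Mapping.keys p. set (letters w) \<subseteq> gens D},
     monoid.mult = (*), one = 1, zero = 0, add = (+)\<rparr>"

definition serre ::
    "('i, 'y, 'x) root_datum \<Rightarrow> ('i \<Rightarrow> ('i, 'y) gen) \<Rightarrow> 'i \<Rightarrow> 'i \<Rightarrow> ('i, 'y) falg" where
  "serre D x i j = (let n = nat (1 - pair D (cor D i) (rt D j)) in
     \<Sum>r\<le>n. (- 1) ^ r * dpow D i (n - r) (gen (x i)) * gen (x j) * dpow D i r (gen (x i)))"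

definition rels :: "('i, 'y::ab_group_add, 'x) root_datum \<Rightarrow> ('i, 'y) falg set" where
  "rels D =
     {gen (K 0) - 1}
   \<union> {gen (K (\<mu> + \<nu>)) - gen (K \<mu>) * gen (K \<nu>) | \<mu> \<nu>. True}
   \<union> {gen (K \<mu>) * gen (E i) - scal (vq powi pair D \<mu> (rt D i)) * gen (E i) * gen (K \<mu>)
        | \<mu> i. i \<in> idx D}
   \<union> {gen (K \<mu>) * gen (F i) - scal (vq powi (- pair D \<mu> (rt D i))) * gen (F i) * gen (K \<mu>)
        | \<mu> i. i \<in> idx D}
   \<union> {gen (E i) * gen (F j) - gen (F j) * gen (E i)
        - (if i = j then scal (inverse (vi D i - inverse (vi D i))) * (Kt D 1 i - Kt D (- 1) i) else 0)
        | i j. i \<in> idx D \<and> j \<in> idx D}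
   \<union> {serre D E i j | i j. i \<in> idx D \<and> j \<in> idx D \<and> i \<noteq> j}
   \<union> {serre D F i j | i j. i \<in> idx D \<and> j \<in> idx D \<and> i \<noteq> j}"

definition rel_ideal :: "('i, 'y::ab_group_add, 'x) root_datum \<Rightarrow> ('i, 'y) falg set" where
  "rel_ideal D = Idl\<^bsub>free_alg D\<^esub> (rels D)"

definition cls :: "('i, 'y::ab_group_add, 'x) root_datum \<Rightarrow> ('i, 'y) falg \<Rightarrow> ('i, 'y) falg set" where
  "cls D p = rel_ideal D +>\<^bsub>free_alg D\<^esub> p"

text \<open>The record type \<open>module\<close> is used only to store the scalar multiplication along with the
  ring operations; elements of \<open>U D\<close> are cosets, and \<open>cls D p\<close> is the image of \<open>p\<close>.\<close>

definition U :: "('i, 'y::ab_group_add, 'x) root_datum \<Rightarrow> (qv, ('i, 'y) falg set) module" where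
  "U D = ring.extend (free_alg D Quot rel_ideal D)
     \<lparr>module.smult = (\<lambda>c X. cls D (scal c) \<otimes>\<^bsub>free_alg D Quot rel_ideal D\<^esub> X)\<rparr>"

definition alg_hom :: "('k, 'a, 'm) module_scheme \<Rightarrow> ('k, 'b, 'n) module_scheme \<Rightarrow> ('a \<Rightarrow> 'b) set" where
  "alg_hom A B = {h \<in> ring_hom A B. \<forall>c. \<forall>x\<in>carrier A. h (c \<odot>\<^bsub>A\<^esub> x) = c \<odot>\<^bsub>B\<^esub> h x}"

text \<open>On \<open>carrier (U D)\<close>, \<open>f\<close> is the algebra homomorphism \<open>U D \<rightarrow> U D'\<close> sending each generator \<open>g\<close> to (the class
  of) \<open>\<phi> g\<close>. There is at most one such map on
  \<open>carrier (U D)\<close>; values outside the carrier are irrelevant.\<close>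

definition hom_on_gens ::
    "('i, 'y::ab_group_add, 'x) root_datum \<Rightarrow> ('j, 'z::ab_group_add, 'w) root_datum
     \<Rightarrow> (('i, 'y) gen \<Rightarrow> ('j, 'z) falg) \<Rightarrow> (('i, 'y) falg set \<Rightarrow> ('j, 'z) falg set) \<Rightarrow> bool" where
  "hom_on_gens D D' \<phi> f \<longleftrightarrow> f \<in> alg_hom (U D) (U D')
     \<and> (\<forall>g\<in>gens D. f (cls D (gen g)) = cls D' (\<phi> g))"

definition srefl :: "('i, 'y::ab_group_add, 'x) root_datum \<Rightarrow> 'i \<Rightarrow> 'y \<Rightarrow> 'y" where
  "srefl D i \<mu> = \<mu> - zscale (pair D \<mu> (rt D i)) (cor D i)"

fun T1_gen :: "('i, 'y::ab_group_add, 'x) root_datum \<Rightarrow> int \<Rightarrow> 'i \<Rightarrow> ('i, 'y) gen \<Rightarrow> ('i, 'y) falg" where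
  "T1_gen D e i (K \<mu>) = gen (K (srefl D i \<mu>))"
| "T1_gen D e i (E j) =
     (if j = i then - (Kt D e i * gen (F i))
      else let n = nat (- pair D (cor D i) (rt D j)) in
        \<Sum>r\<le>n. scal ((- 1) ^ r * vi D i powi (e * int r))
          * dpow D i r (gen (E i)) * gen (E j) * dpow D i (n - r) (gen (E i)))"
| "T1_gen D e i (F j) =
     (if j = i then - (gen (E i) * Kt D (- e) i)
      else let n = nat (- pair D (cor D i) (rt D j)) in
        \<Sum>r\<le>n. scal ((- 1) ^ r * vi D i powi (- e * int r))
          * dpow D i (n - r) (gen (F i)) * gen (F j) * dpow D i r (gen (F i)))"

fun T2_gen :: "('i, 'y::ab_group_add, 'x) root_datum \<Rightarrow> int \<Rightarrow> 'i \<Rightarrow> ('i, 'y) gen \<Rightarrow> ('i, 'y) falg" where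
  "T2_gen D e i (K \<mu>) = gen (K (srefl D i \<mu>))"
| "T2_gen D e i (E j) =
     (if j = i then - (gen (F i) * Kt D e i)
      else let n = nat (- pair D (cor D i) (rt D j)) in
        \<Sum>r\<le>n. scal ((- 1) ^ r * vi D i powi (- e * int r))
          * dpow D i (n - r) (gen (E i)) * gen (E j) * dpow D i r (gen (E i)))"
| "T2_gen D e i (F j) =
     (if j = i then - (Kt D (- e) i * gen (E i))
      else let n = nat (- pair D (cor D i) (rt D j)) in
        \<Sum>r\<le>n. scal ((- 1) ^ r * vi D i powi (e * int r))
          * dpow D i r (gen (F i)) * gen (F j) * dpow D i (n - r) (gen (F i)))"

definition lusztig_T1 :: "('i, 'y::ab_group_add, 'x) root_datum \<Rightarrow> int
    \<Rightarrow> ('i \<Rightarrow> ('i, 'y) falg set \<Rightarrow> ('i, 'y) falg set) \<Rightarrow> bool" where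
  "lusztig_T1 D e T \<longleftrightarrow> (\<forall>i\<in>idx D. hom_on_gens D D (T1_gen D e i) (T i))"

definition lusztig_T2 :: "('i, 'y::ab_group_add, 'x) root_datum \<Rightarrow> int
    \<Rightarrow> ('i \<Rightarrow> ('i, 'y) falg set \<Rightarrow> ('i, 'y) falg set) \<Rightarrow> bool" where
  "lusztig_T2 D e T \<longleftrightarrow> (\<forall>i\<in>idx D. hom_on_gens D D (T2_gen D e i) (T i))"

definition vi0 :: "('i, 'y::ab_group_add, 'x::ab_group_add) root_datum \<Rightarrow> 'i \<Rightarrow> 'i \<Rightarrow> qv" where
  "vi0 D ip im = vi (contract D ip im) None"

definition E0 :: "('i, 'y::ab_group_add, 'x::ab_group_add) root_datum \<Rightarrow> 'i \<Rightarrow> 'i \<Rightarrow> int \<Rightarrow> ('i, 'y) falg" where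
  "E0 D ip im \<epsilon> = gen (E ip) * gen (E im) - scal (vi0 D ip im powi (- \<epsilon>)) * gen (E im) * gen (E ip)"

definition F0 :: "('i, 'y::ab_group_add, 'x::ab_group_add) root_datum \<Rightarrow> 'i \<Rightarrow> 'i \<Rightarrow> int \<Rightarrow> ('i, 'y) falg" where
  "F0 D ip im \<epsilon> = gen (F im) * gen (F ip) - scal (vi0 D ip im powi \<epsilon>) * gen (F ip) * gen (F im)"

fun Psi_gen :: "('i, 'y::ab_group_add, 'x::ab_group_add) root_datum \<Rightarrow> 'i \<Rightarrow> 'i \<Rightarrow> int
    \<Rightarrow> ('i option, 'y) gen \<Rightarrow> ('i, 'y) falg" where
  "Psi_gen D ip im \<epsilon> (K \<mu>) = gen (K \<mu>)"
| "Psi_gen D ip im \<epsilon> (E a) = (case a of None \<Rightarrow> E0 D ip im \<epsilon> | Some i \<Rightarrow> gen (E i))"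
| "Psi_gen D ip im \<epsilon> (F a) = (case a of None \<Rightarrow> F0 D ip im \<epsilon> | Some i \<Rightarrow> gen (F i))"

text \<open>The homomorphism is determined by its values on the generators, so that its injectivity is
  not imposed separately.\<close>

definition is_Psi :: "('i, 'y::ab_group_add, 'x::ab_group_add) root_datum \<Rightarrow> 'i \<Rightarrow> 'i \<Rightarrow> int
    \<Rightarrow> (('i option, 'y) falg set \<Rightarrow> ('i, 'y) falg set) \<Rightarrow> bool" where
  "is_Psi D ip im \<epsilon> f \<longleftrightarrow> hom_on_gens (contract D ip im) D (Psi_gen D ip im \<epsilon>) f"

definition Vsub :: "('i, 'y::ab_group_add, 'x::ab_group_add) root_datum \<Rightarrow> 'i \<Rightarrow> 'i
    \<Rightarrow> (('i option, 'y) falg set \<Rightarrow> ('i, 'y) falg set) \<Rightarrow> (qv, ('i, 'y) falg set) module" where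
  "Vsub D ip im \<Psi> = (U D)\<lparr>carrier := \<Psi> ` carrier (U (contract D ip im))\<rparr>"

text \<open>The images of the generators of the source of \<open>\<chi>\<close>, the source being generated by the
  \<open>Psi_gen D ip im (- \<epsilon>) g\<close>; the parameter \<open>s = \<plusminus>1\<close> is the second index of \<open>\<chi>\<close>.\<close>

fun chi_gen :: "('i, 'y::ab_group_add, 'x::ab_group_add) root_datum \<Rightarrow> 'i \<Rightarrow> 'i \<Rightarrow> int \<Rightarrow> int
    \<Rightarrow> ('i option, 'y) gen \<Rightarrow> ('i, 'y) falg" where
  "chi_gen D ip im \<epsilon> s (K \<mu>) = gen (K \<mu>)"
| "chi_gen D ip im \<epsilon> s (E a) = (case a of
     None \<Rightarrow> - (scal (vi0 D ip im powi (if s = 1 then - \<epsilon> else \<epsilon>)) * E0 D ip im \<epsilon>)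
   | Some j \<Rightarrow> if s = 1
       then scal ((- vi0 D ip im) powi (- \<epsilon> * pair D (cor D ip + cor D im) (rt D j))) * gen (E j)
       else gen (E j))"
| "chi_gen D ip im \<epsilon> s (F a) = (case a of
     None \<Rightarrow> - (scal (vi0 D ip im powi (if s = 1 then \<epsilon> else - \<epsilon>)) * F0 D ip im \<epsilon>)
   | Some j \<Rightarrow> if s = 1
       then scal ((- vi0 D ip im) powi (\<epsilon> * pair D (cor D ip + cor D im) (rt D j))) * gen (F j)
       else gen (F j))"

text \<open>\<open>\<Psi>\<close> is the family of the two embeddings, indexed by the sign. Bijectivity
  of \<open>f\<close> is not imposed separately, as the \<open>Psi_gen D ip im (- \<epsilon>) g\<close> generate the source.\<close>

definition is_chi :: "('i, 'y::ab_group_add, 'x::ab_group_add) root_datum \<Rightarrow> 'i \<Rightarrow> 'i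
    \<Rightarrow> (int \<Rightarrow> ('i option, 'y) falg set \<Rightarrow> ('i, 'y) falg set) \<Rightarrow> int \<Rightarrow> int
    \<Rightarrow> (('i, 'y) falg set \<Rightarrow> ('i, 'y) falg set) \<Rightarrow> bool" where
  "is_chi D ip im \<Psi> \<epsilon> s f \<longleftrightarrow>
     f \<in> alg_hom (Vsub D ip im (\<Psi> (- \<epsilon>))) (Vsub D ip im (\<Psi> \<epsilon>))
     \<and> (\<forall>g\<in>gens (contract D ip im).
          f (cls D (Psi_gen D ip im (- \<epsilon>) g)) = cls D (chi_gen D ip im \<epsilon> s g))"

fun contr_T :: "'i \<Rightarrow> 'i \<Rightarrow> ('u \<Rightarrow> 'u) \<Rightarrow> ('i \<Rightarrow> 'u \<Rightarrow> 'u) \<Rightarrow> 'i option \<Rightarrow> 'u \<Rightarrow> 'u" where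
  "contr_T ip im \<chi> T (Some i) = T i"
| "contr_T ip im \<chi> T None = \<chi> \<circ> (T ip \<circ> T im \<circ> T ip)"

lemma gens_letters_mult:
  assumes "p \<in> carrier (free_alg D)" "q \<in> carrier (free_alg D)"
  shows "p * q \<in> carrier (free_alg D)"
  using assms keys_mult[of p q] by (fastforce simp: free_alg_def plus_word_def)

lemma free_alg_ring: "ring (free_alg D)"
proof (rule ringI)
  show "abelian_group (free_alg D)"
  proof (rule abelian_groupI)
    fix x y :: "('a, 'b) falg"
    assume "x \<in> carrier (free_alg D)" "y \<in> carrier (free_alg D)"
    then show "x \<oplus>\<^bsub>free_alg D\<^esub> y \<in> carrier (free_alg D)"
      using Poly_Mapping.keys_add[of x y] by (fastforce simp: free_alg_def)
  next
    fix x :: "('a, 'b) falg"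
    assume "x \<in> carrier (free_alg D)"
    then show "\<exists>y\<in>carrier (free_alg D). y \<oplus>\<^bsub>free_alg D\<^esub> x = \<zero>\<^bsub>free_alg D\<^esub>"
      by (intro bexI[of _ "- x"]) (auto simp: free_alg_def)
  qed (auto simp: free_alg_def algebra_simps)
  show "Group.monoid (free_alg D)"
  proof (rule Group.monoidI)
    fix x y :: "('a, 'b) falg"
    assume "x \<in> carrier (free_alg D)" "y \<in> carrier (free_alg D)"
    then show "x \<otimes>\<^bsub>free_alg D\<^esub> y \<in> carrier (free_alg D)"
      using gens_letters_mult[of x D y] by (simp add: free_alg_def)
  next
    show "\<one>\<^bsub>free_alg D\<^esub> \<in> carrier (free_alg D)"
      by (auto simp: free_alg_def zero_word_def simp flip: single_one)
  qed (auto simp: free_alg_def algebra_simps)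
qed (auto simp: free_alg_def algebra_simps)

lemma gen_in_carrier: "g \<in> gens D \<Longrightarrow> gen g \<in> carrier (free_alg D)"
  by (auto simp: free_alg_def gen_def)

lemma scal_in_carrier: "scal c \<in> carrier (free_alg D)"
  by (auto simp: free_alg_def scal_def zero_word_def)

lemma diff_in_carrier:
  assumes "p \<in> carrier (free_alg D)" "q \<in> carrier (free_alg D)"
  shows "p - q \<in> carrier (free_alg D)"
  using assms Poly_Mapping.keys_add[of p "- q"] by (fastforce simp: free_alg_def)

lemma one_in_carrier: "1 \<in> carrier (free_alg D)"
  by (auto simp: free_alg_def zero_word_def simp flip: single_one)

lemma zero_in_carrier: "0 \<in> carrier (free_alg D)"
  by (auto simp: free_alg_def)

lemma uminus_in_carrier: "p \<in> carrier (free_alg D) \<Longrightarrow> - p \<in> carrier (free_alg D)"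
  by (auto simp: free_alg_def)

lemma power_in_carrier: "p \<in> carrier (free_alg D) \<Longrightarrow> p ^ n \<in> carrier (free_alg D)"
  by (induction n) (auto intro: one_in_carrier gens_letters_mult)

lemma sum_in_carrier:
  assumes "\<And>r. r \<in> A \<Longrightarrow> f r \<in> carrier (free_alg D)"
  shows "sum f A \<in> carrier (free_alg D)"
  using assms
proof (induction A rule: infinite_finite_induct)
  case (insert a A)
  then have "f a - - sum f A \<in> carrier (free_alg D)"
    by (intro diff_in_carrier uminus_in_carrier) auto
  with insert show ?case by simp
qed (auto simp: zero_in_carrier)

lemmas in_carrier = gen_in_carrier scal_in_carrier diff_in_carrier one_in_carrier zero_in_carrier
  uminus_in_carrier power_in_carrier sum_in_carrier gens_letters_mult

lemma rels_in_carrier: "rels D \<subseteq> carrier (free_alg D)"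
proof -
  have g: "E i \<in> gens D" "F i \<in> gens D" if "i \<in> idx D" for i
    using that by (auto simp: gens_def)
  have k: "K \<mu> \<in> gens D" for \<mu> by (auto simp: gens_def)
  show ?thesis
    by (auto simp: rels_def serre_def Let_def Kt_def dpow_def g k intro!: in_carrier)
qed

lemma rel_ideal_ideal: "ideal (rel_ideal D) (free_alg D)"
  unfolding rel_ideal_def by (rule ring.genideal_ideal[OF free_alg_ring rels_in_carrier])

lemma U_simps:
  "carrier (U D) = carrier (free_alg D Quot rel_ideal D)"
  "monoid.mult (U D) = monoid.mult (free_alg D Quot rel_ideal D)"
  "one (U D) = one (free_alg D Quot rel_ideal D)"
  "zero (U D) = zero (free_alg D Quot rel_ideal D)"
  "add (U D) = add (free_alg D Quot rel_ideal D)"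
  by (simp_all add: U_def ring.extend_def)

lemma U_ring: "ring (U D)"
proof -
  have eq: "ring.truncate (U D) = free_alg D Quot rel_ideal D"
    by (simp add: U_def ring.extend_def ring.truncate_def)
  interpret Q: ring "free_alg D Quot rel_ideal D"
    by (rule ideal.quotient_is_ring[OF rel_ideal_ideal])
  show ?thesis
  proof (rule ringI)
    show "abelian_group (U D)"
      by (rule abelian_groupI)
        (auto simp: U_simps Q.a_ac intro: Q.l_neg Q.a_inv_closed)
    show "Group.monoid (U D)"
      by (rule Group.monoidI) (auto simp: U_simps Q.m_assoc)
  qed (auto simp: U_simps Q.l_distr Q.r_distr)
qed

lemma contract_root_datum:
  fixes D :: "('i, 'y::ab_group_add, 'x::ab_group_add) root_datum"
  assumes rd: "is_root_datum D" and c: "contractible D ip im"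
  shows "is_root_datum (contract D ip im)"
proof -
  let ?I = "idx D" and ?b = "form D" and ?p = "pair D"
  from rd have cd: "cartan_datum ?I ?b" and pp: "perfect_pairing ?p"
    and pr: "\<And>i j. i \<in> ?I \<Longrightarrow> j \<in> ?I \<Longrightarrow> ?p (cor D i) (rt D j) * ?b i i = 2 * ?b i j"
    and ic: "inj_on (cor D) ?I" and ir: "inj_on (rt D) ?I"
    by (auto simp: is_root_datum_def)
  from c have ipm: "ip \<in> ?I" "im \<in> ?I" "?b ip ip = - 2 * ?b ip im" "?b im im = - 2 * ?b ip im"
    by (auto simp: contractible_def)
  have sym: "\<And>i j. i \<in> ?I \<Longrightarrow> j \<in> ?I \<Longrightarrow> ?b i j = ?b j i"
    and pos: "\<And>i. i \<in> ?I \<Longrightarrow> ?b i i > 0" and ev: "\<And>i. i \<in> ?I \<Longrightarrow> even (?b i i)"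
    and neg: "\<And>i j. i \<in> ?I \<Longrightarrow> j \<in> ?I \<Longrightarrow> i \<noteq> j \<Longrightarrow> \<exists>n::nat. 2 * ?b i j = - int n * ?b i i"
    using cd by (auto simp: cartan_datum_def)
  have ne: "ip \<noteq> im" using ipm pos[of ip] by auto
  have addl: "?p (y + y') x = ?p y x + ?p y' x" for y y' x
    using pp by (auto simp: perfect_pairing_def Modules.additive_def)
  have addr: "?p y (x + x') = ?p y x + ?p y x'" for y x x'
    using pp by (auto simp: perfect_pairing_def Modules.additive_def)
  have b00: "?b im ip = ?b ip im" using sym ipm by auto
  have bpos: "?b ip im < 0" using pos[of ip] ipm by auto
  have pneg: "?p (cor D i) (rt D j) \<le> 0" if ij: "i \<in> ?I" "j \<in> ?I" "i \<noteq> j" for i j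
  proof -
    obtain n :: nat where "2 * ?b i j = - int n * ?b i i" using neg[OF ij] by auto
    with pr[OF ij(1,2)] have "(?p (cor D i) (rt D j) + int n) * ?b i i = 0"
      by (simp add: algebra_simps)
    with pos[OF ij(1)] show ?thesis by simp
  qed
  have pii: "?p (cor D i) (rt D i) = 2" if "i \<in> ?I" for i
    using pr[OF that that] pos[OF that] by simp
  have ppm: "?p (cor D ip) (rt D im) = -1" "?p (cor D im) (rt D ip) = -1"
  proof -
    have "(?p (cor D ip) (rt D im) + 1) * ?b ip im = 0"
      using pr[of ip im] ipm by (simp add: algebra_simps)
    then show "?p (cor D ip) (rt D im) = -1" using bpos by auto
    have "(?p (cor D im) (rt D ip) + 1) * ?b ip im = 0"
      using pr[of im ip] ipm b00 by (simp add: algebra_simps)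
    then show "?p (cor D im) (rt D ip) = -1" using bpos by auto
  qed
  let ?C = "contract D ip im"
  have f1: "form ?C None None = - 2 * ?b ip im" using ne ipm b00 by (simp add: contract_def)
  have f2: "form ?C None (Some j) = ?b ip j + ?b im j" for j using ne by (simp add: contract_def)
  have f3: "form ?C (Some j) None = ?b j ip + ?b j im" for j using ne by (simp add: contract_def)
  have f4: "form ?C (Some i) (Some j) = ?b i j" for i j by (simp add: contract_def)
  have c1: "cor ?C None = cor D ip + cor D im" "rt ?C None = rt D ip + rt D im"
    using ne by (simp_all add: contract_def)
  have c2: "cor ?C (Some j) = cor D j" "rt ?C (Some j) = rt D j" for j
    by (simp_all add: contract_def)
  have c3: "pair ?C = ?p" "idx ?C = insert None (Some ` (?I - {ip, im}))"
    by (simp_all add: contract_def)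
  have pair_eq: "?p (cor ?C a) (rt ?C b) * form ?C a a = 2 * form ?C a b"
    if "a \<in> idx ?C" "b \<in> idx ?C" for a b
  proof (cases a; cases b)
    assume "a = None" "b = None"
    then show ?thesis using pii ipm ppm by (simp add: c1 f1 addl addr)
  next
    fix j assume ab: "a = None" "b = Some j"
    then have "j \<in> ?I" using that c3 by auto
    then show ?thesis using pr[of ip j] pr[of im j] ipm ab
      by (simp add: c1 c2 f1 f2 addl algebra_simps)
  next
    fix i assume ab: "a = Some i" "b = None"
    then have "i \<in> ?I" using that c3 by auto
    then show ?thesis using pr[of i ip] pr[of i im] ipm ab
      by (simp add: c1 c2 f3 f4 addr algebra_simps)
  next
    fix i j assume ab: "a = Some i" "b = Some j"
    then have "i \<in> ?I" "j \<in> ?I" using that c3 by auto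
    then show ?thesis using pr[of i j] ab by (simp add: c2 f4)
  qed
  have pn: "?p (cor ?C a) (rt ?C b) \<le> 0" if "a \<in> idx ?C" "b \<in> idx ?C" "a \<noteq> b" for a b
  proof (cases a; cases b)
    assume "a = None" "b = None" with that show ?thesis by simp
  next
    fix j assume ab: "a = None" "b = Some j"
    then have "j \<in> ?I" "j \<noteq> ip" "j \<noteq> im" using that c3 by auto
    then show ?thesis using pneg[of ip j] pneg[of im j] ipm ab by (simp add: c1 c2 addl)
  next
    fix i assume ab: "a = Some i" "b = None"
    then have "i \<in> ?I" "i \<noteq> ip" "i \<noteq> im" using that c3 by auto
    then show ?thesis using pneg[of i ip] pneg[of i im] ipm ab by (simp add: c1 c2 addr)
  next
    fix i j assume ab: "a = Some i" "b = Some j"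
    then have "i \<in> ?I" "j \<in> ?I" "i \<noteq> j" using that c3 by auto
    then show ?thesis using pneg[of i j] ab by (simp add: c2)
  qed
  have p2: "?p (cor ?C a) (rt ?C a) = 2" if "a \<in> idx ?C" for a
    using that pii ipm ppm by (cases a) (auto simp: c1 c2 c3 addl addr)
  have "cartan_datum (idx ?C) (form ?C)"
    unfolding cartan_datum_def
  proof (intro conjI ballI impI)
    show "finite (idx ?C)" using cd by (simp add: c3 cartan_datum_def)
    fix a assume a: "a \<in> idx ?C"
    show "form ?C a a > 0" "even (form ?C a a)"
      using a bpos pos ev by (cases a; auto simp: f1 f4 c3)+
    fix b assume b: "b \<in> idx ?C"
    show "form ?C a b = form ?C b a"
      using a b sym ipm by (cases a; cases b) (auto simp: f1 f2 f3 f4 c3)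
    assume "a \<noteq> b"
    then show "\<exists>n::nat. 2 * form ?C a b = - int n * form ?C a a"
      using pn[OF a b] pair_eq[OF a b]
      by (intro exI[of _ "nat (- ?p (cor ?C a) (rt ?C b))"]) simp
  qed
  moreover have "inj_on (cor ?C) (idx ?C)"
    by (rule inj_onI) (metis p2 pn not_numeral_le_zero)
  moreover have "inj_on (rt ?C) (idx ?C)"
    by (rule inj_onI) (metis p2 pn not_numeral_le_zero)
  ultimately show ?thesis
    using rd pair_eq by (auto simp: is_root_datum_def c3)
qed

end

theory Submission
  imports Defs
begin

text \<open>
  Write \<open>Q\<close> for \<open>v\<^sub>i\<close> to the power \<open>e\<close>; it is the same for \<open>i = i\<^sub>+\<close>, \<open>i\<^sub>-\<close> and \<open>i\<^sub>0\<close>. The operator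
  \<open>T'\<close> for \<open>i\<close> sends \<open>E\<^sub>j\<close> to a divided iterated \<open>Q\<close>-commutator of \<open>E\<^sub>j\<close> by \<open>E\<^sub>i\<close>, the bracket \<open>qbr\<close> below, and the
  four formulas, for \<open>E\<^sub>j\<close> and \<open>F\<^sub>j\<close> under \<open>T'\<close> and \<open>T''\<close>, differ only by powers of \<open>- Q\<close>. In fact \<open>T''\<close> is \<open>T'\<close>
  multiplied, on the weight space of \<open>\<nu>\<close>, by \<open>(- Q)\<close> to the power \<open>\<langle>i, \<nu>\<rangle>\<close>. Both families are
  therefore the cases \<open>u = 1\<close> and \<open>u = - inverse Q\<close> of one family in which \<open>T'\<close> is rescaled by the powers of a
  nonzero scalar \<open>u\<close> (\<open>rescaled_braid\<close>), and every statement is proved once, for this family.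

  For an index \<open>j\<close> of \<open>I\<close> other than \<open>i\<^sub>+\<close> and \<open>i\<^sub>-\<close>, one of \<open>E\<^sub>i\<^sub>+\<close>, \<open>E\<^sub>i\<^sub>-\<close> commutes with \<open>E\<^sub>j\<close>, the one at the
  end vertex. Bracketing with \<open>E\<^sub>j\<close> then treats it as a constant, so the bracket of \<open>E\<^sub>i\<^sub>0\<close> is formed from the
  bracket of the other factor (\<open>other_symmetry_intertwines\<close>).

  For \<open>i\<^sub>0\<close>, let \<open>\<tau>\<close> be the product \<open>T\<^sub>+ T\<^sub>- T\<^sub>+\<close>. The rank two identity \<open>T\<^sub>+ T\<^sub>- (E\<^sub>+) = E\<^sub>-\<close>
  (\<open>braid_root_vector\<close>, \<open>braid_rank_two\<close>) determines \<open>\<tau>\<close> on \<open>E\<^sub>\<plusminus>\<close> and \<open>F\<^sub>\<plusminus>\<close>, hence on the elements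
  \<open>E\<^sub>i\<^sub>0\<close> and \<open>F\<^sub>i\<^sub>0\<close> (\<open>tau_E0\<close>, \<open>tau_F0\<close>). The value on \<open>E\<^sub>j\<close> is the crux. If \<open>i\<^sub>+\<close> is the end vertex, \<open>E\<^sub>j\<close> is
  fixed by \<open>T\<^sub>+\<close> and \<open>\<tau> (E\<^sub>j)\<close> is visibly, up to a scalar, the bracket of \<open>E\<^sub>j\<close> by \<open>T\<^sub>+ (E\<^sub>-)\<close>, a multiple of
  \<open>E\<^sub>i\<^sub>0\<close> for the sign \<open>- \<epsilon>\<close>. If \<open>i\<^sub>-\<close> is the end vertex, \<open>\<tau> (E\<^sub>j)\<close> is, up to a scalar, the bracket by \<open>E\<^sub>-\<close> of the bracket by
  \<open>E\<^sub>+\<close> of \<open>E\<^sub>j\<close>, and it has to be recognised as a single bracket by \<open>E\<^sub>i\<^sub>0\<close>. This is an identity for the adjoint action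
  of the positive part of quantum \<open>sl\<^sub>3\<close> on a vector annihilated by \<open>E\<^sub>-\<close> (\<open>qbr_exchange\<close>).
  The computation for the \<open>F\<^sub>j\<close> is the same, with \<open>F\<^sub>\<plusminus>\<close> in place of \<open>E\<^sub>\<plusminus>\<close>.

  In each case the result is a scalar multiple of an element of the image of \<open>\<Psi>\<close> for the sign \<open>- \<epsilon>\<close>, and the scalars are
  exactly those that \<open>\<chi>\<close> removes (\<open>tau_intertwines_generators\<close>). As all maps involved are algebra
  homomorphisms, agreement on generators is enough.
\<close>

section \<open>Iterated q-commutators\<close>

text \<open>
  No unit is part of this class: the algebras \<open>U D\<close> are going to be embedded as factors into a product
  algebra, and such an embedding does not preserve the unit.
\<close>

class qv_algebra = ring +
  fixes smul :: "qv \<Rightarrow> 'a \<Rightarrow> 'a" (infixr "*s" 75)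
  assumes smul_add_right: "c *s (a + b) = c *s a + c *s b"
    and smul_add_left: "(c + d) *s a = c *s a + d *s a"
    and smul_smul [simp]: "c *s d *s a = (c * d) *s a"
    and one_smul [simp]: "1 *s a = a"
    and smul_mult_left [simp]: "(c *s a) * b = c *s (a * b)"
    and smul_mult_right [simp]: "a * (c *s b) = c *s (a * b)"
begin

lemma smul_zero_right [simp]: "c *s 0 = 0"
  using smul_add_right[of c 0 0] by simp

lemma smul_zero_left [simp]: "0 *s a = 0"
  using smul_add_left[of 0 0 a] by simp

lemma smul_minus_right [simp]: "c *s (- a) = - (c *s a)"
  using smul_add_right[of c a "- a"] by (simp add: eq_neg_iff_add_eq_0 add.commute)

lemma smul_minus_left [simp]: "(- c) *s a = - (c *s a)"
  using smul_add_left[of c "- c" a] by (simp add: eq_neg_iff_add_eq_0 add.commute)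

lemma smul_diff_right: "c *s (a - b) = c *s a - c *s b"
  using smul_add_right[of c a "- b"] by simp

lemma smul_diff_left: "(c - d) *s a = c *s a - d *s a"
  using smul_add_left[of c "- d" a] by simp

lemma smul_sum_right: "c *s sum f A = (\<Sum>k\<in>A. c *s f k)"
  by (induction A rule: infinite_finite_induct) (auto simp: smul_add_right)

lemmas smul_distribs = smul_add_right smul_add_left smul_diff_right smul_diff_left

end

text \<open>
  If \<open>p\<close> has weight \<open>k\<close> for the coroot belonging to \<open>x\<close>, then \<open>qcomm (Q powi (- k)) x p\<close> is the (right) adjoint action
  of \<open>x\<close> on \<open>p\<close>. The result has weight \<open>k + 2\<close>, which is why the exponent drops by 2 at every step of \<open>qiter\<close>.
\<close>

definition qcomm :: "qv \<Rightarrow> 'a \<Rightarrow> 'a \<Rightarrow> 'a::qv_algebra" where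
  "qcomm c x p = p * x - c *s (x * p)"

primrec qiter :: "qv \<Rightarrow> int \<Rightarrow> 'a \<Rightarrow> nat \<Rightarrow> 'a \<Rightarrow> 'a::qv_algebra" where
  "qiter Q k x 0 p = p"
| "qiter Q k x (Suc m) p = qcomm (Q powi (k - 2 * int m)) x (qiter Q k x m p)"

lemma qcomm_smul: "qcomm c x (d *s p) = d *s qcomm c x p"
  by (simp add: qcomm_def smul_distribs mult.commute)

lemma qcomm_diff: "qcomm c x (p - p') = qcomm c x p - qcomm c x p'"
  by (simp add: qcomm_def smul_distribs algebra_simps)

text \<open>
  Here \<open>q\<close> and \<open>r\<close> stand for \<open>Q\<close> and its inverse. As separate variables they make all coefficients monomials, so that
  both sides can be compared by expansion. With \<open>S\<close> for the Serre expression, the two sides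
  differ by \<open>p * S - (a * a * b) *s (S * p)\<close>; all terms with factors on both sides of \<open>p\<close> cancel.
\<close>

lemma qcomm_serre_aux:
  fixes x y p :: "'a::qv_algebra"
  assumes serre: "x * (x * y) + y * (x * x) = (q + r) *s (x * (y * x))" and qr: "q * r = 1"
  shows "qcomm (q * q * b) y (qcomm (a * r * r) x (qcomm a x p))
       = (q + r) *s qcomm (a * r) x (qcomm (q * b) y (qcomm a x p))
         - qcomm (a * r) x (qcomm (q * a) x (qcomm b y p))"
proof -
  have qr': "q * (r * z) = z" for z using qr by (metis mult.assoc mult_1)
  define S where "S = x * (x * y) + y * (x * x) - (q + r) *s (x * (y * x))"
  have S0: "S = 0" using serre by (simp add: S_def)
  have "qcomm (q * q * b) y (qcomm (a * r * r) x (qcomm a x p))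
       - ((q + r) *s qcomm (a * r) x (qcomm (q * b) y (qcomm a x p))
         - qcomm (a * r) x (qcomm (q * a) x (qcomm b y p)))
       = p * S - (a * a * b) *s (S * p)"
    unfolding qcomm_def S_def
    by (simp add: smul_distribs algebra_simps qr qr')
  then show ?thesis by (simp add: S0)
qed


text \<open>
  The adjoint action is an action: the operators of \<open>x\<close> and \<open>y\<close> inherit the Serre relation. The
  exponents follow the weights, as \<open>x\<close> shifts the weight for \<open>x\<close> by 2 and the one for \<open>y\<close> by -1.
\<close>

lemma qcomm_serre:
  fixes x y p :: "'a::qv_algebra"
  assumes serre: "x * (x * y) + y * (x * x) = (Q + inverse Q) *s (x * (y * x))" and Q: "Q \<noteq> 0"
  shows "qcomm (Q powi (\<beta> + 2)) y (qcomm (Q powi (\<alpha> - 2)) x (qcomm (Q powi \<alpha>) x p))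
       = (Q + inverse Q) *s qcomm (Q powi (\<alpha> - 1)) x (qcomm (Q powi (\<beta> + 1)) y (qcomm (Q powi \<alpha>) x p))
         - qcomm (Q powi (\<alpha> - 1)) x (qcomm (Q powi (\<alpha> + 1)) x (qcomm (Q powi \<beta>) y p))"
  using qcomm_serre_aux[OF serre, of "Q powi \<beta>" "Q powi \<alpha>" p] Q
  by (simp add: power_int_add power_int_diff field_simps power2_eq_square power_int_minus)

definition qnum :: "qv \<Rightarrow> nat \<Rightarrow> qv" where
  "qnum Q n = (Q powi int n - Q powi - int n) / (Q - inverse Q)"

definition qfac :: "qv \<Rightarrow> nat \<Rightarrow> qv" where
  "qfac Q n = (\<Prod>k=1..n. qnum Q k)"

lemma qnum_0 [simp]: "qnum Q 0 = 0"
  by (simp add: qnum_def)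

lemma qnum_1 [simp]: "Q \<noteq> inverse Q \<Longrightarrow> qnum Q (Suc 0) = 1"
  by (simp add: qnum_def power_int_minus)

lemma qnum_add:
  assumes "Q \<noteq> 0"
  shows "Q powi int r * qnum Q s + Q powi - int s * qnum Q r = qnum Q (r + s)"
proof -
  have "Q powi int r * (Q powi int s - Q powi - int s) + Q powi - int s * (Q powi int r - Q powi - int r)
      = Q powi int (r + s) - Q powi - int (r + s)"
    using assms by (simp add: right_diff_distrib algebra_simps power_add power_int_minus del: of_nat_add)
  then show ?thesis by (simp add: qnum_def flip: add_divide_distrib)
qed

lemma qnum_rec:
  assumes "Q \<noteq> 0"
  shows "qnum Q (Suc (Suc n)) = (Q + inverse Q) * qnum Q (Suc n) - qnum Q n"
proof -
  have "Q powi int (Suc (Suc n)) - Q powi - int (Suc (Suc n))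
      = (Q + inverse Q) * (Q powi int (Suc n) - Q powi - int (Suc n)) - (Q powi int n - Q powi - int n)"
    using assms by (simp add: power_int_minus field_simps del: of_nat_Suc)
  then show ?thesis unfolding qnum_def times_divide_eq_right diff_divide_distrib[symmetric] by simp
qed

lemma qnum_inverse: "qnum (inverse Q) n = qnum Q n"
proof -
  have *: "(inverse Q powi m) = Q powi - m" for m by (simp add: power_int_minus power_int_inverse)
  have "(a - b) / (c - d) = (b - a) / (d - c)" for a b c d :: qv
    by (metis minus_diff_eq minus_divide_divide)
  then show ?thesis unfolding qnum_def * by simp
qed

text \<open>
  In terms of the operators \<open>X\<close> and \<open>Y\<close> of \<open>x\<close> and \<open>y\<close>: if \<open>Y h = 0\<close>, then \<open>Y X\<^sup>a h = [a] X\<^sup>a\<^sup>-\<^sup>1 Y X h\<close>. The Serre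
  relation gives a two-step recursion for \<open>Y X\<^sup>a h\<close>, and the quantum integers satisfy the same recursion.
\<close>

lemma qcomm_qiter:
  fixes x y h :: "'a::qv_algebra"
  assumes serre: "x * (x * y) + y * (x * x) = (Q + inverse Q) *s (x * (y * x))"
    and Q: "Q \<noteq> 0" "Q \<noteq> inverse Q" and h: "qcomm (Q powi \<beta>) y h = 0"
  shows "qcomm (Q powi (\<beta> + int (Suc a))) y (qiter Q \<alpha> x (Suc a) h)
       = qnum Q (Suc a) *s qiter Q (\<alpha> - 1) x a (qcomm (Q powi (\<beta> + 1)) y (qcomm (Q powi \<alpha>) x h))"
proof (induction a rule: induct_nat_012)
  case 0
  then show ?case using Q by simp
next
  case 1
  have q2: "qnum Q 2 = Q + inverse Q" using qnum_rec[OF Q(1), of 0] Q by (simp add: numeral_2_eq_2)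
  have "qcomm c x 0 = 0" for c by (simp add: qcomm_def)
  then show ?case using qcomm_serre[OF serre Q(1), of \<beta> \<alpha> h] Q q2 h
    by (simp add: numeral_2_eq_2)
next
  case (ge2 n)
  let ?p = "qiter Q \<alpha> x (Suc n) h" and ?y1 = "qcomm (Q powi (\<beta> + 1)) y (qcomm (Q powi \<alpha>) x h)"
  let ?\<alpha> = "\<alpha> - 2 * int (Suc n)"
  have "qcomm (Q powi (\<beta> + int (Suc (Suc (Suc n))))) y (qiter Q \<alpha> x (Suc (Suc (Suc n))) h)
     = qcomm (Q powi ((\<beta> + int (Suc n)) + 2)) y (qcomm (Q powi (?\<alpha> - 2)) x (qcomm (Q powi ?\<alpha>) x ?p))"
    by (simp add: algebra_simps)
  also have "\<dots> = (Q + inverse Q) *s qcomm (Q powi (?\<alpha> - 1)) x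
        (qcomm (Q powi (\<beta> + int (Suc (Suc n)))) y (qiter Q \<alpha> x (Suc (Suc n)) h))
      - qcomm (Q powi (?\<alpha> - 1)) x (qcomm (Q powi (?\<alpha> + 1)) x (qcomm (Q powi (\<beta> + int (Suc n))) y ?p))"
    by (subst qcomm_serre[OF serre Q(1)]) (simp add: algebra_simps)
  also have "\<dots> = ((Q + inverse Q) * qnum Q (Suc (Suc n)) - qnum Q (Suc n)) *s
      qiter Q (\<alpha> - 1) x (Suc (Suc n)) ?y1"
    unfolding ge2
    by (simp add: qcomm_smul smul_distribs algebra_simps)
  finally show ?case unfolding qnum_rec[OF Q(1)] .
qed

text \<open>
  The root vector \<open>w = x * y - Q *s (y * x)\<close> does not act as \<open>Y X\<close> in general; it does on vectors that \<open>Y\<close> annihilates,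
  which is what the hypothesis on \<open>h\<close> says.
\<close>

lemma qcomm_qcomm:
  fixes x y h :: "'a::qv_algebra"
  assumes h: "h * y = d *s (y * h)"
  shows "qcomm (Q * d) y (qcomm c x h) = qcomm (c * d) (x * y - Q *s (y * x)) h"
proof -
  have h': "h * (y * t) = d *s (y * (h * t))" for t
    using h by (metis mult.assoc smul_mult_left)
  show ?thesis
    by (simp add: qcomm_def smul_distribs algebra_simps h h')
qed

lemma rank2_root_vector:
  fixes x y :: "'a::qv_algebra"
  assumes serre: "y * (y * x) + x * (y * y) = (Q + inverse Q) *s (y * (x * y))"
    and Q: "Q \<noteq> 0" and w: "w = x * y - Q *s (y * x)"
  shows "w * y = inverse Q *s (y * w)"
proof -
  have "x * (y * y) = (Q + inverse Q) *s (y * (x * y)) - y * (y * x)"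
    using serre by (metis add_diff_cancel_left')
  then show ?thesis using Q by (simp add: w smul_distribs algebra_simps)
qed

text \<open>
  The operator of \<open>y\<close> annihilates not only \<open>z\<close> but all iterated commutators of \<open>z\<close> by the root vector, because \<open>w\<close> and \<open>y\<close>
  commute up to a scalar.
\<close>

lemma qiter_root_vector:
  fixes x y z :: "'a::qv_algebra"
  assumes Q: "Q \<noteq> 0" and wy: "w * y = inverse Q *s (y * w)" and zy: "z * y = y * z"
  shows "qiter Q k w b z * y = Q powi (- int b) *s (y * qiter Q k w b z)"
proof (induction b)
  case 0
  then show ?case using zy by simp
next
  case (Suc b)
  let ?h = "qiter Q k w b z"
  have wy': "w * (y * t) = inverse Q *s (y * (w * t))" for t
    using wy by (metis mult.assoc smul_mult_left)
  have IH': "?h * (y * t) = Q powi (- int b) *s (y * (?h * t))" for t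
    using Suc.IH by (metis mult.assoc smul_mult_left)
  have "Q powi (- int (Suc b)) = Q powi (- int b) * inverse Q"
    using Q by (simp add: power_int_diff power_int_minus field_simps)
  then show ?case
    by (simp add: qcomm_def smul_distribs algebra_simps wy wy' Suc.IH IH')
qed

text \<open>
  Every application of \<open>Y\<close> to \<open>X\<^sup>n\<^sup>-\<^sup>m W\<^sup>m z\<close> trades one \<open>X\<close> for one \<open>W\<close> at the cost of the quantum integer \<open>[n - m]\<close>.
\<close>

lemma qiter_exchange_partial:
  fixes x y z :: "'a::qv_algebra"
  assumes sx: "x * (x * y) + y * (x * x) = (Q + inverse Q) *s (x * (y * x))"
    and sy: "y * (y * x) + x * (y * y) = (Q + inverse Q) *s (y * (x * y))"
    and Q: "Q \<noteq> 0" "Q \<noteq> inverse Q" and zy: "z * y = y * z"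
    and w: "w = x * y - Q *s (y * x)" and "m \<le> n"
  shows "qiter Q (int n) y m (qiter Q (int n) x n z)
       = (\<Prod>k<m. qnum Q (n - k)) *s qiter Q (int n - int m) x (n - m) (qiter Q (int n) w m z)"
  using \<open>m \<le> n\<close>
proof (induction m)
  case 0
  then show ?case by simp
next
  case (Suc m)
  let ?h = "qiter Q (int n) w m z"
  obtain a where a: "n - m = Suc a" using Suc.prems by (metis Suc_diff_Suc Suc_le_lessD)
  then have a': "n - Suc m = a" by simp
  have hy: "?h * y = Q powi (- int m) *s (y * ?h)"
    by (rule qiter_root_vector[OF Q(1) rank2_root_vector[OF sy Q(1) w] zy])
  have an: "int n = int m + int a + 1" using a Suc.prems by linarith
  have "qcomm (Q powi (int n - 2 * int m)) y (qiter Q (int n - int m) x (n - m) ?h)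
      = qcomm (Q powi (- int m + int (Suc a))) y (qiter Q (int n - int m) x (Suc a) ?h)"
    unfolding a by (simp add: an add.commute)
  also have "\<dots> = qnum Q (Suc a) *s qiter Q (int n - int m - 1) x a
      (qcomm (Q powi (- int m + 1)) y (qcomm (Q powi (int n - int m)) x ?h))"
    by (rule qcomm_qiter[OF sx Q]) (simp add: qcomm_def hy)
  also have "qcomm (Q powi (- int m + 1)) y (qcomm (Q powi (int n - int m)) x ?h)
      = qcomm (Q powi (int n - 2 * int m)) w ?h"
  proof -
    have e1: "Q powi (- int m + 1) = Q * Q powi (- int m)"
      using Q by (simp add: power_int_add del: minus_add_distrib uminus_add_conv_diff)
    have e2: "Q powi (int n - 2 * int m) = Q powi (int n - int m) * Q powi (- int m)"
      using Q by (simp flip: power_int_add)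
    show ?thesis unfolding e1 e2 w by (rule qcomm_qcomm[OF hy[unfolded w]])
  qed
  finally have "qcomm (Q powi (int n - 2 * int m)) y (qiter Q (int n - int m) x (n - m) ?h)
      = qnum Q (n - m) *s qiter Q (int n - int (Suc m)) x (n - Suc m) (qiter Q (int n) w (Suc m) z)"
    using a a' by (simp add: an algebra_simps)
  then show ?case using Suc by (simp add: qcomm_smul mult.commute)
qed

lemma qiter_exchange:
  fixes x y z :: "'a::qv_algebra"
  assumes sx: "x * (x * y) + y * (x * x) = (Q + inverse Q) *s (x * (y * x))"
    and sy: "y * (y * x) + x * (y * y) = (Q + inverse Q) *s (y * (x * y))"
    and Q: "Q \<noteq> 0" "Q \<noteq> inverse Q" and zy: "z * y = y * z"
  shows "qiter Q (int n) y n (qiter Q (int n) x n z)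
       = qfac Q n *s qiter Q (int n) (x * y - Q *s (y * x)) n z"
proof -
  have "(\<Prod>k<n. qnum Q (n - k)) = qfac Q n"
    unfolding qfac_def
    by (rule prod.reindex_bij_witness[of _ "\<lambda>k. n - k" "\<lambda>k. n - k"]) auto
  then show ?thesis
    using qiter_exchange_partial[OF sx sy Q zy refl, of n n] by simp
qed

text \<open>
  For \<open>Q = v\<^sub>i\<^sup>e\<close>, \<open>x = E\<^sub>i\<close>, \<open>z = E\<^sub>j\<close> and \<open>n = - \<langle>i, j'\<rangle>\<close> this is \<open>T'\<^sub>i\<^sub>,\<^sub>e (E\<^sub>j)\<close>, by \<open>qbr_closed_form\<close> below.
\<close>

definition qbr :: "qv \<Rightarrow> nat \<Rightarrow> 'a \<Rightarrow> 'a \<Rightarrow> 'a::qv_algebra" where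
  "qbr Q n x z = inverse (qfac Q n) *s qiter Q (int n) x n z"

lemma qiter_smul_base: "qiter Q k x m (c *s z) = c *s qiter Q k x m z"
  by (induction m) (auto simp: qcomm_smul)

lemma qiter_diff: "qiter Q k x m (z - z') = qiter Q k x m z - qiter Q k x m z'"
  by (induction m) (auto simp: qcomm_diff)

lemma qiter_smul_op: "qiter Q k (c *s x) m z = c ^ m *s qiter Q k x m z"
  by (induction m) (auto simp: qcomm_smul qcomm_def smul_distribs algebra_simps)

lemma qiter_commute_left: "p * x = x * p \<Longrightarrow> qiter Q k x m (p * z) = p * qiter Q k x m z"
proof (induction m)
  case (Suc m)
  then have "x * (p * t) = p * (x * t)" for t by (metis mult.assoc)
  with Suc show ?case by (simp add: qcomm_def algebra_simps)
qed simp

lemma qiter_commute_right: "p * x = x * p \<Longrightarrow> qiter Q k x m (z * p) = qiter Q k x m z * p"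
  by (induction m) (auto simp: qcomm_def algebra_simps)

lemma qbr_smul_op: "qbr Q n (c *s x) z = c ^ n *s qbr Q n x z"
  by (simp add: qbr_def qiter_smul_op mult.commute)

lemma qbr_smul_base: "qbr Q n x (c *s z) = c *s qbr Q n x z"
  by (simp add: qbr_def qiter_smul_base mult.commute)

lemma qbr_0 [simp]: "qbr Q 0 x z = z"
  by (simp add: qbr_def qfac_def)

lemma qbr_1: "Q \<noteq> inverse Q \<Longrightarrow> qbr Q 1 x z = z * x - Q *s (x * z)"
  by (simp add: qbr_def qfac_def qcomm_def)

lemma qbr_exchange:
  fixes x y z :: "'a::qv_algebra"
  assumes sx: "x * (x * y) + y * (x * x) = (Q + inverse Q) *s (x * (y * x))"
    and sy: "y * (y * x) + x * (y * y) = (Q + inverse Q) *s (y * (x * y))"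
    and Q: "Q \<noteq> 0" "Q \<noteq> inverse Q" "qfac Q n \<noteq> 0" and zy: "z * y = y * z"
  shows "qbr Q n y (qbr Q n x z) = qbr Q n (x * y - Q *s (y * x)) z"
  using qiter_exchange[OF sx sy Q(1,2) zy, of n] Q(3)
  by (simp add: qbr_def qiter_smul_base)

text \<open>
  The sequence \<open>d\<close> plays the part of the divided powers of \<open>x\<close>. The condition on \<open>d 0\<close> says that it acts as a unit on \<open>z\<close>.
  In the induction step the coefficients combine by \<open>qnum_add\<close>.
\<close>

lemma qiter_closed_form:
  fixes x z :: "'a::qv_algebra" and d :: "nat \<Rightarrow> 'a"
  assumes Q: "Q \<noteq> 0"
    and dx: "\<And>r. d r * x = qnum Q (Suc r) *s d (Suc r)"
    and xd: "\<And>r. x * d r = qnum Q (Suc r) *s d (Suc r)"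
    and d0: "d 0 * z * d 0 = z"
  shows "qiter Q k x m z
       = qfac Q m *s (\<Sum>r\<le>m. ((- 1) ^ r * Q powi (int r * (k - int m + 1))) *s (d r * z * d (m - r)))"
proof (induction m)
  case 0
  then show ?case using d0 by (simp add: qfac_def)
next
  case (Suc m)
  define c where "c m r = (- 1) ^ r * Q powi (int r * (k - int m + 1))" for m r
  let ?t = "\<lambda>r. d r * z * d (Suc m - r)" and ?c = "Q powi (k - 2 * int m)"
  define A where "A r = (c m r * qnum Q (Suc m - r)) *s ?t r" for r
  define B where "B r = (if r = 0 then 0 else (?c * c m (r - 1) * qnum Q r) *s ?t r)" for r
  have S1: "(\<Sum>r\<le>m. c m r *s (d r * z * d (m - r))) * x = (\<Sum>r\<le>Suc m. A r)"
    by (auto simp: A_def sum_distrib_right mult.assoc dx Suc_diff_le intro!: sum.cong)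
  have x_d: "x * (d r * t) = qnum Q (Suc r) *s (d (Suc r) * t)" for r t
    using xd[of r] by (metis mult.assoc smul_mult_left)
  have S2: "?c *s (x * (\<Sum>r\<le>m. c m r *s (d r * z * d (m - r)))) = (\<Sum>r\<le>Suc m. B r)"
    unfolding sum.atMost_Suc_shift
    by (auto simp: B_def sum_distrib_left mult.assoc x_d smul_sum_right intro!: sum.cong)
  have coeff: "A r - B r = (qnum Q (Suc m) * c (Suc m) r) *s ?t r" if "r \<le> Suc m" for r
  proof (cases r)
    case 0
    then show ?thesis by (simp add: A_def B_def c_def)
  next
    case (Suc r')
    have rm: "r + (Suc m - r) = Suc m" using that by simp
    have "c m r * qnum Q (Suc m - r) - ?c * c m r' * qnum Q r
        = c (Suc m) r * (Q powi int r * qnum Q (Suc m - r) + Q powi - int (Suc m - r) * qnum Q r)"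
    proof -
      have "c m r = c (Suc m) r * Q powi int r"
        using Q by (simp add: c_def algebra_simps flip: power_int_add power_int_of_nat)
      moreover have "?c * c m r' = - (c (Suc m) r * Q powi - int (Suc m - r))"
        using Q that by (simp add: Suc c_def of_nat_diff algebra_simps flip: power_int_add)
      ultimately show ?thesis by (simp add: algebra_simps)
    qed
    then show ?thesis
      using qnum_add[OF Q, of r "Suc m - r"] unfolding rm
      by (simp add: A_def B_def Suc mult.commute flip: smul_diff_left)
  qed
  have "qiter Q k x (Suc m) z = qfac Q m *s ((\<Sum>r\<le>Suc m. A r) - (\<Sum>r\<le>Suc m. B r))"
    using Suc.IH S1 S2 by (simp add: c_def qcomm_smul) (simp add: qcomm_def)
  also have "\<dots> = qfac Q m *s (\<Sum>r\<le>Suc m. (qnum Q (Suc m) * c (Suc m) r) *s ?t r)"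
    unfolding sum_subtractf[symmetric] using coeff by (simp cong: sum.cong_simp)
  also have "\<dots> = qfac Q (Suc m) *s (\<Sum>r\<le>Suc m. c (Suc m) r *s ?t r)"
    by (simp add: smul_sum_right qfac_def mult.assoc mult.left_commute del: sum.atMost_Suc)
  finally show ?case by (simp add: c_def)
qed

lemma qbr_closed_form:
  fixes x z :: "'a::qv_algebra" and d :: "nat \<Rightarrow> 'a"
  assumes Q: "Q \<noteq> 0" "qfac Q n \<noteq> 0"
    and d: "\<And>r. d r * x = qnum Q (Suc r) *s d (Suc r)" "\<And>r. x * d r = qnum Q (Suc r) *s d (Suc r)"
      "d 0 * z * d 0 = z"
  shows "(\<Sum>r\<le>n. ((- 1) ^ r * Q powi int r) *s (d r * z * d (n - r))) = qbr Q n x z"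
  unfolding qbr_def qiter_closed_form[OF Q(1) d, where k = "int n"] using Q by simp

text \<open>
  Lusztig's formulas also contain the sum in the opposite order. Substituting \<open>n - r\<close> for \<open>r\<close> shows
  that it is the same bracket up to a scalar; this is what makes \<open>T'\<close> and \<open>T''\<close> proportional on each generator.
\<close>

lemma qbr_closed_form_rev:
  fixes x z :: "'a::qv_algebra" and d :: "nat \<Rightarrow> 'a"
  assumes Q: "Q \<noteq> 0" "qfac Q n \<noteq> 0"
    and d: "\<And>r. d r * x = qnum Q (Suc r) *s d (Suc r)" "\<And>r. x * d r = qnum Q (Suc r) *s d (Suc r)"
      "d 0 * z * d 0 = z"
  shows "(\<Sum>r\<le>n. ((- 1) ^ r * Q powi - int r) *s (d (n - r) * z * d r)) = (- inverse Q) ^ n *s qbr Q n x z"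
proof -
  have "(\<Sum>r\<le>n. ((- 1) ^ r * Q powi - int r) *s (d (n - r) * z * d r))
      = (\<Sum>r\<le>n. ((- 1) ^ (n - r) * Q powi - int (n - r)) *s (d r * z * d (n - r)))"
    by (rule sum.reindex_bij_witness[of _ "\<lambda>k. n - k" "\<lambda>k. n - k"]) auto
  also have "\<dots> = (\<Sum>r\<le>n. (- inverse Q) ^ n *s ((- 1) ^ r * Q powi int r) *s (d r * z * d (n - r)))"
  proof (intro sum.cong refl)
    fix r assume "r \<in> {..n}"
    then have r: "n = (n - r) + r" by simp
    have "(- inverse Q) ^ n * ((- 1) ^ r * Q powi int r) = (- inverse Q) ^ (n - r) * ((inverse Q * Q) ^ r)"
      by (subst r, subst power_add) (simp add: power_mult_distrib power_minus[of "inverse Q"])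
    also have "\<dots> = (- 1) ^ (n - r) * Q powi - int (n - r)"
      using Q by (simp add: power_minus[of "inverse Q"] power_int_minus power_inverse)
    finally show "((- 1) ^ (n - r) * Q powi - int (n - r)) *s (d r * z * d (n - r))
        = (- inverse Q) ^ n *s ((- 1) ^ r * Q powi int r) *s (d r * z * d (n - r))" by simp
  qed
  finally show ?thesis by (simp only: flip: smul_sum_right qbr_closed_form[OF Q d])
qed

definition algebra_map :: "('a::qv_algebra \<Rightarrow> 'b::qv_algebra) \<Rightarrow> bool" where
  "algebra_map f \<longleftrightarrow> (\<forall>a b. f (a + b) = f a + f b) \<and> (\<forall>a b. f (a * b) = f a * f b)
     \<and> (\<forall>c a. f (c *s a) = c *s f a)"

lemma algebra_map_simps:
  assumes "algebra_map f"
  shows "f (a + b) = f a + f b" "f (a * b) = f a * f b" "f (c *s a) = c *s f a"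
    "f (- a) = - f a" "f (a - b) = f a - f b" "f 0 = 0"
proof -
  show s: "f (a + b) = f a + f b" "f (a * b) = f a * f b" "f (c *s a) = c *s f a" for a b c
    using assms by (auto simp: algebra_map_def)
  show "f 0 = 0" using s(3)[of 0 0] by simp
  show m: "f (- a) = - f a" for a using s(3)[of "-1" a] by simp
  show "f (a - b) = f a - f b" using s(1)[of a "- b"] m[of b] by simp
qed

lemma algebra_map_qbr:
  assumes "algebra_map f"
  shows "f (qbr Q n x z) = qbr Q n (f x) (f z)"
proof -
  have "f (qiter Q k x m z) = qiter Q k (f x) m (f z)" for k m
    by (induction m) (auto simp: qcomm_def algebra_map_simps[OF assms])
  then show ?thesis by (simp add: qbr_def algebra_map_simps[OF assms])
qed

text \<open>
  The identity \<open>T\<^sub>i T\<^sub>j (E\<^sub>i) = E\<^sub>j\<close> for a simple edge, with \<open>x = E\<^sub>i\<close>, \<open>y = E\<^sub>j\<close>, \<open>f = F\<^sub>i\<close>: the argument of \<open>T\<close> is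
  the value of the other symmetry at \<open>x\<close>. The hypotheses are symmetric enough to cover \<open>x = F\<^sub>i\<close>, \<open>y = F\<^sub>j\<close>, \<open>f = E\<^sub>i\<close>
  as well, with \<open>k\<close> and \<open>k'\<close> exchanged.
\<close>

lemma braid_root_vector:
  fixes x y f k k' :: "'a::qv_algebra"
  assumes T: "algebra_map T" and Q: "Q \<noteq> 0" "Q \<noteq> inverse Q" and c: "c \<noteq> 0"
    and Ty: "T y = c *s (y * x - Q *s (x * y))" and Tx: "T x = - (inverse (c ^ 2) *s (k * f))"
    and yk: "y * k = Q *s (k * y)" and yk': "y * k' = inverse Q *s (k' * y)"
    and xk: "x * k = inverse (Q ^ 2) *s (k * x)"
    and yf: "y * f = f * y" and xf: "x * f - f * x = inverse (Q - inverse Q) *s (k - k')"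
    and kk: "k * (k' * y) = y"
  shows "T (c *s (x * y - Q *s (y * x))) = y"
proof -
  let ?v = "y * x - Q *s (x * y)"
  have yk2: "y * (k * t) = Q *s (k * (y * t))" for t using yk by (metis mult.assoc smul_mult_left)
  have xk2: "x * (k * t) = inverse (Q ^ 2) *s (k * (x * t))" for t
    using xk by (metis mult.assoc smul_mult_left)
  have yf2: "y * (f * t) = f * (y * t)" for t using yf by (metis mult.assoc)
  have xf1: "x * f = f * x + inverse (Q - inverse Q) *s (k - k')" using xf by (simp add: algebra_simps)
  have xf2: "x * (f * t) = f * (x * t) + inverse (Q - inverse Q) *s ((k - k') * t)" for t
    using xf1 by (metis mult.assoc distrib_right smul_mult_left)
  \<comment> \<open>the weight of \<open>?v\<close> is the sum of the roots of \<open>x\<close> and \<open>y\<close>, which pairs with the coroot of \<open>x\<close> to 1\<close>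
  have vk: "?v * (k * f) = inverse Q *s (k * (?v * f))"
  proof -
    have "Q * inverse Q = 1" "Q * (inverse Q * inverse Q) = inverse Q"
        "Q * (Q * (inverse Q * inverse Q)) = 1"
      using Q by (simp_all add: field_simps)
    note QQ = this
    show ?thesis by (simp add: smul_distribs algebra_simps yk2 xk2 power2_eq_square QQ)
  qed
  have vf: "?v * f - f * ?v = inverse (Q - inverse Q) *s ((Q - Q) *s (k * y) + (Q - inverse Q) *s (k' * y))"
    using Q by (simp add: smul_distribs algebra_simps yf2 yf xf1 xf2 yk yk')
  have "T (c *s (x * y - Q *s (y * x)))
      = c *s (T x * T y - Q *s (T y * T x))"
    by (simp add: algebra_map_simps[OF T])
  also have "\<dots> = Q *s (?v * (k * f)) - k * (f * ?v)"
  proof -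
    have "c * (c * (inverse c * inverse c)) = 1" using c by (simp add: field_simps)
    then show ?thesis by (simp add: Tx Ty power2_eq_square smul_distribs algebra_simps)
  qed
  also have "\<dots> = k * (?v * f - f * ?v)"
    unfolding vk using Q by (simp add: right_diff_distrib)
  also have "\<dots> = y" unfolding vf using Q by (simp add: kk)
  finally show ?thesis .
qed

lemma braid_orbit_fixed_first:
  assumes T: "algebra_map T" "algebra_map T'"
    and z: "T z = z" "T' z = c ^ n *s qbr Q n y z" and y: "T y = c *s v"
  shows "T (T' (T z)) = c ^ (2 * n) *s qbr Q n v z"
  by (simp add: z y algebra_map_simps[OF T(1)] algebra_map_qbr[OF T(1)] qbr_smul_op mult_2 power_add)

text \<open>
  Here \<open>z\<close> commutes with \<open>y\<close>, so \<open>T'\<close> fixes \<open>z\<close>, and \<open>T (T' (T z))\<close> is a bracket by \<open>y\<close> of a bracket by \<open>x\<close>.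
\<close>

lemma braid_orbit_fixed_second:
  fixes x y z :: "'a::qv_algebra"
  assumes T: "algebra_map T" "algebra_map T'"
    and z: "T z = c ^ n *s qbr Q n x z" "T' z = z" and x: "T (T' x) = y"
    and sx: "x * (x * y) + y * (x * x) = (Q + inverse Q) *s (x * (y * x))"
    and sy: "y * (y * x) + x * (y * y) = (Q + inverse Q) *s (y * (x * y))"
    and Q: "Q \<noteq> 0" "Q \<noteq> inverse Q" "qfac Q n \<noteq> 0" and zy: "z * y = y * z"
  shows "T (T' (T z)) = c ^ (2 * n) *s qbr Q n (x * y - Q *s (y * x)) z"
  by (simp add: z x algebra_map_simps[OF T(1)] algebra_map_simps[OF T(2)] algebra_map_qbr[OF T(1)]
      algebra_map_qbr[OF T(2)] qbr_smul_base qbr_exchange[OF sx sy Q zy] mult_2 power_add)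



section \<open>The quantum groups as factors of one type\<close>

lemma scal_add: "scal (c + d) = scal c + scal d"
  by (simp add: scal_def single_add)

lemma scal_mult: "scal (c * d) = scal c * scal d"
  by (simp add: scal_def mult_single)

lemma scal_0 [simp]: "scal 0 = 0"
  by (simp add: scal_def)

lemma scal_1 [simp]: "scal 1 = 1"
  by (simp add: scal_def)

lemma scal_single: "scal c * Poly_Mapping.single w d = Poly_Mapping.single w (c * d)"
  by (simp add: scal_def mult_single)

lemma poly_mapping_sum_singles: "p = (\<Sum>w\<in>Poly_Mapping.keys p. Poly_Mapping.single w (Poly_Mapping.lookup p w))"
  by (rule poly_mapping_eqI) (simp add: lookup_sum lookup_single when_def in_keys_iff)

lemma scal_commute: "p * scal c = scal c * p"
proof -
  have "(\<Sum>w\<in>Poly_Mapping.keys p. Poly_Mapping.single w (Poly_Mapping.lookup p w)) * scal c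
      = scal c * (\<Sum>w\<in>Poly_Mapping.keys p. Poly_Mapping.single w (Poly_Mapping.lookup p w))"
    by (simp add: sum_distrib_left sum_distrib_right scal_def mult_single mult.commute)
  then show ?thesis by (simp flip: poly_mapping_sum_singles)
qed

lemma free_alg_simps:
  "monoid.mult (free_alg D) = (*)" "one (free_alg D) = 1" "zero (free_alg D) = 0" "add (free_alg D) = (+)"
  by (simp_all add: free_alg_def)

lemma cls_closed: "p \<in> carrier (free_alg D) \<Longrightarrow> cls D p \<in> carrier (U D)"
  by (auto simp: U_simps cls_def FactRing_def A_RCOSETS_def' )

lemma carrier_U_E:
  assumes "X \<in> carrier (U D)"
  obtains p where "p \<in> carrier (free_alg D)" "X = cls D p"
  using assms by (auto simp: U_simps cls_def FactRing_def A_RCOSETS_def')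

lemma cls_add:
  assumes "p \<in> carrier (free_alg D)" "q \<in> carrier (free_alg D)"
  shows "cls D (p + q) = cls D p \<oplus>\<^bsub>U D\<^esub> cls D q"
  using ideal.a_rcos_sum[OF rel_ideal_ideal assms] by (simp add: U_simps cls_def FactRing_def free_alg_simps)

lemma cls_mult:
  assumes "p \<in> carrier (free_alg D)" "q \<in> carrier (free_alg D)"
  shows "cls D (p * q) = cls D p \<otimes>\<^bsub>U D\<^esub> cls D q"
  using ideal.rcoset_mult_add[OF rel_ideal_ideal assms] by (simp add: U_simps cls_def FactRing_def free_alg_simps)

lemma cls_one: "cls D 1 = \<one>\<^bsub>U D\<^esub>"
  by (simp add: U_simps cls_def FactRing_def free_alg_simps)

lemma cls_rels: "p \<in> rels D \<Longrightarrow> cls D p = \<zero>\<^bsub>U D\<^esub>"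
proof -
  assume "p \<in> rels D"
  then have "p \<in> rel_ideal D"
    unfolding rel_ideal_def using ring.genideal_self[OF free_alg_ring rels_in_carrier] by blast
  then show ?thesis
    by (simp add: U_simps cls_def FactRing_def ideal.rcos_const_imp_mem abelian_subgroup.a_rcos_const
      abelian_subgroupI3 ideal.axioms(1)[OF rel_ideal_ideal] ring.is_abelian_group[OF free_alg_ring])
qed

lemma smult_U: "c \<odot>\<^bsub>U D\<^esub> X = cls D (scal c) \<otimes>\<^bsub>U D\<^esub> X"
  by (simp add: U_def ring.extend_def)

lemma smult_cls: "p \<in> carrier (free_alg D) \<Longrightarrow> c \<odot>\<^bsub>U D\<^esub> cls D p = cls D (scal c * p)"
  by (simp add: smult_U cls_mult scal_in_carrier)

text \<open>
  The algebra \<open>U D\<close> depends on the term \<open>D\<close> and so is not a type. The product of the algebras \<open>U D\<close> over all root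
  data \<open>D\<close> is one, and it contains each \<open>U D\<close> as a factor. Computations in \<open>U D\<close> are done in this product, where
  type-class algebra and rewriting apply.
\<close>

typedef (overloaded) ('i, 'y::ab_group_add, 'x) ualg =
  "{f :: ('i, 'y, 'x) root_datum \<Rightarrow> ('i, 'y) falg set. \<forall>D. f D \<in> carrier (U D)}"
  by (rule exI[of _ "\<lambda>D. \<zero>\<^bsub>U D\<^esub>"]) (simp add: U_ring ring.ring_simprules)

setup_lifting type_definition_ualg

instantiation ualg :: (type, ab_group_add, type) qv_algebra
begin

lift_definition zero_ualg :: "('a, 'b, 'c) ualg" is "\<lambda>D. \<zero>\<^bsub>U D\<^esub>"
  by (simp add: U_ring ring.ring_simprules)

lift_definition plus_ualg :: "('a, 'b, 'c) ualg \<Rightarrow> ('a, 'b, 'c) ualg \<Rightarrow> ('a, 'b, 'c) ualg"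
  is "\<lambda>f g D. f D \<oplus>\<^bsub>U D\<^esub> g D"
  by (simp add: U_ring ring.ring_simprules)

lift_definition times_ualg :: "('a, 'b, 'c) ualg \<Rightarrow> ('a, 'b, 'c) ualg \<Rightarrow> ('a, 'b, 'c) ualg"
  is "\<lambda>f g D. f D \<otimes>\<^bsub>U D\<^esub> g D"
  by (simp add: U_ring ring.ring_simprules)

lift_definition uminus_ualg :: "('a, 'b, 'c) ualg \<Rightarrow> ('a, 'b, 'c) ualg" is "\<lambda>f D. \<ominus>\<^bsub>U D\<^esub> f D"
  by (simp add: U_ring ring.ring_simprules)

lift_definition minus_ualg :: "('a, 'b, 'c) ualg \<Rightarrow> ('a, 'b, 'c) ualg \<Rightarrow> ('a, 'b, 'c) ualg"
  is "\<lambda>f g D. f D \<ominus>\<^bsub>U D\<^esub> g D"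
  by (simp add: U_ring ring.ring_simprules)

lift_definition smul_ualg :: "qv \<Rightarrow> ('a, 'b, 'c) ualg \<Rightarrow> ('a, 'b, 'c) ualg"
  is "\<lambda>c f D. c \<odot>\<^bsub>U D\<^esub> f D"
  by (simp add: smult_U U_ring ring.ring_simprules cls_closed scal_in_carrier)

instance
proof
  fix a b c :: "('a, 'b, 'c) ualg" and s t :: qv
  note [simp] = U_ring ring.ring_simprules cls_closed scal_in_carrier
  show "a + b + c = a + (b + c)" by transfer (rule ext, simp)
  show "a + b = b + a" by transfer (rule ext, simp)
  show "0 + a = a" by transfer (rule ext, simp)
  show "- a + a = 0" by transfer (rule ext, simp)
  show "a - b = a + - b" by transfer (rule ext, simp)
  show "a * b * c = a * (b * c)" by transfer (rule ext, simp)
  show "(a + b) * c = a * c + b * c" by transfer (rule ext, simp)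
  show "a * (b + c) = a * b + a * c" by transfer (rule ext, simp)
  show "s *s (a + b) = s *s a + s *s b" by transfer (rule ext, simp add: smult_U)
  show "(s + t) *s a = s *s a + t *s a" by transfer (rule ext, simp add: smult_U scal_add cls_add)
  show "s *s t *s a = (s * t) *s a" by transfer (rule ext, simp add: smult_U scal_mult cls_mult)
  show "1 *s a = a" by transfer (rule ext, simp add: smult_U cls_one)
  show "(s *s a) * b = s *s (a * b)" by transfer (rule ext, simp add: smult_U)
  show "a * (s *s b) = s *s (a * b)"
  proof (transfer, rule ext)
    fix s D and a b :: "('a, 'b, 'c) root_datum \<Rightarrow> ('a, 'b) falg set"
    assume ab: "\<forall>D. a D \<in> carrier (U D)" "\<forall>D. b D \<in> carrier (U D)"
    obtain p where p: "p \<in> carrier (free_alg D)" "a D = cls D p" using ab by (metis carrier_U_E)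
    have "a D \<otimes>\<^bsub>U D\<^esub> cls D (scal s) = cls D (scal s) \<otimes>\<^bsub>U D\<^esub> a D"
      unfolding p(2) using p(1) by (simp add: scal_commute scal_in_carrier flip: cls_mult)
    note sa = this
    note assoc = monoid.m_assoc[OF ring.is_monoid[OF U_ring], symmetric]
    show "a D \<otimes>\<^bsub>U D\<^esub> (s \<odot>\<^bsub>U D\<^esub> b D) = s \<odot>\<^bsub>U D\<^esub> (a D \<otimes>\<^bsub>U D\<^esub> b D)"
      unfolding smult_U using ab by (subst (1 2) assoc) (simp_all only: sa cls_closed scal_in_carrier)
  qed
qed

end

definition at_datum :: "('i, 'y::ab_group_add, 'x) root_datum \<Rightarrow> ('i, 'y, 'x) ualg \<Rightarrow> ('i, 'y) falg set" where
  "at_datum D a = Rep_ualg a D"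

definition emb :: "('i, 'y::ab_group_add, 'x) root_datum \<Rightarrow> ('i, 'y) falg set \<Rightarrow> ('i, 'y, 'x) ualg" where
  "emb D X = Abs_ualg (\<lambda>D'. if D' = D \<and> X \<in> carrier (U D) then X else \<zero>\<^bsub>U D'\<^esub>)"

lemma at_datum_closed [simp]: "at_datum D a \<in> carrier (U D)"
  using Rep_ualg[of a] by (simp add: at_datum_def)

lemma at_datum_simps [simp]:
  "at_datum D 0 = \<zero>\<^bsub>U D\<^esub>"
  "at_datum D (a + b) = at_datum D a \<oplus>\<^bsub>U D\<^esub> at_datum D b"
  "at_datum D (a * b) = at_datum D a \<otimes>\<^bsub>U D\<^esub> at_datum D b"
  "at_datum D (c *s a) = c \<odot>\<^bsub>U D\<^esub> at_datum D a"
  by (simp_all add: at_datum_def zero_ualg.rep_eq plus_ualg.rep_eq times_ualg.rep_eq smul_ualg.rep_eq)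

lemma at_datum_emb:
  "X \<in> carrier (U D) \<Longrightarrow> at_datum D' (emb D X) = (if D' = D then X else \<zero>\<^bsub>U D'\<^esub>)"
  by (auto simp: at_datum_def emb_def Abs_ualg_inverse U_ring ring.ring_simprules)

lemma ualg_eqI: "(\<And>D. at_datum D a = at_datum D b) \<Longrightarrow> a = b"
  by (simp add: at_datum_def Rep_ualg_inject[symmetric] fun_eq_iff)

lemma emb_inject: "X \<in> carrier (U D) \<Longrightarrow> Y \<in> carrier (U D) \<Longrightarrow> emb D X = emb D Y \<Longrightarrow> X = Y"
  by (metis at_datum_emb)

lemma emb_zero [simp]: "emb D \<zero>\<^bsub>U D\<^esub> = 0"
  by (rule ualg_eqI) (simp add: at_datum_emb U_ring ring.ring_simprules)

lemma emb_hom: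
  assumes "X \<in> carrier (U D)" "Y \<in> carrier (U D)"
  shows emb_add: "emb D (X \<oplus>\<^bsub>U D\<^esub> Y) = emb D X + emb D Y"
    and emb_mult: "emb D (X \<otimes>\<^bsub>U D\<^esub> Y) = emb D X * emb D Y"
  using assms by (auto intro!: ualg_eqI
      simp: at_datum_emb smult_U U_ring ring.ring_simprules cls_closed scal_in_carrier)

lemma emb_smul: "X \<in> carrier (U D) \<Longrightarrow> emb D (c \<odot>\<^bsub>U D\<^esub> X) = c *s emb D X"
  by (auto intro!: ualg_eqI simp: at_datum_emb smult_U U_ring ring.ring_simprules cls_closed scal_in_carrier)

definition el :: "('i, 'y::ab_group_add, 'x) root_datum \<Rightarrow> ('i, 'y) falg \<Rightarrow> ('i, 'y, 'x) ualg" where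
  "el D p = emb D (cls D p)"

lemma el_add: "p \<in> carrier (free_alg D) \<Longrightarrow> q \<in> carrier (free_alg D) \<Longrightarrow> el D (p + q) = el D p + el D q"
  by (simp add: el_def cls_add emb_add cls_closed)

lemma el_mult: "p \<in> carrier (free_alg D) \<Longrightarrow> q \<in> carrier (free_alg D) \<Longrightarrow> el D (p * q) = el D p * el D q"
  by (simp add: el_def cls_mult emb_mult cls_closed)

lemma el_scal: "p \<in> carrier (free_alg D) \<Longrightarrow> el D (scal c * p) = c *s el D p"
  by (simp add: el_def emb_smul cls_closed flip: smult_cls)

lemma el_zero [simp]: "el D 0 = 0"
  using el_scal[OF zero_in_carrier, of D 0] by simp

lemma el_uminus: "p \<in> carrier (free_alg D) \<Longrightarrow> el D (- p) = - el D p"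
  using el_add[of p D "- p"] by (simp add: uminus_in_carrier eq_neg_iff_add_eq_0 add.commute)

lemma el_diff: "p \<in> carrier (free_alg D) \<Longrightarrow> q \<in> carrier (free_alg D) \<Longrightarrow> el D (p - q) = el D p - el D q"
  using el_add[of p D "- q"] by (simp add: uminus_in_carrier el_uminus)

lemma el_sum: "(\<And>r. r \<in> A \<Longrightarrow> f r \<in> carrier (free_alg D)) \<Longrightarrow> el D (sum f A) = (\<Sum>r\<in>A. el D (f r))"
  by (induction A rule: infinite_finite_induct) (auto simp: el_add sum_in_carrier)

lemma el_rels: "p \<in> rels D \<Longrightarrow> el D p = 0"
  by (simp add: el_def cls_rels)

lemma gens_in_carrier [simp]:
  "gen (K \<mu>) \<in> carrier (free_alg D)"
  "i \<in> idx D \<Longrightarrow> gen (E i) \<in> carrier (free_alg D)"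
  "i \<in> idx D \<Longrightarrow> gen (F i) \<in> carrier (free_alg D)"
  by (auto intro!: gen_in_carrier simp: gens_def)

lemma el_one: "el D 1 = el D (gen (K 0))"
proof -
  have "el D (gen (K 0) - 1) = 0" by (rule el_rels) (simp add: rels_def)
  then show ?thesis by (simp add: el_diff one_in_carrier)
qed

lemma el_one_mult [simp]: "p \<in> carrier (free_alg D) \<Longrightarrow> el D (gen (K 0)) * el D p = el D p"
  "p \<in> carrier (free_alg D) \<Longrightarrow> el D p * el D (gen (K 0)) = el D p"
  by (simp_all flip: el_one el_mult add: one_in_carrier)

text \<open>
  The generators generate. There is no clause for the unit, which is the generator \<open>K\<^sub>0\<close>.
\<close>

lemma el_induct [consumes 1, case_names add mult smul gen]:
  assumes p: "p \<in> carrier (free_alg D)"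
    and add: "\<And>a b. P a \<Longrightarrow> P b \<Longrightarrow> P (a + b)" and mult: "\<And>a b. P a \<Longrightarrow> P b \<Longrightarrow> P (a * b)"
    and smul: "\<And>c a. P a \<Longrightarrow> P (c *s a)" and gen: "\<And>g. g \<in> gens D \<Longrightarrow> P (el D (gen g))"
  shows "P (el D p)"
proof -
  have K0: "P (el D (gen (K 0)))" by (rule gen) (simp add: gens_def)
  have P0: "P 0" using smul[OF K0, of 0] by simp
  have word: "P (el D (Poly_Mapping.single (Word gs) 1))
      \<and> Poly_Mapping.single (Word gs) 1 \<in> carrier (free_alg D)" if "set gs \<subseteq> gens D" for gs
    using that
  proof (induction gs)
    case Nil
    have "Poly_Mapping.single (Word []) 1 = (1 :: ('a, 'b) falg)"
      by (simp flip: zero_word_def)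
    then show ?case using K0 by (simp add: el_one one_in_carrier)
  next
    case (Cons g gs)
    have "Poly_Mapping.single (Word (g # gs)) 1 = gen g * Poly_Mapping.single (Word gs) 1"
      by (simp add: gen_def mult_single plus_word_def)
    with Cons show ?case by (simp add: el_mult gen_in_carrier gens_letters_mult mult gen)
  qed
  have monomial: "P (el D (Poly_Mapping.single w c)) \<and> Poly_Mapping.single w c \<in> carrier (free_alg D)"
    if "w \<in> Poly_Mapping.keys p" for w c
  proof -
    have "Poly_Mapping.single w c = scal c * Poly_Mapping.single (Word (letters w)) 1"
      by (simp add: scal_single)
    moreover have "set (letters w) \<subseteq> gens D" using p that by (auto simp: free_alg_def)
    ultimately show ?thesis using word[of "letters w"]
      by (simp add: el_scal smul gens_letters_mult scal_in_carrier)
  qed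
  have sums: "finite A \<Longrightarrow> (\<And>w. w \<in> A \<Longrightarrow> P (f w)) \<Longrightarrow> P (sum f A)" for A and f :: "('a, 'b) gen word \<Rightarrow> _"
    by (induction A rule: finite_induct) (auto simp: P0 add)
  have "el D p = (\<Sum>w\<in>Poly_Mapping.keys p. el D (Poly_Mapping.single w (Poly_Mapping.lookup p w)))"
    by (subst poly_mapping_sum_singles) (rule el_sum, use monomial in blast)
  then show ?thesis using monomial by (auto intro!: sums)
qed

text \<open>
  Extending a homomorphism by zero on the other factors makes it a total map that is additive and multiplicative
  everywhere, without conditions on carriers.
\<close>

definition lift_hom :: "('i, 'y::ab_group_add, 'x) root_datum \<Rightarrow> ('j, 'z::ab_group_add, 'w) root_datum
    \<Rightarrow> (('i, 'y) falg set \<Rightarrow> ('j, 'z) falg set) \<Rightarrow> ('i, 'y, 'x) ualg \<Rightarrow> ('j, 'z, 'w) ualg" where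
  "lift_hom D D' f a = emb D' (f (at_datum D a))"

lemma alg_homD:
  assumes "f \<in> alg_hom A B"
  shows "x \<in> carrier A \<Longrightarrow> f x \<in> carrier B"
    "x \<in> carrier A \<Longrightarrow> y \<in> carrier A \<Longrightarrow> f (x \<oplus>\<^bsub>A\<^esub> y) = f x \<oplus>\<^bsub>B\<^esub> f y"
    "x \<in> carrier A \<Longrightarrow> y \<in> carrier A \<Longrightarrow> f (x \<otimes>\<^bsub>A\<^esub> y) = f x \<otimes>\<^bsub>B\<^esub> f y"
    "x \<in> carrier A \<Longrightarrow> f (c \<odot>\<^bsub>A\<^esub> x) = c \<odot>\<^bsub>B\<^esub> f x"
    "f \<one>\<^bsub>A\<^esub> = \<one>\<^bsub>B\<^esub>"
  using assms by (auto simp: alg_hom_def ring_hom_def)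

lemma lift_hom_algebra_map:
  assumes "f \<in> alg_hom (U D) (U D')"
  shows "algebra_map (lift_hom D D' f)"
  using alg_homD[OF assms] by (simp add: algebra_map_def lift_hom_def emb_add emb_mult emb_smul)

lemma lift_hom_emb: "X \<in> carrier (U D) \<Longrightarrow> lift_hom D D' f (emb D X) = emb D' (f X)"
  by (simp add: lift_hom_def at_datum_emb)

lemma lift_hom_gen:
  assumes "hom_on_gens D D' \<phi> f" "g \<in> gens D"
  shows "lift_hom D D' f (el D (gen g)) = el D' (\<phi> g)"
  using assms by (simp add: el_def lift_hom_emb cls_closed gen_in_carrier hom_on_gens_def)



section \<open>Relations between the generators\<close>

lemma vq_power_neq_1:
  assumes "0 < n"
  shows "vq ^ n \<noteq> 1"
proof
  have pow: "vq ^ n = Fraction_Field.Fract (monom 1 n) 1"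
    by (induction n) (simp_all add: vq_def One_fract_def monom_Suc)
  assume "vq ^ n = 1"
  then have "monom 1 n = (1 :: rat poly)"
    by (simp add: pow One_fract_def eq_fract)
  then have "degree (monom 1 n :: rat poly) = 0" by simp
  then show False using assms by (simp add: degree_monom_eq)
qed

lemma vq_neq_0 [simp]: "vq \<noteq> 0"
  by (simp add: vq_def Zero_fract_def eq_fract)

lemma vq_powi_neq_1: "m \<noteq> 0 \<Longrightarrow> vq powi m \<noteq> 1"
  using vq_power_neq_1[of "nat \<bar>m\<bar>"]
  by (cases "m \<ge> 0") (auto simp: power_int_def power_inverse)

text \<open>
  A quantum integer \<open>[k]\<close> vanishes only at roots of unity, and no power of the indeterminate is one.
\<close>

lemma qnum_vq_neq_0:
  assumes "m \<noteq> 0" "0 < k"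
  shows "qnum (vq powi m) k \<noteq> 0"
proof -
  have *: "vq powi (m * int j) \<noteq> vq powi (- (m * int j))" if "0 < j" for j
  proof
    assume "vq powi (m * int j) = vq powi (- (m * int j))"
    then have "vq powi (m * int j) * vq powi (m * int j) = 1"
      using right_inverse[of "vq powi (m * int j)"] by (simp add: power_int_minus)
    then have "vq powi (m * int j + m * int j) = 1" by (subst power_int_add) auto
    moreover have "m * int j + m * int j \<noteq> 0" using that assms by simp
    ultimately show False using vq_powi_neq_1 by blast
  qed
  have "inverse (vq powi m) = vq powi - m" by (simp add: power_int_minus)
  moreover have "(vq powi m) powi int k - (vq powi m) powi - int k \<noteq> 0"
    using *[OF assms(2)] by (simp only: power_int_mult[symmetric] mult_minus_right)
  ultimately show ?thesis
    using *[of 1] by (simp add: qnum_def del: power_int_of_nat)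
qed

lemma zscale_0 [simp]: "zscale 0 x = 0"
  by (simp add: zscale_def)

lemma zscale_Suc: "zscale (n + 1) x = zscale n x + x"
proof (cases "n \<ge> 0")
  case True
  then have "nat (n + 1) = Suc (nat n)" by simp
  with True show ?thesis by (simp add: zscale_def add.commute)
next
  case False
  then have *: "nat (- n) = Suc (nat (- (n + 1)))" by simp
  show ?thesis
  proof (cases "n = -1")
    case False
    with \<open>\<not> n \<ge> 0\<close> have "\<not> n + 1 \<ge> 0" by simp
    with \<open>\<not> n \<ge> 0\<close> show ?thesis by (simp add: zscale_def *)
  qed (simp add: zscale_def)
qed

lemma zscale_add: "zscale (m + n) x = zscale m x + zscale n x"
proof (induction n rule: int_induct[where k = 0])
  case (step1 i)
  then show ?case using zscale_Suc[of "m + i" x] zscale_Suc[of i x] by (simp add: algebra_simps)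
next
  case (step2 i)
  then show ?case using zscale_Suc[of "m + (i - 1)" x] zscale_Suc[of "i - 1" x] by (simp add: algebra_simps)
qed simp

lemma zscale_minus: "zscale (- n) x = - zscale n x"
  using zscale_add[of n "- n" x] by (simp add: eq_neg_iff_add_eq_0 add.commute)

lemma zscale_plus: "zscale n (x + y) = zscale n x + zscale n y"
proof (induction n rule: int_induct[where k = 0])
  case (step2 i)
  then show ?case
    using zscale_Suc[of "i - 1" x] zscale_Suc[of "i - 1" y] zscale_Suc[of "i - 1" "x + y"]
    by (simp add: algebra_simps)
qed (simp_all add: zscale_Suc algebra_simps)

lemma additive_zscale:
  assumes "\<And>x y. f (x + y) = f x + f y"
  shows "f (zscale n x) = zscale n (f x)"
proof -
  have [simp]: "f 0 = 0" using assms[of 0 0] by simp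
  show ?thesis
  proof (induction n rule: int_induct[where k = 0])
    case (step2 i)
    then show ?case using zscale_Suc[of "i - 1" x] zscale_Suc[of "i - 1" "f x"] assms
      by (metis add_right_cancel diff_add_cancel)
  qed (simp_all add: zscale_Suc assms)
qed

lemma zscale_int: "zscale n (k :: int) = n * k"
proof (induction n rule: int_induct[where k = 0])
  case (step2 i)
  then show ?case using zscale_Suc[of "i - 1" k] by (simp add: algebra_simps)
qed (simp_all add: zscale_Suc algebra_simps)

lemma scal_uminus [simp]: "scal (- c) = - scal c"
  by (simp add: scal_def single_uminus)

lemma el_scal_mult [simp]:
  assumes "p \<in> carrier (free_alg D)"
  shows "el D (scal c) * el D p = c *s el D p" "el D (scal c) * (el D p * a) = c *s (el D p * a)"
  using assms by (simp_all add: el_scal scal_in_carrier flip: el_mult mult.assoc)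

abbreviation "UE D i \<equiv> el D (gen (E i))"
abbreviation "UF D i \<equiv> el D (gen (F i))"
abbreviation "UK D \<mu> \<equiv> el D (gen (K \<mu>))"
abbreviation "UKt D e i \<equiv> el D (Kt D e i)"

lemma el_one_mult_left: "p \<in> carrier (free_alg D) \<Longrightarrow> UK D 0 * (el D p * a) = el D p * a"
  by (simp flip: mult.assoc)

lemma UK_add: "UK D (\<mu> + \<nu>) = UK D \<mu> * UK D \<nu>"
proof -
  have "el D (gen (K (\<mu> + \<nu>)) - gen (K \<mu>) * gen (K \<nu>)) = 0"
    by (rule el_rels) (auto simp: rels_def)
  then show ?thesis by (simp add: el_diff el_mult gens_letters_mult)
qed

lemma UK_UE: "i \<in> idx D \<Longrightarrow> UK D \<mu> * UE D i = vq powi (pair D \<mu> (rt D i)) *s (UE D i * UK D \<mu>)"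
proof -
  assume i: "i \<in> idx D"
  have "el D (gen (K \<mu>) * gen (E i) - scal (vq powi pair D \<mu> (rt D i)) * gen (E i) * gen (K \<mu>)) = 0"
    by (rule el_rels) (use i in \<open>auto simp: rels_def\<close>)
  then show ?thesis using i
    by (simp add: el_diff el_mult mult.assoc gens_letters_mult scal_in_carrier)
qed

lemma UK_UF: "i \<in> idx D \<Longrightarrow> UK D \<mu> * UF D i = vq powi (- pair D \<mu> (rt D i)) *s (UF D i * UK D \<mu>)"
proof -
  assume i: "i \<in> idx D"
  have "el D (gen (K \<mu>) * gen (F i) - scal (vq powi (- pair D \<mu> (rt D i))) * gen (F i) * gen (K \<mu>)) = 0"
    by (rule el_rels) (use i in \<open>auto simp: rels_def\<close>)
  then show ?thesis using i
    by (simp add: el_diff el_mult mult.assoc gens_letters_mult scal_in_carrier)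
qed

lemma Kt_in_carrier [simp]: "Kt D e i \<in> carrier (free_alg D)"
  by (simp add: Kt_def)

lemma UE_UF:
  assumes "i \<in> idx D" "j \<in> idx D"
  shows "UE D i * UF D j - UF D j * UE D i
    = (if i = j then inverse (vi D i - inverse (vi D i)) *s (UKt D 1 i - UKt D (- 1) i) else 0)"
proof -
  have "el D (gen (E i) * gen (F j) - gen (F j) * gen (E i)
        - (if i = j then scal (inverse (vi D i - inverse (vi D i))) * (Kt D 1 i - Kt D (- 1) i) else 0)) = 0"
    by (rule el_rels) (use assms in \<open>auto simp: rels_def\<close>)
  then show ?thesis using assms
    by (auto simp: el_diff el_mult gens_letters_mult scal_in_carrier diff_in_carrier
        zero_in_carrier right_diff_distrib smul_distribs split: if_splits)
qed

lemma qint_eq: "qint D i n = qnum (vi D i) n"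
  by (simp add: qint_def qnum_def)

lemma qfact_eq: "qfact D i n = qfac (vi D i) n"
  by (simp add: qfact_def qfac_def qint_eq)

lemma qnum_powi_sign: "e \<in> {1, -1} \<Longrightarrow> qnum (Q powi e) n = qnum Q n"
  by (auto simp: power_int_minus qnum_inverse)

lemma dpow_in_carrier: "x \<in> carrier (free_alg D) \<Longrightarrow> dpow D i n x \<in> carrier (free_alg D)"
  by (simp add: dpow_def gens_letters_mult scal_in_carrier power_in_carrier)

lemma root_datum_form:
  assumes "is_root_datum D" "i \<in> idx D"
  shows "form D i i = 2 * (form D i i div 2)" "form D i i div 2 > 0"
proof -
  have "form D i i > 0 \<and> even (form D i i)" using assms by (auto simp: is_root_datum_def cartan_datum_def)
  then show "form D i i = 2 * (form D i i div 2)" "form D i i div 2 > 0" by auto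
qed

lemma vi_sign_eq: "vi D i powi e = vq powi (e * (form D i i div 2))"
  by (simp add: vi_def mult.commute flip: power_int_mult)

lemma vi_sign_generic:
  assumes "is_root_datum D" "i \<in> idx D" "e \<in> {1, -1}"
  shows "vi D i powi e \<noteq> 0" "0 < k \<Longrightarrow> qnum (vi D i powi e) k \<noteq> 0"
    "qfac (vi D i powi e) n \<noteq> 0" "vi D i powi e \<noteq> inverse (vi D i powi e)"
proof -
  have m: "e * (form D i i div 2) \<noteq> 0" using root_datum_form[OF assms(1,2)] assms(3) by auto
  show "vi D i powi e \<noteq> 0" by (simp add: vi_sign_eq)
  show q: "0 < k \<Longrightarrow> qnum (vi D i powi e) k \<noteq> 0" for k
    unfolding vi_sign_eq by (rule qnum_vq_neq_0[OF m])
  show "qfac (vi D i powi e) n \<noteq> 0" using q by (simp add: qfac_def)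
  show "vi D i powi e \<noteq> inverse (vi D i powi e)" using q[of 1] by (auto simp: qnum_def)
qed

lemma root_datum_pair:
  assumes "is_root_datum D"
  shows "pair D (\<mu> + \<nu>) x = pair D \<mu> x + pair D \<nu> x" "pair D \<mu> (x + y) = pair D \<mu> x + pair D \<mu> y"
    "pair D (- \<mu>) x = - pair D \<mu> x" "pair D (\<mu> - \<nu>) x = pair D \<mu> x - pair D \<nu> x"
    "pair D (zscale n \<mu>) x = n * pair D \<mu> x"
proof -
  have l: "pair D (\<mu> + \<nu>) x = pair D \<mu> x + pair D \<nu> x" for \<mu> \<nu> x
    using assms by (simp add: is_root_datum_def perfect_pairing_def Modules.additive_def)
  then show "pair D (\<mu> + \<nu>) x = pair D \<mu> x + pair D \<nu> x" .
  show "pair D \<mu> (x + y) = pair D \<mu> x + pair D \<mu> y"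
    using assms by (simp add: is_root_datum_def perfect_pairing_def Modules.additive_def)
  have "pair D 0 x = 0" using l[of 0 0 x] by simp
  then show m: "pair D (- \<mu>) x = - pair D \<mu> x" for \<mu> using l[of \<mu> "- \<mu>" x] by simp
  show "pair D (\<mu> - \<nu>) x = pair D \<mu> x - pair D \<nu> x" using l[of \<mu> "- \<nu>" x] m by simp
  show "pair D (zscale n \<mu>) x = n * pair D \<mu> x"
    using additive_zscale[of "\<lambda>\<mu>. pair D \<mu> x", OF l] by (simp add: zscale_int)
qed

lemma root_datum_pair_self:
  assumes "is_root_datum D" "i \<in> idx D"
  shows "pair D (cor D i) (rt D i) = 2"
proof -
  have "pair D (cor D i) (rt D i) * form D i i = 2 * form D i i"
    using assms by (auto simp: is_root_datum_def)
  moreover have "form D i i \<noteq> 0" using root_datum_form[OF assms] by linarith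
  ultimately show ?thesis by simp
qed

lemma root_datum_pair_nonpos:
  assumes rd: "is_root_datum D" and ij: "i \<in> idx D" "j \<in> idx D" "i \<noteq> j"
  shows "pair D (cor D i) (rt D j) \<le> 0"
proof -
  have "\<forall>i\<in>idx D. \<forall>j\<in>idx D. i \<noteq> j \<longrightarrow> (\<exists>n::nat. 2 * form D i j = - int n * form D i i)"
    using rd unfolding is_root_datum_def cartan_datum_def by blast
  then obtain n :: nat where "2 * form D i j = - int n * form D i i"
    using ij by blast
  moreover have "pair D (cor D i) (rt D j) * form D i i = 2 * form D i j"
    using rd ij unfolding is_root_datum_def by blast
  ultimately have "(pair D (cor D i) (rt D j) + int n) * form D i i = 0"
    by (simp add: distrib_right)
  moreover have "form D i i \<noteq> 0" using root_datum_form[OF rd ij(1)] by linarith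
  ultimately show ?thesis by simp
qed

lemma UKt_commute:
  assumes "is_root_datum D" "j \<in> idx D"
  shows "UKt D e i * UE D j = (vi D i powi e) powi pair D (cor D i) (rt D j) *s (UE D j * UKt D e i)"
    and "UKt D e i * UF D j = (vi D i powi e) powi (- pair D (cor D i) (rt D j)) *s (UF D j * UKt D e i)"
  unfolding Kt_def vi_sign_eq power_int_mult[symmetric]
  by (simp_all only: UK_UE[OF assms(2)] UK_UF[OF assms(2)] root_datum_pair(5)[OF assms(1)] mult_minus_right)

lemma UKt_inverse:
  assumes "p \<in> carrier (free_alg D)"
  shows "UKt D e i * (UKt D (- e) i * el D p) = el D p"
proof -
  have "UKt D e i * UKt D (- e) i = UK D 0"
    by (simp add: Kt_def UK_add[symmetric] zscale_add[symmetric])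
  then have "UKt D e i * (UKt D (- e) i * el D p) = UK D 0 * el D p"
    by (simp only: mult.assoc[symmetric])
  then show ?thesis using assms by simp
qed

lemma dpow_0 [simp]: "dpow D i 0 p = 1"
  by (simp add: dpow_def qfact_def)

lemma el_dpow_step:
  assumes rd: "is_root_datum D" and i: "i \<in> idx D" and X [simp]: "X \<in> carrier (free_alg D)"
  shows "el D (dpow D i r X) * el D X = qnum (vi D i) (Suc r) *s el D (dpow D i (Suc r) X)"
  "el D X * el D (dpow D i r X) = qnum (vi D i) (Suc r) *s el D (dpow D i (Suc r) X)"
proof -
  have "qnum (vi D i) (Suc r) \<noteq> 0"
    using vi_sign_generic(2)[OF rd i, of 1] by simp
  then have *: "inverse (qfact D i r) = qnum (vi D i) (Suc r) * inverse (qfact D i (Suc r))"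
    by (simp add: qfact_eq qfac_def)
  show "el D (dpow D i r X) * el D X = qnum (vi D i) (Suc r) *s el D (dpow D i (Suc r) X)"
    unfolding dpow_def * power_Suc2
    by (simp add: el_mult power_in_carrier gens_letters_mult scal_in_carrier)
  show "el D X * el D (dpow D i r X) = qnum (vi D i) (Suc r) *s el D (dpow D i (Suc r) X)"
    unfolding dpow_def * power_Suc
    by (simp add: el_mult power_in_carrier gens_letters_mult scal_in_carrier)
qed

text \<open>
  The sum in Lusztig's formulas, for \<open>X = E\<^sub>i\<close> or \<open>X = F\<^sub>i\<close>, is the bracket.
\<close>

lemma el_braid_sum:
  assumes rd: "is_root_datum D" and i: "i \<in> idx D"
    and XZ [simp]: "X \<in> carrier (free_alg D)" "Z \<in> carrier (free_alg D)" and e: "e \<in> {1, -1}"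
  shows "el D (\<Sum>r\<le>n. scal ((- 1) ^ r * vi D i powi (e * int r))
           * dpow D i r X * Z * dpow D i (n - r) X)
       = qbr (vi D i powi e) n (el D X) (el D Z)"
proof -
  let ?d = "\<lambda>r. el D (dpow D i r X)"
  have *: "el D (scal c * dpow D i r X * Z * dpow D i s X)
      = c *s (?d r * el D Z * ?d s)" for c r s
    by (simp add: mult.assoc el_mult dpow_in_carrier gens_letters_mult scal_in_carrier)
  have "(\<Sum>r\<le>n. ((- 1) ^ r * (vi D i powi e) powi int r) *s (?d r * el D Z * ?d (n - r)))
      = qbr (vi D i powi e) n (el D X) (el D Z)"
    by (rule qbr_closed_form[OF vi_sign_generic(1,3)[OF rd i e]])
      (simp_all add: el_dpow_step[OF rd i] qnum_powi_sign[OF e] el_one)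
  then show ?thesis
    by (subst el_sum) (simp_all add: * power_int_mult gens_letters_mult scal_in_carrier dpow_in_carrier)
qed

lemma el_braid_sum_rev:
  assumes rd: "is_root_datum D" and i: "i \<in> idx D"
    and XZ [simp]: "X \<in> carrier (free_alg D)" "Z \<in> carrier (free_alg D)" and e: "e \<in> {1, -1}"
  shows "el D (\<Sum>r\<le>n. scal ((- 1) ^ r * vi D i powi (- e * int r))
           * dpow D i (n - r) X * Z * dpow D i r X)
       = (- inverse (vi D i powi e)) ^ n *s qbr (vi D i powi e) n (el D X) (el D Z)"
proof -
  let ?d = "\<lambda>r. el D (dpow D i r X)"
  have *: "el D (scal c * dpow D i r X * Z * dpow D i s X)
      = c *s (?d r * el D Z * ?d s)" for c r s
    by (simp add: mult.assoc el_mult dpow_in_carrier gens_letters_mult scal_in_carrier)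
  have **: "vi D i powi (- e * int r) = (vi D i powi e) powi (- int r)" for r
    by (simp flip: power_int_mult)
  have "(\<Sum>r\<le>n. ((- 1) ^ r * (vi D i powi e) powi - int r) *s (?d (n - r) * el D Z * ?d r))
      = (- inverse (vi D i powi e)) ^ n *s qbr (vi D i powi e) n (el D X) (el D Z)"
    by (rule qbr_closed_form_rev[OF vi_sign_generic(1,3)[OF rd i e]])
      (simp_all add: el_dpow_step[OF rd i] qnum_powi_sign[OF e] el_one)
  then show ?thesis unfolding **
    by (subst el_sum) (simp_all add: * gens_letters_mult scal_in_carrier dpow_in_carrier)
qed

lemma serre_relation:
  assumes "x = E \<or> x = F" "i \<in> idx D" "j \<in> idx D" "i \<noteq> j"
  shows "el D (serre D x i j) = 0"
  by (rule el_rels) (use assms in \<open>auto simp: rels_def\<close>)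

lemma el_serre:
  assumes [simp]: "gen (x i) \<in> carrier (free_alg D)" "gen (x j) \<in> carrier (free_alg D)"
  shows "el D (serre D x i j) = (\<Sum>r\<le>nat (1 - pair D (cor D i) (rt D j)). (- 1) ^ r *s
     (el D (dpow D i (nat (1 - pair D (cor D i) (rt D j)) - r) (gen (x i))) * el D (gen (x j)) * el D (dpow D i r (gen (x i)))))"
proof -
  have s: "(- 1) ^ r = scal ((- 1) ^ r)" for r
    by (induction r) (simp_all add: scal_mult)
  show ?thesis
    unfolding serre_def Let_def s
    by (subst el_sum) (simp_all add: mult.assoc el_mult dpow_in_carrier gens_letters_mult scal_in_carrier)
qed

lemma serre_orthogonal:
  assumes rd: "is_root_datum D" and x: "x = E \<or> x = F" and ij: "i \<in> idx D" "j \<in> idx D"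
    and ne: "i \<noteq> j" and pair: "pair D (cor D i) (rt D j) = 0"
  shows "el D (gen (x i)) * el D (gen (x j)) = el D (gen (x j)) * el D (gen (x i))"
proof -
  have car [simp]: "gen (x i) \<in> carrier (free_alg D)" "gen (x j) \<in> carrier (free_alg D)"
    using x ij by (metis gens_in_carrier(2,3))+
  have d1: "el D (dpow D i (Suc 0) (gen (x i))) = el D (gen (x i))"
    using vi_sign_generic(2)[OF rd ij(1), of 1 1]
    by (simp add: dpow_def qfact_eq qfac_def qnum_1[OF vi_sign_generic(4)[OF rd ij(1), of 1, simplified]])
  show ?thesis
    using serre_relation[OF x ij ne] el_serre[OF car]
    by (simp add: pair d1 el_one el_one_mult_left mult.assoc)
qed

text \<open>
  Either sign of \<open>e\<close> is allowed because \<open>Q + inverse Q\<close> is invariant under inversion of \<open>Q\<close>.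
\<close>

lemma serre_simple_edge:
  assumes rd: "is_root_datum D" and x: "x = E \<or> x = F" and ij: "i \<in> idx D" "j \<in> idx D"
    and ne: "i \<noteq> j" and pair: "pair D (cor D i) (rt D j) = -1" and e: "e \<in> {1, -1}"
  shows "el D (gen (x i)) * (el D (gen (x i)) * el D (gen (x j))) + el D (gen (x j)) * (el D (gen (x i)) * el D (gen (x i)))
    = (vi D i powi e + inverse (vi D i powi e)) *s (el D (gen (x i)) * (el D (gen (x j)) * el D (gen (x i))))"
proof -
  let ?x = "el D (gen (x i))" and ?y = "el D (gen (x j))" and ?d = "\<lambda>r. el D (dpow D i r (gen (x i)))"
  let ?q = "vi D i"
  have car [simp]: "gen (x i) \<in> carrier (free_alg D)" "gen (x j) \<in> carrier (free_alg D)"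
    using x ij by (metis gens_in_carrier(2,3))+
  have q: "?q \<noteq> 0" "?q \<noteq> inverse ?q" "qnum ?q 2 \<noteq> 0"
    using vi_sign_generic[OF rd ij(1), of 1] by auto
  have q2: "qnum ?q 2 = ?q + inverse ?q" using qnum_rec[OF q(1), of 0] q by (simp add: numeral_2_eq_2)
  have qe: "?q powi e + inverse (?q powi e) = qnum ?q 2"
    using e by (auto simp: q2 power_int_minus)
  have d1: "?d (Suc 0) = ?x"
    by (simp add: dpow_def qfact_eq qfac_def qnum_1[OF q(2)])
  have d2: "qnum ?q 2 *s ?d 2 = ?x * ?x"
    using el_dpow_step(1)[OF rd ij(1) car(1), of "Suc 0"] by (simp add: d1 numeral_2_eq_2)
  have "?d 2 * ?y - ?x * ?y * ?x + ?y * ?d 2 = 0"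
    using serre_relation[OF x ij ne] el_serre[OF car]
    by (simp add: pair d1 el_one el_one_mult_left numeral_2_eq_2 mult.assoc dpow_in_carrier)
  then have "qnum ?q 2 *s (?d 2 * ?y - ?x * ?y * ?x + ?y * ?d 2) = 0" by simp
  then have "(qnum ?q 2 *s ?d 2) * ?y - qnum ?q 2 *s (?x * ?y * ?x) + ?y * (qnum ?q 2 *s ?d 2) = 0"
    by (simp add: smul_distribs)
  then show ?thesis unfolding qe d2 by (simp add: algebra_simps)
qed



section \<open>Lusztig's symmetries up to a character\<close>

text \<open>
  On the weight space of \<open>\<nu>\<close> this is \<open>T'\<^sub>i\<^sub>,\<^sub>e\<close> times \<open>u\<close> to the power \<open>- \<langle>i, \<nu>\<rangle>\<close>: the weights of
  \<open>E\<^sub>i\<close>, \<open>F\<^sub>i\<close>, \<open>E\<^sub>j\<close> pair with \<open>i\<close> to \<open>2\<close>, \<open>- 2\<close>, \<open>- n\<close>. For \<open>F\<^sub>j\<close> the exponent is \<open>- n\<close>, on top of the factor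
  \<open>(- inverse Q) ^ n\<close> by which the formula for \<open>T'\<close> differs from the bracket.
\<close>

definition rescaled_braid :: "('i, 'y::ab_group_add, 'x::ab_group_add) root_datum \<Rightarrow> int \<Rightarrow> qv \<Rightarrow> 'i
    \<Rightarrow> (('i, 'y, 'x) ualg \<Rightarrow> ('i, 'y, 'x) ualg) \<Rightarrow> bool" where
  "rescaled_braid D e u i T \<longleftrightarrow> algebra_map T
     \<and> (\<forall>\<mu>. T (UK D \<mu>) = UK D (srefl D i \<mu>))
     \<and> T (UE D i) = - (inverse (u ^ 2) *s (UKt D e i * UF D i))
     \<and> T (UF D i) = - (u ^ 2 *s (UE D i * UKt D (- e) i))
     \<and> (\<forall>j\<in>idx D. j \<noteq> i \<longrightarrow> (let n = nat (- pair D (cor D i) (rt D j)); Q = vi D i powi e in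
          T (UE D j) = u ^ n *s qbr Q n (UE D i) (UE D j)
        \<and> T (UF D j) = inverse (- (Q * u)) ^ n *s qbr Q n (UF D i) (UF D j)))"

lemma rescaled_braidD:
  assumes "rescaled_braid D e u i T"
  shows "algebra_map T" "T (UK D \<mu>) = UK D (srefl D i \<mu>)"
    "T (UE D i) = - (inverse (u ^ 2) *s (UKt D e i * UF D i))"
    "T (UF D i) = - (u ^ 2 *s (UE D i * UKt D (- e) i))"
    "j \<in> idx D \<Longrightarrow> j \<noteq> i \<Longrightarrow> n = nat (- pair D (cor D i) (rt D j)) \<Longrightarrow> Q = vi D i powi e \<Longrightarrow>
      T (UE D j) = u ^ n *s qbr Q n (UE D i) (UE D j)"
    "j \<in> idx D \<Longrightarrow> j \<noteq> i \<Longrightarrow> n = nat (- pair D (cor D i) (rt D j)) \<Longrightarrow> Q = vi D i powi e \<Longrightarrow>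
      T (UF D j) = inverse (- (Q * u)) ^ n *s qbr Q n (UF D i) (UF D j)"
  using assms by (simp_all add: rescaled_braid_def Let_def)

lemma sign_powi_minus: "vi D i powi (- e) = inverse (vi D i powi e)"
  by (simp add: power_int_minus)

lemma lusztig_T1_rescaled:
  assumes rd: "is_root_datum D" and e: "e \<in> {1, -1}" and T: "lusztig_T1 D e T" and i: "i \<in> idx D"
  shows "rescaled_braid D e 1 i (lift_hom D D (T i))"
proof -
  have h: "hom_on_gens D D (T1_gen D e i) (T i)" using T i by (simp add: lusztig_T1_def)
  note g = lift_hom_gen[OF h]
  show ?thesis
    unfolding rescaled_braid_def Let_def
  proof (intro conjI allI ballI impI)
    show "algebra_map (lift_hom D D (T i))"
      using h by (simp add: hom_on_gens_def lift_hom_algebra_map)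
    show "lift_hom D D (T i) (UK D \<mu>) = UK D (srefl D i \<mu>)" for \<mu>
      by (simp add: g gens_def)
    show "lift_hom D D (T i) (UE D i) = - (inverse (1 ^ 2) *s (UKt D e i * UF D i))"
      using i by (simp add: g gens_def el_uminus el_mult gens_letters_mult)
    show "lift_hom D D (T i) (UF D i) = - (1 ^ 2 *s (UE D i * UKt D (- e) i))"
      using i by (simp add: g gens_def el_uminus el_mult gens_letters_mult)
    fix j assume j: "j \<in> idx D" "j \<noteq> i"
    let ?n = "nat (- pair D (cor D i) (rt D j))" and ?Q = "vi D i powi e"
    show "lift_hom D D (T i) (UE D j) = 1 ^ ?n *s qbr ?Q ?n (UE D i) (UE D j)"
      using i j el_braid_sum[OF rd i gens_in_carrier(2)[OF i] gens_in_carrier(2)[OF j(1)] e, of ?n]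
      by (simp add: g gens_def Let_def)
    show "lift_hom D D (T i) (UF D j) = inverse (- (?Q * 1)) ^ ?n *s qbr ?Q ?n (UF D i) (UF D j)"
      using i j el_braid_sum_rev[OF rd i gens_in_carrier(3)[OF i] gens_in_carrier(3)[OF j(1)] e, of ?n]
      by (simp add: g gens_def Let_def)
  qed
qed

text \<open>
  In \<open>T''\<close> the factors of \<open>F\<^sub>i K\<close> are in the other order than in \<open>T'\<close>; commuting them produces the power
  \<open>inverse (u ^ 2) = Q ^ 2\<close> that the character prescribes.
\<close>

lemma lusztig_T2_rescaled:
  assumes rd: "is_root_datum D" and e: "e \<in> {1, -1}" and T: "lusztig_T2 D e T" and i: "i \<in> idx D"
  shows "rescaled_braid D e (- inverse (vi D i powi e)) i (lift_hom D D (T i))"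
proof -
  have h: "hom_on_gens D D (T2_gen D e i) (T i)" using T i by (simp add: lusztig_T2_def)
  note g = lift_hom_gen[OF h]
  let ?Q = "vi D i powi e"
  have Q: "?Q \<noteq> 0" by (rule vi_sign_generic(1)[OF rd i e])
  note comm = UKt_commute[OF rd i, of _ i, unfolded root_datum_pair_self[OF rd i] sign_powi_minus]
  have FK: "UF D i * UKt D e i = ?Q ^ 2 *s (UKt D e i * UF D i)"
    using Q by (simp add: comm(2) power_int_minus del: power_mult_distrib)
  have KE: "UKt D (- e) i * UE D i = inverse ?Q ^ 2 *s (UE D i * UKt D (- e) i)"
    using comm(1)[of "- e"] by (simp add: sign_powi_minus)
  show ?thesis
    unfolding rescaled_braid_def Let_def
  proof (intro conjI allI ballI impI)
    show "algebra_map (lift_hom D D (T i))"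
      using h by (simp add: hom_on_gens_def lift_hom_algebra_map)
    show "lift_hom D D (T i) (UK D \<mu>) = UK D (srefl D i \<mu>)" for \<mu>
      by (simp add: g gens_def)
    show "lift_hom D D (T i) (UE D i) = - (inverse ((- inverse ?Q) ^ 2) *s (UKt D e i * UF D i))"
      using i by (simp add: g gens_def el_uminus el_mult gens_letters_mult FK power_inverse)
    show "lift_hom D D (T i) (UF D i) = - ((- inverse ?Q) ^ 2 *s (UE D i * UKt D (- e) i))"
      using i by (simp add: g gens_def el_uminus el_mult gens_letters_mult KE)
    fix j assume j: "j \<in> idx D" "j \<noteq> i"
    let ?n = "nat (- pair D (cor D i) (rt D j))"
    show "lift_hom D D (T i) (UE D j) = (- inverse ?Q) ^ ?n *s qbr ?Q ?n (UE D i) (UE D j)"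
      using i j el_braid_sum_rev[OF rd i gens_in_carrier(2)[OF i] gens_in_carrier(2)[OF j(1)] e, of ?n]
      by (simp add: g gens_def Let_def)
    have "inverse (- (?Q * (- inverse ?Q))) = 1" using Q by simp
    then show "lift_hom D D (T i) (UF D j) = inverse (- (?Q * (- inverse ?Q))) ^ ?n *s qbr ?Q ?n (UF D i) (UF D j)"
      using i j el_braid_sum[OF rd i gens_in_carrier(3)[OF i] gens_in_carrier(3)[OF j(1)] e, of ?n]
      by (simp add: g gens_def Let_def)
  qed
qed

lemma contractible_facts:
  assumes rd: "is_root_datum D" and ct: "contractible D p m"
  shows "p \<in> idx D" "m \<in> idx D" "p \<noteq> m" "contractible D m p"
    "pair D (cor D p) (rt D m) = -1" "pair D (cor D m) (rt D p) = -1"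
    "form D m m = form D p p" "form (contract D p m) None None = form D p p"
proof -
  show pm: "p \<in> idx D" "m \<in> idx D" using ct by (auto simp: contractible_def)
  have f: "form D p p = - 2 * form D p m" "form D m m = - 2 * form D p m"
    using ct by (auto simp: contractible_def)
  have sym: "form D m p = form D p m" using rd pm by (auto simp: is_root_datum_def cartan_datum_def)
  have pos: "form D p p > 0" "form D m m > 0" using root_datum_form[OF rd] pm by fastforce+
  show ne: "p \<noteq> m" using f pos by auto
  show "contractible D m p" using f sym pm by (simp add: contractible_def)
  show "form D m m = form D p p" using f by simp
  have pr: "pair D (cor D i) (rt D j) * form D i i = 2 * form D i j" if "i \<in> idx D" "j \<in> idx D" for i j
    using rd that by (auto simp: is_root_datum_def)
  have "(pair D (cor D p) (rt D m) + 1) * form D p p = 0" "(pair D (cor D m) (rt D p) + 1) * form D m m = 0"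
    using pr[OF pm] pr[OF pm(2,1)] f sym by (simp_all add: algebra_simps)
  then show "pair D (cor D p) (rt D m) = -1" "pair D (cor D m) (rt D p) = -1" using pos by auto
  show "form (contract D p m) None None = form D p p" using ne f sym by (simp add: contract_def)
qed

text \<open>
  The character cancels: \<open>E\<^sub>p\<close> has weight -1 for \<open>m\<close>, and its image under \<open>Tm\<close> has weight 1 for \<open>p\<close>; likewise for
  \<open>F\<^sub>p\<close> with the opposite signs.
\<close>

lemma braid_rank_two:
  assumes rd: "is_root_datum D" and ct: "contractible D p m" and e: "e \<in> {1, -1}" and u: "u \<noteq> 0"
    and Tp: "rescaled_braid D e u p Tp" and Tm: "rescaled_braid D e u m Tm"
  shows "Tp (Tm (UE D p)) = UE D m" "Tp (Tm (UF D p)) = UF D m"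
proof -
  note f = contractible_facts[OF rd ct]
  define Q where "Q = vi D p powi e"
  have vm: "vi D m powi e = Q" by (simp add: Q_def vi_def f)
  have Q: "Q \<noteq> 0" "Q \<noteq> inverse Q"
    unfolding Q_def using vi_sign_generic[OF rd f(1) e] by blast+
  note tp = rescaled_braidD[OF Tp] and tm = rescaled_braidD[OF Tm]
  have Q': "vi D p powi - e = inverse Q" by (simp add: Q_def power_int_minus)
  have QQ: "inverse (vi D p - inverse (vi D p)) *s (UKt D 1 p - UKt D (- 1) p)
      = inverse (Q - inverse Q) *s (UKt D e p - UKt D (- e) p)"
  proof (cases "e = 1")
    case False
    then have "e = -1" using e by simp
    moreover have "inverse (a - b) *s (c - d) = inverse (b - a) *s (d - c)" for a b and c d :: "('a, 'b, 'c) ualg"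
    proof -
      have "inverse (a - b) *s (c - d) = inverse (- (b - a)) *s (- (d - c))" by simp
      then show ?thesis by (simp only: inverse_minus_eq smul_minus_left smul_minus_right minus_minus)
    qed
    ultimately show ?thesis by (simp add: Q_def power_int_minus)
  qed (simp add: Q_def)
  have KEm: "UKt D e p * UE D m = inverse Q *s (UE D m * UKt D e p)"
    "UKt D (- e) p * UE D m = Q *s (UE D m * UKt D (- e) p)"
    and KFm: "UKt D e p * UF D m = Q *s (UF D m * UKt D e p)"
    "UKt D (- e) p * UF D m = inverse Q *s (UF D m * UKt D (- e) p)"
    by (simp_all add: UKt_commute[OF rd f(2)] f(5) Q' power_int_minus flip: Q_def)
  have KEp: "UKt D e p * UE D p = Q ^ 2 *s (UE D p * UKt D e p)"
    "UKt D (- e) p * UE D p = inverse Q ^ 2 *s (UE D p * UKt D (- e) p)"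
    and KFp: "UKt D e p * UF D p = inverse Q ^ 2 *s (UF D p * UKt D e p)"
    "UKt D (- e) p * UF D p = Q ^ 2 *s (UF D p * UKt D (- e) p)"
    by (simp_all add: UKt_commute[OF rd f(1)] root_datum_pair_self[OF rd f(1)] Q' power_int_minus
        flip: Q_def power_inverse)
  have n1: "nat (- pair D (cor D m) (rt D p)) = 1" "nat (- pair D (cor D p) (rt D m)) = 1"
    by (simp_all add: f)
  have Em: "Tm (UE D p) = u *s (UE D p * UE D m - Q *s (UE D m * UE D p))"
    using tm(5)[OF f(1,3) n1(1)[symmetric] refl] by (simp add: vm qbr_1[OF Q(2), simplified])
  have Ep: "Tp (UE D m) = u *s (UE D m * UE D p - Q *s (UE D p * UE D m))"
    using tp(5)[OF f(2) f(3)[symmetric] n1(2)[symmetric] Q_def] by (simp add: qbr_1[OF Q(2), simplified])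
  let ?c = "inverse (- (Q * u))"
  have Fm: "Tm (UF D p) = ?c *s (UF D p * UF D m - Q *s (UF D m * UF D p))"
    using tm(6)[OF f(1,3) n1(1)[symmetric] refl] by (simp add: vm qbr_1[OF Q(2), simplified])
  have Fp: "Tp (UF D m) = ?c *s (UF D m * UF D p - Q *s (UF D p * UF D m))"
    using tp(6)[OF f(2) f(3)[symmetric] n1(2)[symmetric] Q_def] by (simp add: qbr_1[OF Q(2), simplified])
  show "Tp (Tm (UE D p)) = UE D m"
    unfolding Em
  proof (rule braid_root_vector[OF tp(1) Q u Ep tp(3)])
    show "UE D m * UKt D e p = Q *s (UKt D e p * UE D m)" using Q by (simp add: KEm)
    show "UE D m * UKt D (- e) p = inverse Q *s (UKt D (- e) p * UE D m)" using Q by (simp add: KEm)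
    show "UE D p * UKt D e p = inverse (Q ^ 2) *s (UKt D e p * UE D p)" using Q by (simp add: KEp)
    show "UE D m * UF D p = UF D p * UE D m" using UE_UF[OF f(2,1)] f(3) by simp
    show "UE D p * UF D p - UF D p * UE D p = inverse (Q - inverse Q) *s (UKt D e p - UKt D (- e) p)"
      using UE_UF[OF f(1,1)] by (simp only: QQ if_True simp_thms)
    show "UKt D e p * (UKt D (- e) p * UE D m) = UE D m" using f by (simp add: UKt_inverse)
  qed
  show "Tp (Tm (UF D p)) = UF D m"
    unfolding Fm
  proof (rule braid_root_vector[OF tp(1) Q _ Fp, where k = "UKt D (- e) p" and k' = "UKt D e p" and f = "UE D p"])
    show "?c \<noteq> 0" using Q u by simp
    have "UE D p * UKt D (- e) p = Q ^ 2 *s (UKt D (- e) p * UE D p)"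
      using Q by (simp add: KEp power_inverse)
    then show "Tp (UF D p) = - (inverse (?c ^ 2) *s (UKt D (- e) p * UE D p))"
      by (simp add: tp(4) power_mult_distrib power_inverse mult.commute)
    show "UF D m * UKt D (- e) p = Q *s (UKt D (- e) p * UF D m)" using Q by (simp add: KFm)
    show "UF D m * UKt D e p = inverse Q *s (UKt D e p * UF D m)" using Q by (simp add: KFm)
    show "UF D p * UKt D (- e) p = inverse (Q ^ 2) *s (UKt D (- e) p * UF D p)" using Q by (simp add: KFp)
    show "UF D m * UE D p = UE D p * UF D m" using UE_UF[OF f(1,2)] f(3) by simp
    have "UF D p * UE D p - UE D p * UF D p = - (UE D p * UF D p - UF D p * UE D p)" by simp
    also have "\<dots> = inverse (Q - inverse Q) *s (UKt D (- e) p - UKt D e p)"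
      unfolding UE_UF[OF f(1,1)] by (simp only: QQ if_True simp_thms smul_minus_right[symmetric] minus_diff_eq)
    finally show "UF D p * UE D p - UE D p * UF D p = inverse (Q - inverse Q) *s (UKt D (- e) p - UKt D e p)" .
    show "UKt D (- e) p * (UKt D e p * UF D m) = UF D m"
      using f UKt_inverse[of "gen (F m)" D "- e" p] by simp
  qed
qed



section \<open>The triple product at the contracted index\<close>

lemma contract_simps:
  assumes "p \<noteq> m"
  shows "cor (contract D p m) None = cor D p + cor D m" "rt (contract D p m) None = rt D p + rt D m"
    "cor (contract D p m) (Some j) = cor D j" "rt (contract D p m) (Some j) = rt D j"
    "pair (contract D p m) = pair D" "form (contract D p m) (Some j) (Some k) = form D j k"
    "idx (contract D p m) = insert None (Some ` (idx D - {p, m}))"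
  using assms by (simp_all add: contract_def)

lemma end_vertex_pair:
  assumes rd: "is_root_datum D" and ev: "end_vertex D p m i" and ij: "i \<in> idx D" "j \<in> idx D - {p, m}"
  shows "pair D (cor D i) (rt D j) = 0" "pair D (cor D j) (rt D i) = 0"
proof -
  have j: "j \<in> idx D" using ij by simp
  have "form D i j = 0" "form D j i = 0"
    using ev ij rd by (auto simp: end_vertex_def is_root_datum_def cartan_datum_def)
  moreover have "pair D (cor D i) (rt D j) * form D i i = 2 * form D i j"
    "pair D (cor D j) (rt D i) * form D j j = 2 * form D j i"
    using rd ij(1) j by (auto simp: is_root_datum_def)
  ultimately show "pair D (cor D i) (rt D j) = 0" "pair D (cor D j) (rt D i) = 0"
    using root_datum_form[OF rd ij(1)] root_datum_form[OF rd j] by auto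
qed

lemma el_E0:
  assumes "p \<in> idx D" "m \<in> idx D"
  shows "el D (E0 D p m \<epsilon>) = UE D p * UE D m - vi0 D p m powi (- \<epsilon>) *s (UE D m * UE D p)"
  using assms by (simp add: E0_def el_diff el_mult gens_letters_mult scal_in_carrier mult.assoc)

lemma el_F0:
  assumes "p \<in> idx D" "m \<in> idx D"
  shows "el D (F0 D p m \<epsilon>) = UF D m * UF D p - vi0 D p m powi \<epsilon> *s (UF D p * UF D m)"
  using assms by (simp add: F0_def el_diff el_mult gens_letters_mult scal_in_carrier mult.assoc)

lemma E0_F0_in_carrier [simp]:
  assumes "p \<in> idx D" "m \<in> idx D"
  shows "E0 D p m \<epsilon> \<in> carrier (free_alg D)" "F0 D p m \<epsilon> \<in> carrier (free_alg D)"
  using assms by (simp_all add: E0_def F0_def diff_in_carrier gens_letters_mult scal_in_carrier)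

text \<open>
  \<open>s\<^sub>+ s\<^sub>- s\<^sub>+\<close> is the reflection in the root \<open>i\<^sub>+ + i\<^sub>-\<close> of the rank two root system.
\<close>

lemma srefl_contract:
  assumes rd: "is_root_datum D" and ct: "contractible D p m"
  shows "srefl D p (srefl D m (srefl D p \<mu>)) = srefl (contract D p m) None \<mu>"
proof -
  note f = contractible_facts[OF rd ct] and pr = root_datum_pair[OF rd]
  show ?thesis
    by (simp add: srefl_def contract_simps[OF f(3)] pr f root_datum_pair_self[OF rd f(1)]
        root_datum_pair_self[OF rd f(2)] zscale_add zscale_minus
        zscale_plus algebra_simps)
qed

lemma gens_simps [simp]:
  "E i \<in> gens D \<longleftrightarrow> i \<in> idx D" "F i \<in> gens D \<longleftrightarrow> i \<in> idx D" "K \<mu> \<in> gens D"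
  by (auto simp: gens_def)

locale contracted_symmetry =
  fixes D :: "('i, 'y::ab_group_add, 'x::ab_group_add) root_datum" and p m :: 'i and e \<epsilon> :: int and u :: qv
    and Tp Tm :: "('i, 'y, 'x) ualg \<Rightarrow> ('i, 'y, 'x) ualg"
  assumes rd: "is_root_datum D" and ct: "contractible D p m"
    and e: "e \<in> {1, -1}" and \<epsilon>: "\<epsilon> \<in> {1, -1}"
    and end_vertex: "(e * \<epsilon> = -1 \<and> end_vertex D p m p) \<or> (e * \<epsilon> = 1 \<and> end_vertex D p m m)"
    and u: "u \<noteq> 0"
    and Tp: "rescaled_braid D e u p Tp" and Tm: "rescaled_braid D e u m Tm"
begin

definition "Q = vi D p powi e"
definition "\<tau> a = Tp (Tm (Tp a))"

lemmas facts = contractible_facts[OF rd ct]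
lemmas tp = rescaled_braidD[OF Tp]
lemmas tm = rescaled_braidD[OF Tm]

lemma pm [simp]: "p \<in> idx D" "m \<in> idx D" "p \<noteq> m" "m \<noteq> p"
  using facts by auto

lemma Q_nonzero [simp]: "Q \<noteq> 0" and Q_generic: "Q \<noteq> inverse Q" "qfac Q n \<noteq> 0"
  unfolding Q_def using vi_sign_generic[OF rd facts(1) e] by blast+

lemma Q_eqs: "vi D p powi e = Q" "vi D m powi e = Q" "vi (contract D p m) None powi e = Q"
  by (simp_all add: Q_def vi_def facts)

lemma vi0_powi: "vi0 D p m powi e = Q" "vi0 D p m powi (- e) = inverse Q"
  by (simp_all add: vi0_def Q_eqs power_int_minus)

lemma tau_algebra_map: "algebra_map \<tau>"
  using tp(1) tm(1) by (simp add: \<tau>_def algebra_map_def)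

lemma tau_UK: "\<tau> (UK D \<mu>) = UK D (srefl (contract D p m) None \<mu>)"
  by (simp add: \<tau>_def tp(2) tm(2) srefl_contract[OF rd ct])

text \<open>
  The Cartan part of \<open>T\<^sub>+ T\<^sub>- (E\<^sub>+) = E\<^sub>-\<close>: \<open>s\<^sub>+ s\<^sub>-\<close> maps \<open>i\<^sub>+\<close> to \<open>i\<^sub>-\<close>.
\<close>

lemma tau_UKt: "Tp (Tm (UKt D s p)) = UKt D s m"
proof -
  have "srefl D p (srefl D m (zscale n (cor D p))) = zscale n (cor D m)" for n
    by (simp add: srefl_def root_datum_pair[OF rd] facts root_datum_pair_self[OF rd facts(1)]
        zscale_minus flip: zscale_minus)
  then show ?thesis by (simp add: Kt_def tp(2) tm(2) facts)
qed

lemma rank_two: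
  "Tp (Tm (UE D p)) = UE D m" "Tp (Tm (UF D p)) = UF D m"
  "Tm (Tp (UE D m)) = UE D p" "Tm (Tp (UF D m)) = UF D p"
  by (rule braid_rank_two[OF rd ct e u Tp Tm] braid_rank_two[OF rd facts(4) e u Tm Tp])+

lemma tau_simple:
  "\<tau> (UE D p) = - (inverse (u ^ 2) *s (UKt D e m * UF D m))"
  "\<tau> (UE D m) = - (inverse (u ^ 2) *s (UKt D e p * UF D p))"
  "\<tau> (UF D p) = - (u ^ 2 *s (UE D m * UKt D (- e) m))"
  "\<tau> (UF D m) = - (u ^ 2 *s (UE D p * UKt D (- e) p))"
  by (simp_all add: \<tau>_def tp(3,4) rank_two tau_UKt algebra_map_simps[OF tp(1)] algebra_map_simps[OF tm(1)])

text \<open>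
  This is \<open>UKt (contract D p m) s None\<close> carried over to \<open>D\<close>.
\<close>

definition "K0 s = UK D (zscale (s * (form D p p div 2)) (cor D p + cor D m))"

lemma K0_eq: "UKt D s p * UKt D s m = K0 s" "UKt D s m * UKt D s p = K0 s"
  by (simp_all add: K0_def Kt_def facts zscale_plus add.commute flip: UK_add)

lemma UKt_cross:
  "UF D m * UKt D e p = inverse Q *s (UKt D e p * UF D m)"
  "UF D p * UKt D e m = inverse Q *s (UKt D e m * UF D p)"
  "UKt D (- e) p * UE D m = Q *s (UE D m * UKt D (- e) p)"
  "UKt D (- e) m * UE D p = Q *s (UE D p * UKt D (- e) m)"
proof -
  have "UKt D e p * UF D m = Q *s (UF D m * UKt D e p)" "UKt D e m * UF D p = Q *s (UF D p * UKt D e m)"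
    using UKt_commute(2)[OF rd facts(2), of e p] UKt_commute(2)[OF rd facts(1), of e m]
    by (simp_all add: facts Q_eqs)
  then show "UF D m * UKt D e p = inverse Q *s (UKt D e p * UF D m)"
    "UF D p * UKt D e m = inverse Q *s (UKt D e m * UF D p)" by simp_all
  show "UKt D (- e) p * UE D m = Q *s (UE D m * UKt D (- e) p)"
    "UKt D (- e) m * UE D p = Q *s (UE D p * UKt D (- e) m)"
    using UKt_commute(1)[OF rd facts(2), of "- e" p] UKt_commute(1)[OF rd facts(1), of "- e" m]
    by (simp_all add: facts Q_eqs sign_powi_minus power_int_minus)
qed

text \<open>
  Up to Cartan factors, \<open>\<tau>\<close> maps \<open>E\<^sub>p\<close> to \<open>F\<^sub>m\<close> and \<open>E\<^sub>m\<close> to \<open>F\<^sub>p\<close>. This turns the \<open>q\<close>-commutator defining \<open>E\<^sub>i\<^sub>0\<close> into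
  the one defining \<open>F\<^sub>i\<^sub>0\<close> for the opposite sign.
\<close>

lemma tau_E0:
  "\<tau> (el D (E0 D p m \<epsilon>)) = (inverse (u ^ 4) * inverse Q) *s (K0 e * el D (F0 D p m (- \<epsilon>)))"
proof -
  have 1: "UKt D e m * UF D m * (UKt D e p * UF D p) = inverse Q *s (K0 e * (UF D m * UF D p))"
    and 2: "UKt D e p * UF D p * (UKt D e m * UF D m) = inverse Q *s (K0 e * (UF D p * UF D m))"
  proof -
    have "UKt D e m * UF D m * (UKt D e p * UF D p) = UKt D e m * (UF D m * UKt D e p) * UF D p"
      by (simp only: mult.assoc)
    also have "\<dots> = inverse Q *s (UKt D e m * UKt D e p * (UF D m * UF D p))"
      by (simp only: UKt_cross smul_mult_left smul_mult_right mult.assoc)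
    finally show "UKt D e m * UF D m * (UKt D e p * UF D p) = inverse Q *s (K0 e * (UF D m * UF D p))"
      by (simp only: K0_eq)
    have "UKt D e p * UF D p * (UKt D e m * UF D m) = UKt D e p * (UF D p * UKt D e m) * UF D m"
      by (simp only: mult.assoc)
    also have "\<dots> = inverse Q *s (UKt D e p * UKt D e m * (UF D p * UF D m))"
      by (simp only: UKt_cross smul_mult_left smul_mult_right mult.assoc)
    finally show "UKt D e p * UF D p * (UKt D e m * UF D m) = inverse Q *s (K0 e * (UF D p * UF D m))"
      by (simp only: K0_eq)
  qed
  have u4: "inverse (u ^ 4) = inverse (u ^ 2) * inverse (u ^ 2)"
    by (simp flip: power_add inverse_mult_distrib)
  show ?thesis
    unfolding el_E0[OF pm(1,2)] el_F0[OF pm(1,2)] u4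
    by (simp add: algebra_map_simps[OF tau_algebra_map] tau_simple 1 2 smul_distribs right_diff_distrib
        mult.commute mult.left_commute)
qed

lemma tau_F0:
  "\<tau> (el D (F0 D p m \<epsilon>)) = (u ^ 4 * Q) *s (el D (E0 D p m (- \<epsilon>)) * K0 (- e))"
proof -
  have 1: "UE D p * UKt D (- e) p * (UE D m * UKt D (- e) m) = Q *s (UE D p * UE D m * K0 (- e))"
    and 2: "UE D m * UKt D (- e) m * (UE D p * UKt D (- e) p) = Q *s (UE D m * UE D p * K0 (- e))"
  proof -
    have "UE D p * UKt D (- e) p * (UE D m * UKt D (- e) m) = UE D p * (UKt D (- e) p * UE D m) * UKt D (- e) m"
      by (simp only: mult.assoc)
    also have "\<dots> = Q *s (UE D p * UE D m * (UKt D (- e) p * UKt D (- e) m))"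
      by (simp only: UKt_cross smul_mult_left smul_mult_right mult.assoc)
    finally show "UE D p * UKt D (- e) p * (UE D m * UKt D (- e) m) = Q *s (UE D p * UE D m * K0 (- e))"
      by (simp only: K0_eq)
    have "UE D m * UKt D (- e) m * (UE D p * UKt D (- e) p) = UE D m * (UKt D (- e) m * UE D p) * UKt D (- e) p"
      by (simp only: mult.assoc)
    also have "\<dots> = Q *s (UE D m * UE D p * (UKt D (- e) m * UKt D (- e) p))"
      by (simp only: UKt_cross smul_mult_left smul_mult_right mult.assoc)
    finally show "UE D m * UKt D (- e) m * (UE D p * UKt D (- e) p) = Q *s (UE D m * UE D p * K0 (- e))"
      by (simp only: K0_eq)
  qed
  have u4: "u ^ 4 = u ^ 2 * u ^ 2" by (simp flip: power_add)
  show ?thesis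
    unfolding el_E0[OF pm(1,2)] el_F0[OF pm(1,2)] u4
    by (simp add: algebra_map_simps[OF tau_algebra_map] tau_simple 1[unfolded mult.assoc]
        2[unfolded mult.assoc] smul_distribs algebra_simps)
qed

context
  fixes j n
  assumes j: "j \<in> idx D - {p, m}" and n: "n = nat (- pair D (cor D p + cor D m) (rt D j))"
begin

text \<open>
  The end vertex condition decides which of the two orbit computations applies. The extra factors \<open>- Q\<close> compare
  the root vector obtained there with \<open>E\<^sub>i\<^sub>0\<close> and \<open>F\<^sub>i\<^sub>0\<close> as they are normalised.
\<close>

lemma tau_other:
  "\<tau> (UE D j) = (u ^ (2 * n) * (if e * \<epsilon> = -1 then - Q else 1) ^ n) *s qbr Q n (el D (E0 D p m (- \<epsilon>))) (UE D j)"
  "\<tau> (UF D j) = (inverse (- (Q * u)) ^ (2 * n) * (if e * \<epsilon> = -1 then 1 else - Q) ^ n)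
      *s qbr Q n (el D (F0 D p m (- \<epsilon>))) (UF D j)"
proof -
  have jj: "j \<in> idx D" "j \<noteq> p" "j \<noteq> m" using j by auto
  have npm: "nat (- pair D (cor D m) (rt D p)) = 1" "nat (- pair D (cor D p) (rt D m)) = 1"
    by (simp_all add: facts)
  let ?c = "inverse (- (Q * u))"
  have EF: "Tp (UE D m) = u *s (UE D m * UE D p - Q *s (UE D p * UE D m))"
      "Tp (UF D m) = ?c *s (UF D m * UF D p - Q *s (UF D p * UF D m))"
    using tp(5)[OF facts(2) pm(4) npm(2)[symmetric] Q_def] tp(6)[OF facts(2) pm(4) npm(2)[symmetric] Q_def]
    by (simp_all add: qbr_1[OF Q_generic(1), simplified])
  from end_vertex consider "e * \<epsilon> = -1" "\<epsilon> = - e" "end_vertex D p m p" | "e * \<epsilon> = 1" "\<epsilon> = e" "end_vertex D p m m"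
    using e \<epsilon> by auto
  then have "\<tau> (UE D j) = (u ^ (2 * n) * (if e * \<epsilon> = -1 then - Q else 1) ^ n) *s qbr Q n (el D (E0 D p m (- \<epsilon>))) (UE D j)
    \<and> \<tau> (UF D j) = (?c ^ (2 * n) * (if e * \<epsilon> = -1 then 1 else - Q) ^ n)
      *s qbr Q n (el D (F0 D p m (- \<epsilon>))) (UF D j)"
  proof cases
    case 1
    note ep = end_vertex_pair[OF rd 1(3) facts(1) j]
    have np: "nat (- pair D (cor D p) (rt D j)) = 0" "nat (- pair D (cor D m) (rt D j)) = n"
      by (simp_all add: n ep root_datum_pair[OF rd])
    have v: "UE D m * UE D p - Q *s (UE D p * UE D m) = (- Q) *s el D (E0 D p m (- \<epsilon>))"
      "UF D m * UF D p - Q *s (UF D p * UF D m) = el D (F0 D p m (- \<epsilon>))"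
      by (simp_all add: el_E0 el_F0 1(2) vi0_powi smul_distribs)
    have "\<tau> (UE D j) = u ^ (2 * n) *s qbr Q n (UE D m * UE D p - Q *s (UE D p * UE D m)) (UE D j)"
      unfolding \<tau>_def
      by (rule braid_orbit_fixed_first[OF tp(1) tm(1) _ _ EF(1)])
        (use tp(5)[OF jj(1,2) np(1)[symmetric] Q_def] tm(5)[OF jj(1,3) np(2)[symmetric] Q_eqs(2)[symmetric]] in simp_all)
    then have E: "\<tau> (UE D j) = (u ^ (2 * n) * (if e * \<epsilon> = -1 then - Q else 1) ^ n) *s qbr Q n (el D (E0 D p m (- \<epsilon>))) (UE D j)"
      unfolding v qbr_smul_op using 1(1) by simp
    have "\<tau> (UF D j) = ?c ^ (2 * n) *s qbr Q n (UF D m * UF D p - Q *s (UF D p * UF D m)) (UF D j)"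
      unfolding \<tau>_def
      by (rule braid_orbit_fixed_first[OF tp(1) tm(1) _ _ EF(2)])
        (use tp(6)[OF jj(1,2) np(1)[symmetric] Q_def] tm(6)[OF jj(1,3) np(2)[symmetric] Q_eqs(2)[symmetric]] in simp_all)
    then have "\<tau> (UF D j) = (?c ^ (2 * n) * (if e * \<epsilon> = -1 then 1 else - Q) ^ n)
        *s qbr Q n (el D (F0 D p m (- \<epsilon>))) (UF D j)"
      unfolding v using 1(1) by simp
    with E show ?thesis by blast
  next
    case 2
    note em = end_vertex_pair[OF rd 2(3) facts(2) j]
    have nm: "nat (- pair D (cor D p) (rt D j)) = n" "nat (- pair D (cor D m) (rt D j)) = 0"
      by (simp_all add: n em root_datum_pair[OF rd])
    have v: "UE D p * UE D m - Q *s (UE D m * UE D p) = el D (E0 D p m (- \<epsilon>))"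
      "UF D p * UF D m - Q *s (UF D m * UF D p) = (- Q) *s el D (F0 D p m (- \<epsilon>))"
      by (simp_all add: el_E0 el_F0 2(2) vi0_powi smul_distribs)
    note serre = serre_simple_edge[OF rd _ facts(1,2,3,5) e, unfolded Q_eqs]
      serre_simple_edge[OF rd _ facts(2,1) pm(4) facts(6) e, unfolded Q_eqs]
    have zE: "UE D j * UE D m = UE D m * UE D j" and zF: "UF D j * UF D m = UF D m * UF D j"
      using serre_orthogonal[OF rd _ jj(1) facts(2) jj(3) em(2), of E]
        serre_orthogonal[OF rd _ jj(1) facts(2) jj(3) em(2), of F] by simp_all
    have "\<tau> (UE D j) = u ^ (2 * n) *s qbr Q n (UE D p * UE D m - Q *s (UE D m * UE D p)) (UE D j)"
      unfolding \<tau>_def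
      by (rule braid_orbit_fixed_second[OF tp(1) tm(1) tp(5)[OF jj(1,2) nm(1)[symmetric] Q_def] _ rank_two(1)
          serre(1)[of E, simplified] serre(2)[of E, simplified] Q_nonzero Q_generic zE])
        (use tm(5)[OF jj(1,3) nm(2)[symmetric] Q_eqs(2)[symmetric]] in simp)
    then have E: "\<tau> (UE D j) = (u ^ (2 * n) * (if e * \<epsilon> = -1 then - Q else 1) ^ n) *s qbr Q n (el D (E0 D p m (- \<epsilon>))) (UE D j)"
      unfolding v using 2(1) by simp
    have "\<tau> (UF D j) = ?c ^ (2 * n) *s qbr Q n (UF D p * UF D m - Q *s (UF D m * UF D p)) (UF D j)"
      unfolding \<tau>_def
      by (rule braid_orbit_fixed_second[OF tp(1) tm(1) tp(6)[OF jj(1,2) nm(1)[symmetric] Q_def] _ rank_two(2)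
          serre(1)[of F, simplified] serre(2)[of F, simplified] Q_nonzero Q_generic zF])
        (use tm(6)[OF jj(1,3) nm(2)[symmetric] Q_eqs(2)[symmetric]] in simp)
    then have "\<tau> (UF D j) = (?c ^ (2 * n) * (if e * \<epsilon> = -1 then 1 else - Q) ^ n)
        *s qbr Q n (el D (F0 D p m (- \<epsilon>))) (UF D j)"
      unfolding v qbr_smul_op using 2(1) by simp
    with E show ?thesis by blast
  qed
  then show "\<tau> (UE D j) = (u ^ (2 * n) * (if e * \<epsilon> = -1 then - Q else 1) ^ n) *s qbr Q n (el D (E0 D p m (- \<epsilon>))) (UE D j)"
    "\<tau> (UF D j) = (?c ^ (2 * n) * (if e * \<epsilon> = -1 then 1 else - Q) ^ n)
      *s qbr Q n (el D (F0 D p m (- \<epsilon>))) (UF D j)" by blast+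
qed

end

text \<open>
  The scalar such that \<open>\<chi>\<close> multiplies \<open>E\<^sub>j\<close> by \<open>lam ^ n\<close> and \<open>F\<^sub>j\<close> by the inverse. In terms of \<open>u\<close> it depends only
  on which of the two indices is the end vertex, although \<open>\<chi>\<close> itself is chosen differently for \<open>T'\<close> and \<open>T''\<close>.
\<close>

definition "lam = (if e * \<epsilon> = -1 then u else - (Q * u))"

context
  fixes s :: int
  assumes s: "(u = 1 \<and> s = e * \<epsilon>) \<or> (u = - inverse Q \<and> s = - e * \<epsilon>)"
begin

lemma chi_gen_None:
  "el D (chi_gen D p m \<epsilon> s (E None)) = (- inverse (Q * u ^ 2)) *s el D (E0 D p m \<epsilon>)"
  "el D (chi_gen D p m \<epsilon> s (F None)) = (- (Q * u ^ 2)) *s el D (F0 D p m \<epsilon>)"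
proof -
  have "s \<in> {1, -1}" using s e \<epsilon> by auto
  then have if_s: "(if s = 1 then - \<epsilon> else \<epsilon>) = - (s * \<epsilon>)" "(if s = 1 then \<epsilon> else - \<epsilon>) = s * \<epsilon>" by auto
  have pow: "vi0 D p m powi (- (s * \<epsilon>)) = inverse (Q * u ^ 2) \<and> vi0 D p m powi (s * \<epsilon>) = Q * u ^ 2"
    using s
  proof
    assume *: "u = 1 \<and> s = e * \<epsilon>"
    then have se: "s * \<epsilon> = e" using \<epsilon> by auto
    show ?thesis unfolding se using * by (simp add: vi0_powi)
  next
    assume *: "u = - inverse Q \<and> s = - e * \<epsilon>"
    then have se: "s * \<epsilon> = - e" using \<epsilon> by auto
    show ?thesis unfolding se using * by (simp add: vi0_powi power2_eq_square)
  qed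
  show "el D (chi_gen D p m \<epsilon> s (E None)) = (- inverse (Q * u ^ 2)) *s el D (E0 D p m \<epsilon>)"
    "el D (chi_gen D p m \<epsilon> s (F None)) = (- (Q * u ^ 2)) *s el D (F0 D p m \<epsilon>)"
    unfolding chi_gen.simps option.case if_s pow[THEN conjunct1] pow[THEN conjunct2]
    by (simp_all add: el_uminus el_scal gens_letters_mult scal_in_carrier)
qed

lemma chi_gen_Some:
  assumes j: "j \<in> idx D - {p, m}" and n: "n = nat (- pair D (cor D p + cor D m) (rt D j))"
  shows "el D (chi_gen D p m \<epsilon> s (E (Some j))) = lam ^ n *s UE D j"
    "el D (chi_gen D p m \<epsilon> s (F (Some j))) = inverse lam ^ n *s UF D j"
proof -
  have "pair D (cor D p) (rt D j) \<le> 0" "pair D (cor D m) (rt D j) \<le> 0"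
    using root_datum_pair_nonpos[OF rd, of p j] root_datum_pair_nonpos[OF rd, of m j] j by auto
  then have pn: "pair D (cor D p + cor D m) (rt D j) = - int n" by (simp add: n root_datum_pair[OF rd])
  have sgn: "(- vi0 D p m) powi \<epsilon> = - (vi0 D p m powi \<epsilon>)" using \<epsilon> by (auto simp: power_int_minus)
  have "s \<in> {1, -1}" using s e \<epsilon> by auto
  have l: "lam = (if s = 1 then - (vi0 D p m powi \<epsilon>) else 1)"
  proof (cases "e * \<epsilon> = -1")
    case True
    then have "\<epsilon> = - e" using e \<epsilon> by auto
    then have v: "vi0 D p m powi \<epsilon> = inverse Q" by (simp add: vi0_powi)
    have l: "lam = u" using True by (simp add: lam_def)
    from s True have "(u = 1 \<and> s = -1) \<or> (u = - inverse Q \<and> s = 1)" by auto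
    then show ?thesis unfolding l v by (elim disjE conjE) simp_all
  next
    case False
    then have eq: "e * \<epsilon> = 1" "\<epsilon> = e" using e \<epsilon> by auto
    have v: "vi0 D p m powi \<epsilon> = Q" by (simp add: eq(2) vi0_powi)
    have l: "lam = - (Q * u)" using False by (simp add: lam_def)
    from s eq(1) have "(u = 1 \<and> s = 1) \<or> (u = - inverse Q \<and> s = -1)" by auto
    then show ?thesis unfolding l v by (elim disjE conjE) simp_all
  qed
  have k1: "(- vi0 D p m) powi (- \<epsilon> * pair D (cor D p + cor D m) (rt D j)) = (- (vi0 D p m powi \<epsilon>)) ^ n"
    unfolding pn minus_mult_minus power_int_mult sgn by (rule power_int_of_nat)
  have k2: "(- vi0 D p m) powi (\<epsilon> * pair D (cor D p + cor D m) (rt D j)) = inverse (- (vi0 D p m powi \<epsilon>)) ^ n"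
    unfolding pn power_int_mult sgn power_int_minus power_int_of_nat by (rule power_inverse[symmetric])
  show "el D (chi_gen D p m \<epsilon> s (E (Some j))) = lam ^ n *s UE D j"
    "el D (chi_gen D p m \<epsilon> s (F (Some j))) = inverse lam ^ n *s UF D j"
    unfolding l chi_gen.simps option.case k1 k2 using j by (cases "s = 1"; simp add: el_scal)+
qed

text \<open>
  In the application \<open>\<psi>\<close> and \<open>\<psi>'\<close> are the embeddings \<open>\<Psi>\<close> for the signs \<open>\<epsilon>\<close> and \<open>- \<epsilon>\<close>, and \<open>\<xi>\<close> is \<open>\<chi>\<close> after \<open>\<psi>'\<close>.
  The witness \<open>w\<close> shows both that \<open>\<tau>\<close> maps into the domain of \<open>\<chi>\<close> and what \<open>\<chi>\<close> does to the value. It is a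
  multiple of \<open>Th\<close> at the generator, with the scalar read off from the values of \<open>\<tau>\<close> above.
\<close>

lemma tau_intertwines_generators:
  assumes Th: "rescaled_braid (contract D p m) e u None Th"
    and \<psi>: "algebra_map \<psi>" "\<And>g. g \<in> gens (contract D p m) \<Longrightarrow>
      \<psi> (el (contract D p m) (gen g)) = el D (Psi_gen D p m \<epsilon> g)"
    and \<psi>': "algebra_map \<psi>'" "\<And>g. g \<in> gens (contract D p m) \<Longrightarrow>
      \<psi>' (el (contract D p m) (gen g)) = el D (Psi_gen D p m (- \<epsilon>) g)"
    and \<xi>: "algebra_map \<xi>" "\<And>g. g \<in> gens (contract D p m) \<Longrightarrow>
      \<xi> (el (contract D p m) (gen g)) = el D (chi_gen D p m \<epsilon> s g)"
    and g: "g \<in> gens (contract D p m)"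
  shows "\<exists>w. \<tau> (\<psi> (el (contract D p m) (gen g))) = \<psi>' w \<and> \<xi> w = \<psi> (Th (el (contract D p m) (gen g)))"
proof -
  let ?C = "contract D p m"
  note th = rescaled_braidD[OF Th]
  note cs = contract_simps[OF pm(3)]
  note maps = algebra_map_simps[OF \<psi>(1)] algebra_map_simps[OF \<psi>'(1)] algebra_map_simps[OF \<xi>(1)]
    algebra_map_qbr[OF \<psi>(1)] algebra_map_qbr[OF \<psi>'(1)] algebra_map_qbr[OF \<xi>(1)]
  note vals = \<psi>(2) \<psi>'(2) \<xi>(2)
  have Kt: "UKt ?C t None = UK ?C (zscale (t * (form D p p div 2)) (cor D p + cor D m))" for t
    by (simp add: Kt_def cs facts)
  show ?thesis
  proof (cases g)
    case (K \<mu>)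
    show ?thesis
      by (rule exI[of _ "UK ?C (srefl ?C None \<mu>)"]) (simp add: K vals th(2) tau_UK)
  next
    case (E a)
    show ?thesis
    proof (cases a)
      case None
      have "inverse (u ^ 4) * inverse Q * (- (Q * u ^ 2)) = - inverse (u ^ 2)"
        using u by (simp add: field_simps flip: power_add)
      then show ?thesis
        by (intro exI[of _ "(inverse (u ^ 4) * inverse Q) *s (UKt ?C e None * UF ?C None)"])
          (simp add: E None vals maps th(3) tau_E0 Kt K0_def cs chi_gen_None del: chi_gen.simps(2,3))
    next
      case (Some j)
      then have j: "j \<in> idx D - {p, m}" using g E by (auto simp: cs)
      define n where n: "n = nat (- pair D (cor D p + cor D m) (rt D j))"
      define d where "d = - inverse (Q * u ^ 2)"
      note chi0 = chi_gen_None(1)[folded d_def]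
      \<comment> \<open>\<open>k ^ n\<close>, \<open>d ^ n\<close> and \<open>lam ^ n\<close> come from \<open>\<tau>\<close>, from \<open>\<chi>\<close> at \<open>E\<^sub>i\<^sub>0\<close> and from \<open>\<chi>\<close> at \<open>E\<^sub>j\<close>\<close>
      define k where "k = (u ^ 2 * (if e * \<epsilon> = -1 then - Q else 1))"
      have t: "Th (UE ?C (Some j)) = u ^ n *s qbr Q n (UE ?C None) (UE ?C (Some j))"
        by (rule th(5)) (use j in \<open>auto simp: cs n Q_eqs\<close>)
      have "k * d * lam = u"
        using u by (simp add: k_def d_def lam_def field_simps power2_eq_square)
      then have "k ^ n * (d ^ n * lam ^ n) = u ^ n"
        by (simp only: power_mult_distrib[symmetric] mult.assoc[symmetric])
      moreover have "\<tau> (UE D j) = k ^ n *s qbr Q n (el D (E0 D p m (- \<epsilon>))) (UE D j)"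
        unfolding tau_other(1)[OF j n] by (simp add: k_def power_mult power_mult_distrib)
      ultimately show ?thesis using j
        by (intro exI[of _ "k ^ n *s qbr Q n (UE ?C None) (UE ?C (Some j))"])
          (simp add: E Some vals maps t cs chi0 chi_gen_Some[OF j n] qbr_smul_op qbr_smul_base
              mult.commute[of "d ^ n"] del: chi_gen.simps(2,3))
    qed
  next
    case (F a)
    show ?thesis
    proof (cases a)
      case None
      have "u ^ 4 * Q * (- inverse (Q * u ^ 2)) = - (u ^ 2)"
        using u by (simp add: field_simps flip: power_add)
      then show ?thesis
        by (intro exI[of _ "(u ^ 4 * Q) *s (UE ?C None * UKt ?C (- e) None)"])
          (simp add: F None vals maps th(4) tau_F0 Kt K0_def cs chi_gen_None del: chi_gen.simps(2,3))
    next
      case (Some j)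
      then have j: "j \<in> idx D - {p, m}" using g F by (auto simp: cs)
      define n where n: "n = nat (- pair D (cor D p + cor D m) (rt D j))"
      define c where "c = inverse (- (Q * u))"
      define d where "d = - (Q * u ^ 2)"
      note chi0 = chi_gen_None(2)[folded d_def]
      define k where "k = (c ^ 2 * (if e * \<epsilon> = -1 then 1 else - Q))"
      have t: "Th (UF ?C (Some j)) = c ^ n *s qbr Q n (UF ?C None) (UF ?C (Some j))"
        unfolding c_def by (rule th(6)) (use j in \<open>auto simp: cs n Q_eqs\<close>)
      have "k * d * inverse lam = c"
        using u by (simp add: k_def d_def lam_def c_def field_simps power2_eq_square)
      then have "k ^ n * (d ^ n * inverse lam ^ n) = c ^ n"
        by (simp only: power_mult_distrib[symmetric] mult.assoc[symmetric])
      moreover have "\<tau> (UF D j) = k ^ n *s qbr Q n (el D (F0 D p m (- \<epsilon>))) (UF D j)"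
        unfolding tau_other(2)[OF j n] by (simp add: k_def c_def power_mult power_mult_distrib)
      ultimately show ?thesis using j
        by (intro exI[of _ "k ^ n *s qbr Q n (UF ?C None) (UF ?C (Some j))"])
          (simp add: F Some vals maps t cs chi0 chi_gen_Some[OF j n] qbr_smul_op qbr_smul_base
              mult.commute[of "d ^ n"] del: chi_gen.simps(2,3))
    qed
  qed
qed

lemma tau_intertwines:
  assumes Th: "rescaled_braid (contract D p m) e u None Th"
    and \<psi>: "algebra_map \<psi>" "\<And>g. g \<in> gens (contract D p m) \<Longrightarrow>
      \<psi> (el (contract D p m) (gen g)) = el D (Psi_gen D p m \<epsilon> g)"
    and \<psi>': "algebra_map \<psi>'" "\<And>g. g \<in> gens (contract D p m) \<Longrightarrow>
      \<psi>' (el (contract D p m) (gen g)) = el D (Psi_gen D p m (- \<epsilon>) g)"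
    and \<xi>: "algebra_map \<xi>" "\<And>g. g \<in> gens (contract D p m) \<Longrightarrow>
      \<xi> (el (contract D p m) (gen g)) = el D (chi_gen D p m \<epsilon> s g)"
    and q: "q \<in> carrier (free_alg (contract D p m))"
  shows "\<exists>w. \<tau> (\<psi> (el (contract D p m) q)) = \<psi>' w \<and> \<xi> w = \<psi> (Th (el (contract D p m) q))"
  using q
proof (induction q rule: el_induct)
  case (add a b)
  then obtain w w' where "\<tau> (\<psi> a) = \<psi>' w \<and> \<xi> w = \<psi> (Th a)" "\<tau> (\<psi> b) = \<psi>' w' \<and> \<xi> w' = \<psi> (Th b)" by blast
  then show ?case
    by (intro exI[of _ "w + w'"]) (simp add: algebra_map_simps[OF tau_algebra_map] algebra_map_simps[OF \<psi>(1)]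
        algebra_map_simps[OF \<psi>'(1)] algebra_map_simps[OF \<xi>(1)] algebra_map_simps[OF rescaled_braidD(1)[OF Th]])
next
  case (mult a b)
  then obtain w w' where "\<tau> (\<psi> a) = \<psi>' w \<and> \<xi> w = \<psi> (Th a)" "\<tau> (\<psi> b) = \<psi>' w' \<and> \<xi> w' = \<psi> (Th b)" by blast
  then show ?case
    by (intro exI[of _ "w * w'"]) (simp add: algebra_map_simps[OF tau_algebra_map] algebra_map_simps[OF \<psi>(1)]
        algebra_map_simps[OF \<psi>'(1)] algebra_map_simps[OF \<xi>(1)] algebra_map_simps[OF rescaled_braidD(1)[OF Th]])
next
  case (smul c a)
  then obtain w where "\<tau> (\<psi> a) = \<psi>' w \<and> \<xi> w = \<psi> (Th a)" by blast
  then show ?case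
    by (intro exI[of _ "c *s w"]) (simp add: algebra_map_simps[OF tau_algebra_map] algebra_map_simps[OF \<psi>(1)]
        algebra_map_simps[OF \<psi>'(1)] algebra_map_simps[OF \<xi>(1)] algebra_map_simps[OF rescaled_braidD(1)[OF Th]])
next
  case (gen g)
  then show ?case by (intro tau_intertwines_generators Th \<psi> \<psi>' \<xi>)
qed

end

end

section \<open>Compatibility with the edge contraction\<close>

lemma qbr_commuting_factor:
  assumes "a * x = x * a"
  shows "qbr Q n x (a * z - c *s (z * a)) = a * qbr Q n x z - c *s (qbr Q n x z * a)"
    "qbr Q n x (z * a - c *s (a * z)) = qbr Q n x z * a - c *s (a * qbr Q n x z)"
  by (simp_all add: qbr_def qiter_diff qiter_smul_base qiter_commute_left[OF assms]
      qiter_commute_right[OF assms] smul_distribs mult.commute[of c])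

text \<open>
  The only generators for which there is something to show are those at the contracted index: of the two factors of
  \<open>E\<^sub>i\<^sub>0\<close>, the one at the end vertex is fixed by \<open>T\<close> and passes through the bracket by \<open>E\<^sub>j\<close>.
\<close>

lemma other_symmetry_intertwines:
  fixes D :: "('i, 'y::ab_group_add, 'x::ab_group_add) root_datum"
  assumes rd: "is_root_datum D" and ct: "contractible D p m"
    and ev: "end_vertex D p m p \<or> end_vertex D p m m" and j: "j \<in> idx D - {p, m}"
    and T: "rescaled_braid D e u j T" and Th: "rescaled_braid (contract D p m) e u (Some j) Th"
    and \<psi>: "algebra_map \<psi>" "\<And>g. g \<in> gens (contract D p m) \<Longrightarrow>
      \<psi> (el (contract D p m) (gen g)) = el D (Psi_gen D p m \<epsilon> g)"
    and q: "q \<in> carrier (free_alg (contract D p m))"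
  shows "\<psi> (Th (el (contract D p m) q)) = T (\<psi> (el (contract D p m) q))"
  using q
proof (induction q rule: el_induct)
  case (gen g)
  let ?C = "contract D p m"
  note f = contractible_facts[OF rd ct]
  note cs = contract_simps[OF f(3)]
  note t = rescaled_braidD[OF T] and th = rescaled_braidD[OF Th]
  note maps = algebra_map_simps[OF \<psi>(1)] algebra_map_qbr[OF \<psi>(1)] algebra_map_simps[OF t(1)]
  have jj: "j \<in> idx D" "j \<noteq> p" "j \<noteq> m" "p \<noteq> j" "m \<noteq> j" using j by auto
  have vi: "vi ?C (Some j) = vi D j" by (simp add: vi_def cs)
  have Kt: "UKt ?C s (Some j) = UK ?C (zscale (s * (form D j j div 2)) (cor D j))" for s
    by (simp add: Kt_def cs)
  have orth: "UE D i * UE D j = UE D j * UE D i" "UF D i * UF D j = UF D j * UF D i"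
    "T (UE D i) = UE D i" "T (UF D i) = UF D i"
    if i: "end_vertex D p m i" "i = p \<or> i = m" for i
  proof -
    have i': "i \<in> idx D" "i \<noteq> j" using i(2) f jj by auto
    note ep = end_vertex_pair[OF rd i(1) i'(1) j]
    show "UE D i * UE D j = UE D j * UE D i" "UF D i * UF D j = UF D j * UF D i"
      using serre_orthogonal[OF rd _ i'(1) jj(1) i'(2) ep(1), of E]
        serre_orthogonal[OF rd _ i'(1) jj(1) i'(2) ep(1), of F] by simp_all
    show "T (UE D i) = UE D i" "T (UF D i) = UF D i"
      using t(5)[OF i' refl refl] t(6)[OF i' refl refl] by (simp_all add: ep)
  qed
  define n where n: "n = nat (- pair D (cor D j) (rt D p + rt D m))"
  define Q where Q: "Q = vi D j powi e"
  have key: "T (el D (E0 D p m \<epsilon>)) = u ^ n *s qbr Q n (UE D j) (el D (E0 D p m \<epsilon>))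
      \<and> T (el D (F0 D p m \<epsilon>)) = inverse (- (Q * u)) ^ n *s qbr Q n (UF D j) (el D (F0 D p m \<epsilon>))"
    using ev
  proof
    assume p: "end_vertex D p m p"
    have "n = nat (- pair D (cor D j) (rt D m))"
      using end_vertex_pair[OF rd p f(1) j] by (simp add: n root_datum_pair[OF rd])
    note tt = t(5)[OF f(2) jj(5) this Q] t(6)[OF f(2) jj(5) this Q]
    show ?thesis
      by (simp add: el_E0[OF f(1,2)] el_F0[OF f(1,2)] maps tt orth(3,4)[OF p] qbr_commuting_factor[OF orth(1)[OF p]]
          qbr_commuting_factor[OF orth(2)[OF p]] smul_distribs mult.commute)
  next
    assume m: "end_vertex D p m m"
    have "n = nat (- pair D (cor D j) (rt D p))"
      using end_vertex_pair[OF rd m f(2) j] by (simp add: n root_datum_pair[OF rd])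
    note tt = t(5)[OF f(1) jj(4) this Q] t(6)[OF f(1) jj(4) this Q]
    show ?thesis
      by (simp add: el_E0[OF f(1,2)] el_F0[OF f(1,2)] maps tt orth(3,4)[OF m] qbr_commuting_factor[OF orth(1)[OF m]]
          qbr_commuting_factor[OF orth(2)[OF m]] smul_distribs mult.commute)
  qed
  show ?case
  proof (cases g)
    case (K \<mu>)
    then show ?thesis by (simp add: \<psi>(2) t(2) th(2) srefl_def cs)
  next
    case (E a)
    show ?thesis
    proof (cases a)
      case None
      have "Th (UE ?C None) = u ^ n *s qbr Q n (UE ?C (Some j)) (UE ?C None)"
        by (rule th(5)) (auto simp: cs n Q vi)
      then show ?thesis using j by (simp add: E None \<psi>(2) cs maps key)
    next
      case (Some k)
      then have k: "k \<in> idx D - {p, m}" using gen E by (auto simp: cs)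
      show ?thesis
      proof (cases "k = j")
        case True
        then show ?thesis using j by (simp add: E Some \<psi>(2) cs maps t(3) th(3) Kt Kt_def)
      next
        case False
        then show ?thesis
          using j k th(5)[of "Some k", OF _ _ refl refl] t(5)[of k, OF _ _ refl refl]
          by (simp add: E Some \<psi>(2) cs maps vi)
      qed
    qed
  next
    case (F a)
    show ?thesis
    proof (cases a)
      case None
      have "Th (UF ?C None) = inverse (- (Q * u)) ^ n *s qbr Q n (UF ?C (Some j)) (UF ?C None)"
        by (rule th(6)) (auto simp: cs n Q vi)
      then show ?thesis using j by (simp add: F None \<psi>(2) cs maps key)
    next
      case (Some k)
      then have k: "k \<in> idx D - {p, m}" using gen F by (auto simp: cs)
      show ?thesis
      proof (cases "k = j")
        case True
        then show ?thesis using j by (simp add: F Some \<psi>(2) cs maps t(4) th(4) Kt Kt_def)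
      next
        case False
        then show ?thesis
          using j k th(6)[of "Some k", OF _ _ refl refl] t(6)[of k, OF _ _ refl refl]
          by (simp add: F Some \<psi>(2) cs maps vi)
      qed
    qed
  qed
qed (simp_all add: algebra_map_simps[OF \<psi>(1)] algebra_map_simps[OF rescaled_braidD(1)[OF T]]
    algebra_map_simps[OF rescaled_braidD(1)[OF Th]])


text \<open>
  The map \<open>\<chi>\<close> is defined only on the image of \<open>\<Psi>\<close> for the sign \<open>- \<epsilon>\<close>. Composed with this \<open>\<Psi>\<close> it becomes a
  homomorphism on the whole contracted algebra, given by its values on generators.
\<close>

lemma chi_comp_Psi_alg_hom:
  fixes D :: "('i, 'y::ab_group_add, 'x::ab_group_add) root_datum"
  assumes \<Psi>: "\<forall>s\<in>{1, -1}. is_Psi D p m s (\<Psi> s)" and \<epsilon>: "\<epsilon> \<in> {1, -1}"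
    and \<chi>: "is_chi D p m \<Psi> \<epsilon> s f"
  shows "hom_on_gens (contract D p m) D (chi_gen D p m \<epsilon> s) (f \<circ> \<Psi> (- \<epsilon>))"
proof -
  let ?C = "contract D p m"
  have P: "\<Psi> \<epsilon> \<in> alg_hom (U ?C) (U D)" "\<Psi> (- \<epsilon>) \<in> alg_hom (U ?C) (U D)"
    and v: "\<And>g. g \<in> gens ?C \<Longrightarrow> \<Psi> (- \<epsilon>) (cls ?C (gen g)) = cls D (Psi_gen D p m (- \<epsilon>) g)"
    using \<Psi> \<epsilon> by (auto simp: is_Psi_def hom_on_gens_def)
  have f: "f \<in> alg_hom (Vsub D p m (\<Psi> (- \<epsilon>))) (Vsub D p m (\<Psi> \<epsilon>))"
    and w: "\<And>g. g \<in> gens ?C \<Longrightarrow> f (cls D (Psi_gen D p m (- \<epsilon>) g)) = cls D (chi_gen D p m \<epsilon> s g)"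
    using \<chi> by (auto simp: is_chi_def)
  have V: "monoid.mult (Vsub D p m h) = monoid.mult (U D)" "add (Vsub D p m h) = add (U D)"
    "one (Vsub D p m h) = one (U D)" "module.smult (Vsub D p m h) = module.smult (U D)"
    "carrier (Vsub D p m h) = h ` carrier (U ?C)" for h
    by (simp_all add: Vsub_def)
  note f' = alg_homD[OF f, unfolded V] and P' = alg_homD[OF P(2)]
  have closed: "f (\<Psi> (- \<epsilon>) x) \<in> carrier (U D)" if "x \<in> carrier (U ?C)" for x
    using f'(1)[OF imageI[OF that]] alg_homD(1)[OF P(1)] by auto
  have "f \<circ> \<Psi> (- \<epsilon>) \<in> alg_hom (U ?C) (U D)"
    unfolding alg_hom_def ring_hom_def
    using closed f'(2-5) P'(2-5) by auto
  then show ?thesis using v w by (simp add: hom_on_gens_def)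
qed

lemma is_Psi_lift:
  assumes "is_Psi D p m s f"
  shows "algebra_map (lift_hom (contract D p m) D f)"
    "g \<in> gens (contract D p m) \<Longrightarrow>
      lift_hom (contract D p m) D f (el (contract D p m) (gen g)) = el D (Psi_gen D p m s g)"
  using assms lift_hom_gen[of "contract D p m" D _ f]
  by (auto simp: is_Psi_def hom_on_gens_def intro: lift_hom_algebra_map)

lemma contracted_index_compatible:
  fixes D :: "('i, 'y::ab_group_add, 'x::ab_group_add) root_datum"
  assumes rd: "is_root_datum D" and ct: "contractible D p m"
    and e: "e \<in> {1, -1}" and \<epsilon>: "\<epsilon> \<in> {1, -1}"
    and ev: "(e * \<epsilon> = -1 \<and> end_vertex D p m p) \<or> (e * \<epsilon> = 1 \<and> end_vertex D p m m)"
    and \<Psi>: "\<forall>s\<in>{1, -1}. is_Psi D p m s (\<Psi> s)" and \<chi>: "is_chi D p m \<Psi> \<epsilon> s f"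
    and s: "(u = 1 \<and> s = e * \<epsilon>) \<or> (u = - inverse (vi D p powi e) \<and> s = - e * \<epsilon>)"
    and T: "T p \<in> alg_hom (U D) (U D)" "T m \<in> alg_hom (U D) (U D)"
      "rescaled_braid D e u p (lift_hom D D (T p))" "rescaled_braid D e u m (lift_hom D D (T m))"
    and Th: "Th \<in> alg_hom (U (contract D p m)) (U (contract D p m))"
      "rescaled_braid (contract D p m) e u None (lift_hom (contract D p m) (contract D p m) Th)"
    and x: "x \<in> carrier (U (contract D p m))"
  shows "\<Psi> \<epsilon> (Th x) = f (T p (T m (T p (\<Psi> \<epsilon> x))))"
proof -
  let ?C = "contract D p m"
  have "vi D p powi e \<noteq> 0" by (simp add: vi_sign_eq)
  then have u: "u \<noteq> 0" using s by auto
  interpret contracted_symmetry D p m e \<epsilon> u "lift_hom D D (T p)" "lift_hom D D (T m)"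
    by standard (use rd ct e \<epsilon> ev u T in auto)
  let ?\<xi> = "f \<circ> \<Psi> (- \<epsilon>)"
  have P: "is_Psi D p m \<epsilon> (\<Psi> \<epsilon>)" "is_Psi D p m (- \<epsilon>) (\<Psi> (- \<epsilon>))" using \<Psi> \<epsilon> by auto
  have Ph: "\<Psi> \<epsilon> \<in> alg_hom (U ?C) (U D)" "\<Psi> (- \<epsilon>) \<in> alg_hom (U ?C) (U D)"
    using P by (auto simp: is_Psi_def hom_on_gens_def)
  have \<xi>: "hom_on_gens ?C D (chi_gen D p m \<epsilon> s) ?\<xi>" by (rule chi_comp_Psi_alg_hom[OF \<Psi> \<epsilon> \<chi>])
  then have \<xi>h: "?\<xi> \<in> alg_hom (U ?C) (U D)" by (simp add: hom_on_gens_def)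
  obtain q where q: "q \<in> carrier (free_alg ?C)" "x = cls ?C q" using x by (rule carrier_U_E)
  have "\<exists>w. \<tau> (lift_hom ?C D (\<Psi> \<epsilon>) (el ?C q)) = lift_hom ?C D (\<Psi> (- \<epsilon>)) w
      \<and> lift_hom ?C D ?\<xi> w = lift_hom ?C D (\<Psi> \<epsilon>) (lift_hom ?C ?C Th (el ?C q))"
    by (rule tau_intertwines[OF s[folded Q_def] Th(2) is_Psi_lift(1)[OF P(1)] _ is_Psi_lift(1)[OF P(2)] _
        lift_hom_algebra_map[OF \<xi>h] _ q(1)])
      (use is_Psi_lift(2)[OF P(1)] is_Psi_lift(2)[OF P(2)] lift_hom_gen[OF \<xi>] in auto)
  then obtain w where w: "\<tau> (lift_hom ?C D (\<Psi> \<epsilon>) (el ?C q)) = lift_hom ?C D (\<Psi> (- \<epsilon>)) w"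
    "lift_hom ?C D ?\<xi> w = lift_hom ?C D (\<Psi> \<epsilon>) (lift_hom ?C ?C Th (el ?C q))" by blast
  note cl = alg_homD(1)[OF Ph(1)] alg_homD(1)[OF Ph(2)] alg_homD(1)[OF \<xi>h] alg_homD(1)[OF T(1)]
    alg_homD(1)[OF T(2)] alg_homD(1)[OF Th(1)] at_datum_closed
  have el: "el ?C q = emb ?C x" by (simp add: el_def q)
  have "emb D (T p (T m (T p (\<Psi> \<epsilon> x)))) = emb D (\<Psi> (- \<epsilon>) (at_datum ?C w))"
    using w(1) x by (simp add: \<tau>_def el lift_hom_emb cl) (simp add: lift_hom_def)
  then have 1: "T p (T m (T p (\<Psi> \<epsilon> x))) = \<Psi> (- \<epsilon>) (at_datum ?C w)"
    by (rule emb_inject[rotated 2]) (use x in \<open>simp_all add: cl\<close>)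
  have "emb D (f (\<Psi> (- \<epsilon>) (at_datum ?C w))) = emb D (\<Psi> \<epsilon> (Th x))"
    using w(2) x by (simp add: el lift_hom_emb cl) (simp add: lift_hom_def)
  then have "f (\<Psi> (- \<epsilon>) (at_datum ?C w)) = \<Psi> \<epsilon> (Th x)"
    by (rule emb_inject[rotated 2]) (use x cl(3)[of "at_datum ?C w"] in \<open>simp_all add: cl\<close>)
  with 1 show ?thesis by simp
qed

lemma other_index_compatible:
  fixes D :: "('i, 'y::ab_group_add, 'x::ab_group_add) root_datum"
  assumes rd: "is_root_datum D" and ct: "contractible D p m"
    and ev: "end_vertex D p m p \<or> end_vertex D p m m" and j: "j \<in> idx D - {p, m}"
    and P: "is_Psi D p m \<epsilon> h"
    and T: "T \<in> alg_hom (U D) (U D)" "rescaled_braid D e u j (lift_hom D D T)"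
    and Th: "Th \<in> alg_hom (U (contract D p m)) (U (contract D p m))"
      "rescaled_braid (contract D p m) e u (Some j) (lift_hom (contract D p m) (contract D p m) Th)"
    and x: "x \<in> carrier (U (contract D p m))"
  shows "h (Th x) = T (h x)"
proof -
  let ?C = "contract D p m"
  obtain q where q: "q \<in> carrier (free_alg ?C)" "x = cls ?C q" using x by (rule carrier_U_E)
  have h: "h \<in> alg_hom (U ?C) (U D)" using P by (auto simp: is_Psi_def hom_on_gens_def)
  note cl = alg_homD(1)[OF h] alg_homD(1)[OF T(1)] alg_homD(1)[OF Th(1)]
  have "lift_hom ?C D h (lift_hom ?C ?C Th (el ?C q)) = lift_hom D D T (lift_hom ?C D h (el ?C q))"
    by (rule other_symmetry_intertwines[OF rd ct ev j T(2) Th(2) is_Psi_lift(1)[OF P] _ q(1)])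
      (rule is_Psi_lift(2)[OF P])
  then have "emb D (h (Th x)) = emb D (T (h x))"
    using x by (simp add: el_def lift_hom_emb cl flip: q(2))
  then show ?thesis by (rule emb_inject[rotated 2]) (use x in \<open>simp_all add: cl\<close>)
qed

theorem theorem5p2p4:
  fixes D :: "('i, 'y::ab_group_add, 'x::ab_group_add) root_datum"
    and ip im :: 'i
    and e \<epsilon> :: int
    and \<Psi> :: "int \<Rightarrow> ('i option, 'y) falg set \<Rightarrow> ('i, 'y) falg set"
    and \<chi> :: "int \<Rightarrow> ('i, 'y) falg set \<Rightarrow> ('i, 'y) falg set"
    and T1 T2 :: "'i \<Rightarrow> ('i, 'y) falg set \<Rightarrow> ('i, 'y) falg set"
    and T1h T2h :: "'i option \<Rightarrow> ('i option, 'y) falg set \<Rightarrow> ('i option, 'y) falg set"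
  assumes "is_root_datum D"
    and "contractible D ip im"
    and "e \<in> {1, -1}" and "\<epsilon> \<in> {1, -1}"
    and "(e * \<epsilon> = -1 \<and> end_vertex D ip im ip) \<or> (e * \<epsilon> = 1 \<and> end_vertex D ip im im)"
    and "\<forall>s\<in>{1, -1}. is_Psi D ip im s (\<Psi> s)"
    and "\<forall>s\<in>{1, -1}. is_chi D ip im \<Psi> \<epsilon> s (\<chi> s)"
    and "lusztig_T1 D e T1" and "lusztig_T2 D e T2"
    and "lusztig_T1 (contract D ip im) e T1h" and "lusztig_T2 (contract D ip im) e T2h"
  shows "\<forall>i\<in>idx (contract D ip im). \<forall>u\<in>carrier (U (contract D ip im)).
           \<Psi> \<epsilon> (T1h i u) = contr_T ip im (\<chi> (e * \<epsilon>)) T1 i (\<Psi> \<epsilon> u)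
         \<and> \<Psi> \<epsilon> (T2h i u) = contr_T ip im (\<chi> (- e * \<epsilon>)) T2 i (\<Psi> \<epsilon> u)"
proof (intro ballI)
  fix a x
  let ?C = "contract D ip im"
  assume a: "a \<in> idx ?C" and x: "x \<in> carrier (U ?C)"
  note rd = assms(1) and ct = assms(2) and e = assms(3) and \<epsilon> = assms(4) and ev = assms(5)
  note T1 = assms(8) and T2 = assms(9) and T1h = assms(10) and T2h = assms(11)
  note f = contractible_facts[OF rd ct] and rdC = contract_root_datum[OF rd ct]
  note cs = contract_simps[OF f(3)]
  have P: "is_Psi D ip im \<epsilon> (\<Psi> \<epsilon>)" using assms(6) \<epsilon> by auto
  have \<chi>: "is_chi D ip im \<Psi> \<epsilon> (e * \<epsilon>) (\<chi> (e * \<epsilon>))" "is_chi D ip im \<Psi> \<epsilon> (- e * \<epsilon>) (\<chi> (- e * \<epsilon>))"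
    using assms(7) e \<epsilon> by auto
  have hom1: "T1 i \<in> alg_hom (U D) (U D)" "T2 i \<in> alg_hom (U D) (U D)" if "i \<in> idx D" for i
    using T1 T2 that by (auto simp: lusztig_T1_def lusztig_T2_def hom_on_gens_def)
  have homC: "T1h a \<in> alg_hom (U ?C) (U ?C)" "T2h a \<in> alg_hom (U ?C) (U ?C)"
    using T1h T2h a by (auto simp: lusztig_T1_def lusztig_T2_def hom_on_gens_def)
  note r1 = lusztig_T1_rescaled[OF rd e T1] and r2 = lusztig_T2_rescaled[OF rd e T2]
  note c1 = lusztig_T1_rescaled[OF rdC e T1h a] and c2 = lusztig_T2_rescaled[OF rdC e T2h a]
  show "\<Psi> \<epsilon> (T1h a x) = contr_T ip im (\<chi> (e * \<epsilon>)) T1 a (\<Psi> \<epsilon> x)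
      \<and> \<Psi> \<epsilon> (T2h a x) = contr_T ip im (\<chi> (- e * \<epsilon>)) T2 a (\<Psi> \<epsilon> x)"
  proof (cases a)
    case None
    have v: "vi D im = vi D ip" "vi ?C None = vi D ip" by (simp_all add: vi_def f)
    have "\<Psi> \<epsilon> (T1h None x) = \<chi> (e * \<epsilon>) (T1 ip (T1 im (T1 ip (\<Psi> \<epsilon> x))))"
      by (rule contracted_index_compatible[OF rd ct e \<epsilon> ev assms(6) \<chi>(1) _ hom1(1)[OF f(1)] hom1(1)[OF f(2)]
          r1[OF f(1)] r1[OF f(2)] homC(1)[unfolded None] c1[unfolded None] x]) simp
    moreover have "\<Psi> \<epsilon> (T2h None x) = \<chi> (- e * \<epsilon>) (T2 ip (T2 im (T2 ip (\<Psi> \<epsilon> x))))"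
      by (rule contracted_index_compatible[OF rd ct e \<epsilon> ev assms(6) \<chi>(2) _ hom1(2)[OF f(1)] hom1(2)[OF f(2)]
          r2[OF f(1)] r2[OF f(2), unfolded v] homC(2)[unfolded None] c2[unfolded None v] x]) simp
    ultimately show ?thesis by (simp add: None)
  next
    case (Some j)
    then have j: "j \<in> idx D - {ip, im}" "j \<in> idx D" using a by (auto simp: cs)
    have ev': "end_vertex D ip im ip \<or> end_vertex D ip im im" using ev by blast
    have v: "vi ?C (Some j) = vi D j" by (simp add: vi_def cs)
    have "\<Psi> \<epsilon> (T1h (Some j) x) = T1 j (\<Psi> \<epsilon> x)"
      by (rule other_index_compatible[OF rd ct ev' j(1) P hom1(1)[OF j(2)] r1[OF j(2)]
          homC(1)[unfolded Some] c1[unfolded Some] x])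
    moreover have "\<Psi> \<epsilon> (T2h (Some j) x) = T2 j (\<Psi> \<epsilon> x)"
      by (rule other_index_compatible[OF rd ct ev' j(1) P hom1(2)[OF j(2)] r2[OF j(2)]
          homC(2)[unfolded Some] c2[unfolded Some v] x])
    ultimately show ?thesis by (simp add: Some)
  qed
qed


end
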